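(* Consider the federated problem $\min_{\mathbf{X}} f(\mathbf{X})=\frac1N\sum_{j=1}^N f_j(\mathbf{X})$ over layer tuples $\mathbf{X}=[\mathbf{X}_1,\dots,\mathbf{X}_p]$, $\mathbf{X}_i\in\mathbb{R}^{m_i\times n_i}$, and the methods EF21-MuonUSign and EF21-MuonSign, with momentum coefficient $\mu\in[0,1)$. Assume lower boundedness ($f\ge f^*>-\infty$) and the stochastic-gradient assumption described in the context. (i) (Smooth case; EF21-MuonUSign and EF21-MuonSign.) Assume layer-wise smoothness: for $g=f$ (with constants $L_i$) and for each $g=f_j$ (with constants $L_{i,j}$), for every layer $i$ and all tuples $\mathbf{X},\mathbf{Y}$, $\|\nabla_i g(\mathbf{X})-\nabla_i g(\mathbf{Y})\|_*\le L_i^g\|\mathbf{X}_i-\mathbf{Y}_i\|_{2\to2}$. Then for each of the two methods there are a constant $C$ independent of $T$ and, for every $T\ge1$, a choice of $\gamma=\gamma(T)>0$ and $\mu=\mu(T)\in[0,1)$ such that the method run with learning rates $\eta_{t,i}=\gamma\,\|\mathbf{g}_{t,i}\|_*$ satisfies $$\frac1T\sum_{t=0}^{T-1}\mathbb{E}\|\nabla f(\mathbf{X}_t)\|_*^2\le C\,T^{-1/2}.$$ (ii) (Generalized smooth case; EF21-MuonUSign only.) Assume instead layer-wise $(L^0,L^1)$-smoothness: for $g=f$ and each $g=f_j$ there are constants $L_i^{0,g},L_i^{1,g}\ge0$ such that, for every layer $i$ and all tuples $\mathbf{X},\mathbf{Y}$, $\|\nabla_i g(\mathbf{X})-\nabla_i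 g(\mathbf{Y})\|_*\le\bigl(L_i^{0,g}+L_i^{1,g}\|\nabla_i g(\mathbf{X})\|_*\bigr)\|\mathbf{X}_i-\mathbf{Y}_i\|_{2\to2}$; assume also that each $f_j\ge f_j^*>-\infty$. Then there are a constant $C$ independent of $T$ and, for every $T\ge1$, a choice of $\mu=\mu(T)\in[0,1)$ and of a learning rate $\eta=\eta(T)>0$, constant in $t$ and common to all layers ($\eta_{t,i}\equiv\eta$), such that EF21-MuonUSign satisfies $$\min_{0\le t\le T}\ \sum_{i=1}^p\mathbb{E}\|\nabla_i f(\mathbf{X}_t)\|_*\le C\,T^{-1/4}.$$ For unequal per-layer constants in prescribed fixed positive ratios, i.e. $\eta_{t,i}=\gamma_i\|\mathbf{g}_{t,i}\|_*$ in (i) or $\eta_{t,i}\equiv\eta_i$ in (ii), the same statements hold with the left-hand sides replaced by $\frac1T\sum_{t<T}\sum_i w_i\,\mathbb{E}\|\nabla_i f(\mathbf{X}_t)\|_*^2$ with $w_i=\gamma_i/(\frac1p\sum_l\gamma_l)$, and by $\min_{0\le t\le T}\sum_i v_i\,\mathbb{E}\|\nabla_i f(\mathbf{X}_t)\|_*$ with $v_i=\eta_i/(\frac1p\sum_l\eta_l)$, respectively.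
   Context: $\|\cdot\|_{2\to2}$ is the spectral norm, $\|\cdot\|_*$ the nuclear norm, $\nabla_i$ the gradient block of layer $i$, and $\|\nabla f(\mathbf{X})\|_*^2:=\sum_{i=1}^p\|\nabla_i f(\mathbf{X})\|_*^2$. All $f_j$ are continuously differentiable. For $\mathbf{M}$ of rank $r$ with thin SVD $\mathbf{M}=\mathbf{U}\boldsymbol\Sigma\mathbf{V}^\top$ (one column per nonzero singular value), $\operatorname{polar}(\mathbf{M}):=\mathbf{U}\mathbf{V}^\top$ (and $\operatorname{polar}(\mathbf{0})=\mathbf{0}$). The scaled sign is $\mathcal{C}(\mathbf{Y})=\operatorname{mean}|\mathbf{Y}|\,\operatorname{sign}(\mathbf{Y})$, where $\operatorname{mean}|\mathbf{Y}|$ is the average absolute value of the entries and $\operatorname{sign}$ acts entrywise with values in $\{\pm1\}$, exact zeros being resolved to independent random $\pm1$. A second subscript selects a layer ($\mathbf{X}_{t,i}$, $\mathbf{g}_{t,i}$). Stochastic-gradient assumption: each client has a stochastic gradient $\nabla f_j(\mathbf{X};\xi)$, $\xi\sim\mathcal{D}_j$, with $\mathbb{E}_\xi[\nabla f_j(\mathbf{X};\xi)]=\nabla f_j(\mathbf{X})$ and $\mathbb{E}_\xi\|\nabla f_j(\mathbf{X};\xi)-\nabla f_j(\mathbf{X})\|_*^2\le\sigma^2$ for all $\mathbf{X}$; the samples $\xi_t^{(j)}$ are drawn independently across rounds and clients. Methods. $\mathbf{X}_0$ is given, $\mathbf{W}_0=\mathbf{X}_0$, $\mathbf{M}_0^{(j)}=\mathbf{g}_0^{(j)}=\mathbf{g}_0=\mathbf{0}$.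 In round $t\ge1$, with all operations layer by layer: each client $j$ computes $\mathbf{G}_t^{(j)}=\nabla f_j(\mathbf{W}_{t-1};\xi_t^{(j)})$, $\mathbf{M}_t^{(j)}=\mu\mathbf{M}_{t-1}^{(j)}+(1-\mu)\mathbf{G}_t^{(j)}$, and $\mathbf{g}_t^{(j)}=\mathbf{g}_{t-1}^{(j)}+\mathcal{C}(\mathbf{M}_t^{(j)}-\mathbf{g}_{t-1}^{(j)})$; the server computes $\mathbf{g}_t=\mathbf{g}_{t-1}+\frac1N\sum_{j=1}^N\mathcal{C}(\mathbf{M}_t^{(j)}-\mathbf{g}_{t-1}^{(j)})$ and $\mathbf{X}_{t,i}=\mathbf{X}_{t-1,i}-\eta_{t,i}\operatorname{polar}(\mathbf{g}_{t,i})$. The broadcast model is $\mathbf{W}_t=\mathbf{X}_t$ for EF21-MuonUSign and $\mathbf{W}_t=\mathbf{W}_{t-1}+\mathcal{C}(\mathbf{X}_t-\mathbf{W}_{t-1})$ (layer by layer) for EF21-MuonSign. Constants $C$ may depend on the problem (initial point, function lower bounds, smoothness constants, $\sigma$, $N$, $p$, layer dimensions, and the prescribed ratios) but not on $T$. *)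

theory Defs
  imports "HOL-Probability.Probability" "Jordan_Normal_Form.Matrix"
begin

no_notation vec_index (infixl "$" 100)

section \<open>Spectral norm, nuclear norm and polar factor of a real matrix\<close>

definition l2norm :: "real Matrix.vec \<Rightarrow> real" where
  "l2norm v = sqrt (scalar_prod v v)"

definition spectral_norm :: "real mat \<Rightarrow> real" where
  "spectral_norm A =
     Sup {l2norm (mult_mat_vec A v) | v. v \<in> carrier_vec (dim_col A) \<and> l2norm v \<le> 1}"

text \<open>The list \<open>s\<close> holds the nonzero singular values with multiplicity; its length is the rank,
  so the zero matrix has the empty decomposition.\<close>

definition thin_svd :: "real mat \<Rightarrow> real mat \<Rightarrow> real list \<Rightarrow> real mat \<Rightarrow> bool" where
  "thin_svd A U s V \<longleftrightarrow>
     U \<in> carrier_mat (dim_row A) (length s) \<and>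
     V \<in> carrier_mat (dim_col A) (length s) \<and>
     transpose_mat U * U = 1\<^sub>m (length s) \<and>
     transpose_mat V * V = 1\<^sub>m (length s) \<and>
     (\<forall>x\<in>set s. 0 < x) \<and>
     A = U * mat_diag (length s) (\<lambda>k. s ! k) * transpose_mat V"

text \<open>Thin singular value decompositions exist but are not unique; the sum of the singular values
  and the product of the two orthogonal factors do not depend on the chosen one.\<close>

definition nuclear_norm :: "real mat \<Rightarrow> real" where
  "nuclear_norm A = (THE x. \<exists>U s V. thin_svd A U s V \<and> x = sum_list s)"

definition polar :: "real mat \<Rightarrow> real mat" where
  "polar A = (THE P. \<exists>U s V. thin_svd A U s V \<and> P = U * transpose_mat V)"

section \<open>Layer tuples\<close>

text \<open>Layers are indexed by a finite type \<open>'l\<close>, so the number of layers is \<open>CARD('l)\<close>.  A layer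
  tuple is a point of the Euclidean space \<open>real ^ 'e\<close>, where \<open>'e\<close> enumerates the matrix entries of
  all layers: \<open>entry\<close> sends a coordinate to its layer, row and column.  The Euclidean inner product
  of \<open>real ^ 'e\<close> is thus the sum over the layers of the trace inner products.\<close>

record ('l, 'e) shape =
  rows :: "'l \<Rightarrow> nat"
  cols :: "'l \<Rightarrow> nat"
  entry :: "'e \<Rightarrow> 'l \<times> nat \<times> nat"

definition valid_shape :: "('l::finite, 'e::finite) shape \<Rightarrow> bool" where
  "valid_shape S \<longleftrightarrow>
     (\<forall>i. 1 \<le> rows S i \<and> 1 \<le> cols S i) \<and>
     bij_betw (entry S) UNIV (SIGMA i:UNIV. {..<rows S i} \<times> {..<cols S i})"

definition block :: "('l::finite, 'e::finite) shape \<Rightarrow> real ^ 'e \<Rightarrow> 'l \<Rightarrow> real mat" where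
  "block S X i = Matrix.mat (rows S i) (cols S i) (\<lambda>(a, b). X $ inv_into UNIV (entry S) (i, a, b))"

definition of_blocks :: "('l::finite, 'e::finite) shape \<Rightarrow> ('l \<Rightarrow> real mat) \<Rightarrow> real ^ 'e" where
  "of_blocks S B = (\<chi> e. case entry S e of (i, a, b) \<Rightarrow> B i $$ (a, b))"

lemma block_of_blocks:
  assumes "valid_shape S" and B: "\<And>i. B i \<in> carrier_mat (rows S i) (cols S i)"
  shows "block S (of_blocks S B) i = B i"
proof (rule eq_matI)
  have bij: "bij_betw (entry S) UNIV (SIGMA i:UNIV. {..<rows S i} \<times> {..<cols S i})"
    using assms(1) by (simp add: valid_shape_def)
  fix a b assume "a < dim_row (B i)" "b < dim_col (B i)"
  with B[of i] have ab: "a < rows S i" "b < cols S i" by auto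
  then have "entry S (inv_into UNIV (entry S) (i, a, b)) = (i, a, b)"
    using bij by (intro f_inv_into_f) (auto simp: bij_betw_def)
  with ab show "block S (of_blocks S B) i $$ (a, b) = B i $$ (a, b)"
    by (simp add: block_def of_blocks_def)
qed (use B[of i] in \<open>auto simp: block_def\<close>)

lemma of_blocks_block:
  assumes "valid_shape S"
  shows "of_blocks S (block S X) = X"
proof -
  have bij: "bij_betw (entry S) UNIV (SIGMA i:UNIV. {..<rows S i} \<times> {..<cols S i})"
    using assms by (simp add: valid_shape_def)
  have "(case entry S e of (i, a, b) \<Rightarrow> block S X i $$ (a, b)) = X $ e" for e
  proof -
    obtain i a b where e: "entry S e = (i, a, b)" by (cases "entry S e") auto
    have "entry S e \<in> (SIGMA i:UNIV. {..<rows S i} \<times> {..<cols S i})"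
      using bij UNIV_I by (rule bij_betw_apply)
    then have "a < rows S i" "b < cols S i" by (simp_all add: e)
    moreover have "inv_into UNIV (entry S) (i, a, b) = e"
      using inv_into_f_f[of "entry S" UNIV e] bij e by (simp add: bij_betw_def)
    ultimately show ?thesis using e by (simp add: block_def)
  qed
  then show ?thesis by (simp add: of_blocks_def vec_eq_iff)
qed

definition nuclear_norm_sq :: "('l::finite, 'e::finite) shape \<Rightarrow> real ^ 'e \<Rightarrow> real" where
  "nuclear_norm_sq S Z = (\<Sum>i\<in>UNIV. (nuclear_norm (block S Z i))\<^sup>2)"

section \<open>Objective functions\<close>

definition grad :: "(real ^ 'e::finite \<Rightarrow> real) \<Rightarrow> real ^ 'e \<Rightarrow> real ^ 'e" where
  "grad f X = (THE D. GDERIV f X :> D)"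

definition cont_differentiable :: "(real ^ 'e::finite \<Rightarrow> real) \<Rightarrow> bool" where
  "cont_differentiable f \<longleftrightarrow> (\<forall>X. f differentiable (at X)) \<and> continuous_on UNIV (grad f)"

definition average :: "('c::finite \<Rightarrow> real ^ 'e::finite \<Rightarrow> real) \<Rightarrow> real ^ 'e \<Rightarrow> real" where
  "average fs X = (\<Sum>j\<in>UNIV. fs j X) / real CARD('c)"

definition layer_smooth ::
  "('l::finite, 'e::finite) shape \<Rightarrow> (real ^ 'e \<Rightarrow> real) \<Rightarrow> ('l \<Rightarrow> real) \<Rightarrow> bool" where
  "layer_smooth S g L \<longleftrightarrow>
     (\<forall>i X Y. nuclear_norm (block S (grad g X) i - block S (grad g Y) i)
        \<le> L i * spectral_norm (block S X i - block S Y i))"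

definition layer_L0_L1_smooth ::
  "('l::finite, 'e::finite) shape \<Rightarrow> (real ^ 'e \<Rightarrow> real) \<Rightarrow> ('l \<Rightarrow> real) \<Rightarrow> ('l \<Rightarrow> real) \<Rightarrow> bool"
  where
  "layer_L0_L1_smooth S g L0 L1 \<longleftrightarrow>
     (\<forall>i. 0 \<le> L0 i \<and> 0 \<le> L1 i) \<and>
     (\<forall>i X Y. nuclear_norm (block S (grad g X) i - block S (grad g Y) i)
        \<le> (L0 i + L1 i * nuclear_norm (block S (grad g X) i))
           * spectral_norm (block S X i - block S Y i))"

section \<open>Scaled sign compression\<close>

definition mean_abs :: "real mat \<Rightarrow> real" where
  "mean_abs Y = (\<Sum>a<dim_row Y. \<Sum>b<dim_col Y. \<bar>Y $$ (a, b)\<bar>) / real (dim_row Y * dim_col Y)"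

text \<open>\<open>R\<close> supplies the signs that replace \<open>sgn 0\<close>.\<close>

definition scaled_sign :: "real mat \<Rightarrow> real mat \<Rightarrow> real mat" where
  "scaled_sign R Y = Matrix.mat (dim_row Y) (dim_col Y)
     (\<lambda>ab. mean_abs Y * (if Y $$ ab = 0 then R $$ ab else sgn (Y $$ ab)))"

definition compress ::
  "('l::finite, 'e::finite) shape \<Rightarrow> real ^ 'e \<Rightarrow> real ^ 'e \<Rightarrow> real ^ 'e" where
  "compress S R Y = of_blocks S (\<lambda>i. scaled_sign (block S R i) (block S Y i))"

section \<open>Randomness\<close>

text \<open>Clients are indexed by a finite type \<open>'c\<close>.  \<open>law j\<close> and \<open>stoch_grad j X z\<close> are the sampling
  distribution and the stochastic gradient of client \<open>j\<close>; everything random lives on \<open>base\<close>.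
  \<open>up_sign t j\<close> and \<open>down_sign t\<close> resolve the zeros in the messages of client \<open>j\<close> and of the server
  in round \<open>t\<close>.  Rounds are numbered from \<open>1\<close>; the values at \<open>t = 0\<close> are never used.\<close>

record ('c, 'e, 's, 'w) stochastics =
  law :: "'c \<Rightarrow> 's measure"
  stoch_grad :: "'c \<Rightarrow> real ^ 'e \<Rightarrow> 's \<Rightarrow> real ^ 'e"
  base :: "'w measure"
  sample :: "nat \<Rightarrow> 'c \<Rightarrow> 'w \<Rightarrow> 's"
  up_sign :: "nat \<Rightarrow> 'c \<Rightarrow> 'w \<Rightarrow> real ^ 'e"
  down_sign :: "nat \<Rightarrow> 'w \<Rightarrow> real ^ 'e"

definition stochastic_gradient ::
  "('l::finite, 'e::finite) shape \<Rightarrow> real \<Rightarrow> (real ^ 'e \<Rightarrow> real) \<Rightarrow> 's measure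
     \<Rightarrow> (real ^ 'e \<Rightarrow> 's \<Rightarrow> real ^ 'e) \<Rightarrow> bool" where
  "stochastic_gradient S \<sigma> f D G \<longleftrightarrow>
     prob_space D \<and>
     (\<lambda>(X, z). G X z) \<in> borel_measurable (borel \<Otimes>\<^sub>M D) \<and>
     (\<forall>X. has_bochner_integral D (G X) (grad f X)) \<and>
     (\<forall>X. (\<integral>\<^sup>+ z. ennreal (nuclear_norm_sq S (G X z - grad f X)) \<partial>D) \<le> ennreal (\<sigma>\<^sup>2))"

datatype ('c, 'e) source =
    Sample (rnd: nat) 'c
  | Up_Sign (rnd: nat) 'c 'e
  | Down_Sign (rnd: nat) 'e

text \<open>The generated events are those of \<open>indep_vars\<close>, which does not apply directly because the
  samples and the signs take values in different types.\<close>

fun source_events ::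
  "('c::finite, 'e::finite, 's, 'w) stochastics \<Rightarrow> ('c, 'e) source \<Rightarrow> 'w set set" where
  "source_events R (Sample t j) =
     {sample R t j -` A \<inter> space (base R) | A. A \<in> sets (law R j)}"
| "source_events R (Up_Sign t j e) =
     {(\<lambda>\<omega>. up_sign R t j \<omega> $ e) -` A \<inter> space (base R) | A. A \<in> sets borel}"
| "source_events R (Down_Sign t e) =
     {(\<lambda>\<omega>. down_sign R t \<omega> $ e) -` A \<inter> space (base R) | A. A \<in> sets borel}"

definition independent_sources :: "('c::finite, 'e::finite, 's, 'w) stochastics \<Rightarrow> bool" where
  "independent_sources R \<longleftrightarrow>
     prob_space (base R) \<and>
     (\<forall>t\<ge>1. \<forall>j. sample R t j \<in> measurable (base R) (law R j) \<and>
        distr (base R) (law R j) (sample R t j) = law R j) \<and>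
     (\<forall>t\<ge>1. \<forall>j e. (\<lambda>\<omega>. up_sign R t j \<omega> $ e) \<in> borel_measurable (base R) \<and>
        (\<forall>\<omega>\<in>space (base R). up_sign R t j \<omega> $ e \<in> {-1, 1})) \<and>
     (\<forall>t\<ge>1. \<forall>e. (\<lambda>\<omega>. down_sign R t \<omega> $ e) \<in> borel_measurable (base R) \<and>
        (\<forall>\<omega>\<in>space (base R). down_sign R t \<omega> $ e \<in> {-1, 1})) \<and>
     prob_space.indep_sets (base R) (source_events R) {k. 1 \<le> rnd k}"

definition admissible ::
  "('l::finite, 'e::finite) shape \<Rightarrow> real \<Rightarrow> ('c::finite \<Rightarrow> real ^ 'e \<Rightarrow> real)
     \<Rightarrow> ('c, 'e, 's, 'w) stochastics \<Rightarrow> bool" where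
  "admissible S \<sigma> fs R \<longleftrightarrow>
     (\<forall>j. stochastic_gradient S \<sigma> (fs j) (law R j) (stoch_grad R j)) \<and> independent_sources R"

section \<open>The two methods\<close>

datatype muon = EF21_MuonUSign | EF21_MuonSign

record ('c, 'e) state =
  model :: "real ^ 'e"
  broadcast :: "real ^ 'e"
  momentum :: "'c \<Rightarrow> real ^ 'e"
  client_est :: "'c \<Rightarrow> real ^ 'e"
  server_est :: "real ^ 'e"

text \<open>One round, with client samples \<open>z\<close>, client tie-breaking signs \<open>u\<close> and server tie-breaking
  signs \<open>d\<close>.  The learning rate \<open>lr i\<close> of layer \<open>i\<close> may depend on the new server estimate of that
  layer.\<close>

definition muon_step ::
  "('l::finite, 'e::finite) shape \<Rightarrow> muon \<Rightarrow> ('c::finite \<Rightarrow> real ^ 'e \<Rightarrow> 's \<Rightarrow> real ^ 'e) \<Rightarrow> real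
     \<Rightarrow> ('l \<Rightarrow> real mat \<Rightarrow> real) \<Rightarrow> ('c \<Rightarrow> 's) \<Rightarrow> ('c \<Rightarrow> real ^ 'e) \<Rightarrow> real ^ 'e
     \<Rightarrow> ('c, 'e) state \<Rightarrow> ('c, 'e) state" where
  "muon_step S meth G \<mu> lr z u d st =
     (let M = (\<lambda>j. \<mu> *\<^sub>R momentum st j + (1 - \<mu>) *\<^sub>R G j (broadcast st) (z j));
          c = (\<lambda>j. compress S (u j) (M j - client_est st j));
          g = server_est st + (1 / real CARD('c)) *\<^sub>R (\<Sum>j\<in>UNIV. c j);
          X = of_blocks S (\<lambda>i. block S (model st) i
                - lr i (block S g i) \<cdot>\<^sub>m polar (block S g i));
          W = (case meth of
                 EF21_MuonUSign \<Rightarrow> X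
               | EF21_MuonSign \<Rightarrow> broadcast st + compress S d (X - broadcast st))
      in \<lparr>model = X, broadcast = W, momentum = M,
          client_est = (\<lambda>j. client_est st j + c j), server_est = g\<rparr>)"

primrec muon_state ::
  "('l::finite, 'e::finite) shape \<Rightarrow> muon \<Rightarrow> real ^ 'e \<Rightarrow> real \<Rightarrow> ('l \<Rightarrow> real mat \<Rightarrow> real)
     \<Rightarrow> ('c::finite, 'e, 's, 'w) stochastics \<Rightarrow> nat \<Rightarrow> 'w \<Rightarrow> ('c, 'e) state" where
  "muon_state S meth X0 \<mu> lr R 0 = (\<lambda>\<omega>.
     \<lparr>model = X0, broadcast = X0, momentum = (\<lambda>j. 0), client_est = (\<lambda>j. 0), server_est = 0\<rparr>)"
| "muon_state S meth X0 \<mu> lr R (Suc t) = (\<lambda>\<omega>.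
     muon_step S meth (stoch_grad R) \<mu> lr (\<lambda>j. sample R (Suc t) j \<omega>)
       (\<lambda>j. up_sign R (Suc t) j \<omega>) (down_sign R (Suc t) \<omega>) (muon_state S meth X0 \<mu> lr R t \<omega>))"

definition iterate ::
  "('l::finite, 'e::finite) shape \<Rightarrow> muon \<Rightarrow> real ^ 'e \<Rightarrow> real \<Rightarrow> ('l \<Rightarrow> real mat \<Rightarrow> real)
     \<Rightarrow> ('c::finite, 'e, 's, 'w) stochastics \<Rightarrow> nat \<Rightarrow> 'w \<Rightarrow> real ^ 'e" where
  "iterate S meth X0 \<mu> lr R t \<omega> = model (muon_state S meth X0 \<mu> lr R t \<omega>)"

section \<open>Weights for unequal layer constants\<close>

definition mean_normalized :: "('l::finite \<Rightarrow> real) \<Rightarrow> 'l \<Rightarrow> real" where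
  "mean_normalized \<gamma> i = \<gamma> i / ((\<Sum>l\<in>UNIV. \<gamma> l) / real CARD('l))"

end

theory Submission
  imports Defs
begin

text \<open>With constants allowed to depend on the dimensions, all norms of the statement may be replaced by
  the Euclidean norm of \<open>real ^ 'e\<close>, for which the scaled sign is a contraction with factor
  \<open>1 - 1 / CARD('e)\<close>.

  Write \<open>\<beta> = 1 - \<mu>\<close>, \<open>b\<^sub>j = M\<^sub>j - \<nabla>f\<^sub>j(W)\<close>, \<open>a\<^sub>j = g\<^sub>j - M\<^sub>j\<close> and \<open>d = W - X\<close>.  In the smooth case
  \<open>f(X) - f\<^sup>* + P \<Sum>\<bar>b\<^sub>j\<bar>\<^sup>2 + Q \<Sum>\<bar>a\<^sub>j\<bar>\<^sup>2 + R \<bar>d\<bar>\<^sup>2\<close> decreases in expectation by a multiple of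
  \<open>\<gamma> \<bar>\<nabla>f(X)\<bar>\<^sup>2\<close>, up to an error of order \<open>\<gamma> \<beta>\<close>; telescoping with \<open>\<beta> = T\<^sup>-\<^sup>1\<^sup>/\<^sup>2\<close> and
  \<open>\<gamma> = \<epsilon> \<beta>\<close> gives the rate.  In the generalized smooth case \<open>b\<^sub>j\<close> is split into the accumulated
  noise, controlled in second moment, and a drift, controlled in norm.  Since the \<open>f\<^sub>j\<close> are bounded below,
  their gradients are at most linear in the gap \<open>f(X) - f\<^sup>*\<close>, so the drift only multiplies the gap by
  \<open>1 + O(\<eta>\<^sup>2 / \<beta>)\<close> per round, which stays bounded over \<open>T\<close> rounds for \<open>\<beta> = T\<^sup>-\<^sup>1\<^sup>/\<^sup>2\<close> and
  \<open>\<eta> = T\<^sup>-\<^sup>3\<^sup>/\<^sup>4\<close>.  The noise is averaged out conditionally on the past, which needs the iterates to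
  be measurable; for the discontinuous polar factor this follows from the Newton--Schulz iteration.\<close>

section \<open>Existence of singular value decompositions\<close>

text \<open>That momentum averages the noise shows only in the second moment: a recursion for the
  norm would leave noise of order 1, while in the square the cross term vanishes in expectation and
  noise of order \<beta> remains. Squares suit the whole smooth case, because the rate proportional
  to the nuclear norm makes the decrease and all errors quadratic. There the momentum error must be
  weighted by \<gamma> / \<beta>, which has to stay bounded since the initial error is not small;
  this forces a fixed ratio \<epsilon>. In the generalized case the local Lipschitz constant is
  affine in the gap. A squared drift would be quadratic in the gap, out of reach of a potential that
  is linear in it, so the drift is measured in norm, matching the linear decrease of a constant
  rate. With \<tau> = T^(-1/4), \<eta> = \<tau>^3 and \<beta> = \<tau>^2, averaged noise and drift
  \<eta> / \<beta> both have size \<tau>. A round then costs \<eta> \<tau> = 1 / T, just bounded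
  over T rounds, and division by \<eta> T = 1 / \<tau> gives the rate \<tau>.\<close>

definition dotn :: "nat \<Rightarrow> (nat \<Rightarrow> real) \<Rightarrow> (nat \<Rightarrow> real) \<Rightarrow> real" where
  "dotn n x y = (\<Sum>b<n. x b * y b)"

lemma dotn_commute: "dotn n x y = dotn n y x"
  by (simp add: dotn_def mult.commute)

lemma dotn_add_right: "dotn n x (\<lambda>b. y b + t * z b) = dotn n x y + t * dotn n x z"
  by (simp add: dotn_def sum.distrib sum_distrib_left algebra_simps)

lemma dotn_nonneg: "0 \<le> dotn n x x"
  by (simp add: dotn_def sum_nonneg)

lemma dotn_unit: "b < n \<Longrightarrow> dotn n x (\<lambda>b'. if b' = b then 1 else 0) = x b"
  by (simp add: dotn_def if_distrib sum.delta cong: if_cong)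

lemma dotn_scale_left: "dotn n (\<lambda>b. t * x b) y = t * dotn n x y"
  by (simp add: dotn_def sum_distrib_left algebra_simps)

lemma dotn_scale_right: "dotn n x (\<lambda>b. t * y b) = t * dotn n x y"
  by (simp add: dotn_def sum_distrib_left algebra_simps)

lemma dotn_sum_right: "dotn n x (\<lambda>b. \<Sum>i\<in>I. f i b) = (\<Sum>i\<in>I. dotn n x (f i))"
  unfolding dotn_def sum_distrib_left by (rule sum.swap)

lemma dotn_diff_right: "dotn n x (\<lambda>b. y b - z b) = dotn n x y - dotn n x z"
  by (simp add: dotn_def sum_subtractf algebra_simps)

lemma dotn_diff_left: "dotn n (\<lambda>b. y b - z b) x = dotn n y x - dotn n z x"
  by (simp add: dotn_def sum_subtractf algebra_simps)

lemma dotn_swap: "dotn n x (\<lambda>b. dotn m (\<lambda>a. R a b) y) = dotn m y (\<lambda>a. dotn n (R a) x)"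
  unfolding dotn_def sum_distrib_left
  by (subst sum.swap) (simp add: algebra_simps)

lemma dotn_cong: "(\<And>b. b < n \<Longrightarrow> x b = x' b) \<Longrightarrow> (\<And>b. b < n \<Longrightarrow> y b = y' b) \<Longrightarrow> dotn n x y = dotn n x' y'"
  by (simp add: dotn_def)

text \<open>A first-order condition without derivatives: near \<open>t = 0\<close> the linear term
  dominates the quadratic one. A single small \<open>t\<close> with the sign of \<open>X\<close>
  suffices for the contradiction.\<close>

lemma linear_le_quadratic_imp_zero:
  fixes X Y :: real
  assumes "\<And>t. 2 * t * X \<le> t\<^sup>2 * Y"
  shows "X = 0"
proof (rule ccontr)
  assume "X \<noteq> 0"
  define D where "D = \<bar>Y\<bar> + 1"
  have D: "D > 0" "Y \<le> D" by (auto simp: D_def)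
  have "2 * (X / D) * X \<le> (X / D)\<^sup>2 * Y" by (rule assms)
  also have "\<dots> \<le> (X / D)\<^sup>2 * D" using D by (intro mult_left_mono) auto
  also have "\<dots> = X\<^sup>2 / D" using D by (simp add: power2_eq_square)
  finally have "2 * (X\<^sup>2 / D) \<le> X\<^sup>2 / D" by (simp add: power2_eq_square)
  moreover have "X\<^sup>2 / D > 0" using D \<open>X \<noteq> 0\<close> by simp
  ultimately show False by linarith
qed

lemma quadratic_form_attains_max_on_sphere:
  fixes R :: "nat \<Rightarrow> nat \<Rightarrow> real"
  assumes "0 < n"
  obtains v where "dotn n v v = 1"
    "\<And>w. dotn n w w = 1 \<Longrightarrow> (\<Sum>a<m. (dotn n (R a) w)\<^sup>2) \<le> (\<Sum>a<m. (dotn n (R a) v)\<^sup>2)"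
proof -
  \<comment> \<open>Coordinates from \<open>n\<close> on are pinned to 0, so that the set is a
    product of compact factors and the product topology provides compactness.\<close>
  define B where "B = (\<lambda>b. if b < n then {-1..1} else {0::real})"
  define Sp where "Sp = PiE UNIV B \<inter> {v. dotn n v v = 1}"
  have cont: "continuous_on UNIV (\<lambda>v::nat\<Rightarrow>real. dotn n x v)" for x
    unfolding dotn_def by (intro continuous_intros continuous_on_product_coordinates)
  have cont2: "continuous_on UNIV (\<lambda>v::nat\<Rightarrow>real. dotn n v v)"
    unfolding dotn_def by (intro continuous_intros continuous_on_product_coordinates)
  have "compactin (product_topology (\<lambda>i. euclidean) UNIV) (PiE UNIV B)"
    unfolding compactin_PiE by (auto simp: B_def)
  then have "compact (PiE UNIV B)"
    by (simp add: euclidean_product_topology)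
  moreover have "closed {v. dotn n v v = 1}"
    using continuous_closed_vimage[of "{1}" "\<lambda>v. dotn n v v"] cont2
    by (simp add: vimage_def continuous_on_eq_continuous_at)
  ultimately have comp: "compact Sp"
    unfolding Sp_def by (rule compact_Int_closed)
  have restr: "(\<lambda>b. if b < n then w b else 0) \<in> Sp" if "dotn n w w = 1" for w
  proof -
    have "dotn n (\<lambda>b. if b < n then w b else 0) (\<lambda>b. if b < n then w b else 0) = 1"
      using that by (subst dotn_cong[where x' = w and y' = w]) auto
    moreover have "-1 \<le> w b \<and> w b \<le> 1" if b: "b < n" for b
    proof -
      have "w b * w b \<le> dotn n w w"
        unfolding dotn_def by (rule member_le_sum) (use b in auto)
      then have "(w b)\<^sup>2 \<le> 1" using \<open>dotn n w w = 1\<close> by (simp add: power2_eq_square)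
      then have "\<bar>w b\<bar> \<le> 1" using abs_square_le_1 by blast
      then show ?thesis by auto
    qed
    ultimately show ?thesis by (auto simp: Sp_def B_def)
  qed
  have "dotn n (\<lambda>b'. if b' = 0 then 1 else 0) (\<lambda>b'. if b' = 0 then 1 else 0) = 1"
    using assms dotn_unit[of 0 n] by simp
  then have "Sp \<noteq> {}" using restr by blast
  moreover have "continuous_on Sp (\<lambda>w. \<Sum>a<m. (dotn n (R a) w)\<^sup>2)"
    by (intro continuous_intros continuous_on_subset[OF cont]) auto
  ultimately obtain v where v: "v \<in> Sp"
      "\<And>w. w \<in> Sp \<Longrightarrow> (\<Sum>a<m. (dotn n (R a) w)\<^sup>2) \<le> (\<Sum>a<m. (dotn n (R a) v)\<^sup>2)"
    using continuous_attains_sup[OF comp] by meson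
  show thesis
  proof (rule that)
    show "dotn n v v = 1" using v(1) by (simp add: Sp_def)
    fix w assume w: "dotn n w w = 1"
    have "(\<Sum>a<m. (dotn n (R a) w)\<^sup>2) = (\<Sum>a<m. (dotn n (R a) (\<lambda>b. if b < n then w b else 0))\<^sup>2)"
      by (simp add: dotn_def)
    also have "\<dots> \<le> (\<Sum>a<m. (dotn n (R a) v)\<^sup>2)" by (rule v(2)[OF restr[OF w]])
    finally show "(\<Sum>a<m. (dotn n (R a) w)\<^sup>2) \<le> (\<Sum>a<m. (dotn n (R a) v)\<^sup>2)" .
  qed
qed

text \<open>A maximizer \<open>v\<close> of the quadratic form on the unit sphere is an eigenvector
  of the Gram matrix of \<open>R\<close> with eigenvalue \<open>l = q v\<close>, and
  \<open>u\<close> is its normalized image. The nonzero entry makes \<open>l\<close>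
  positive.\<close>

lemma top_singular_pair:
  fixes R :: "nat \<Rightarrow> nat \<Rightarrow> real"
  assumes "a0 < m" "b0 < n" "R a0 b0 \<noteq> 0"
  obtains \<sigma> u v where "0 < \<sigma>" "dotn m u u = 1" "dotn n v v = 1"
    "\<And>a. dotn n (R a) v = \<sigma> * u a"
    "\<And>b. b < n \<Longrightarrow> dotn m (\<lambda>a. R a b) u = \<sigma> * v b"
proof -
  define q where "q w = (\<Sum>a<m. (dotn n (R a) w)\<^sup>2)" for w
  obtain v where v: "dotn n v v = 1" and max: "\<And>w. dotn n w w = 1 \<Longrightarrow> q w \<le> q v"
    unfolding q_def
    using quadratic_form_attains_max_on_sphere[where n = n and m = m and R = R] assms(2) by blast
  define l where "l = q v"
  have "0 < (R a0 b0)\<^sup>2" using assms(3) by simp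
  also have "\<dots> \<le> q (\<lambda>b'. if b' = b0 then 1 else 0)"
    unfolding q_def dotn_unit[OF assms(2)]
    by (rule member_le_sum[of a0 "{..<m}" "\<lambda>a. (R a b0)\<^sup>2"]) (use assms in auto)
  also have "\<dots> \<le> l" unfolding l_def by (rule max) (simp add: dotn_unit[OF assms(2)])
  finally have l: "0 < l" .
  have bound: "q w \<le> l * dotn n w w" for w
  proof (cases "dotn n w w = 0")
    case True
    then have "w b = 0" if "b < n" for b
      using that by (auto simp: dotn_def sum_nonneg_eq_0_iff)
    then have "q w = 0" by (simp add: q_def dotn_def)
    with True show ?thesis by simp
  next
    case False
    then have pos: "dotn n w w > 0" using dotn_nonneg[of n w] by linarith
    define t where "t = 1 / sqrt (dotn n w w)"
    have t: "t * t = 1 / dotn n w w" using pos by (simp add: t_def)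
    have "dotn n (\<lambda>b. t * w b) (\<lambda>b. t * w b) = 1"
      unfolding dotn_scale_left dotn_scale_right using t pos by (simp flip: mult.assoc)
    from max[OF this] have "q (\<lambda>b. t * w b) \<le> l" by (simp add: l_def)
    moreover have "q (\<lambda>b. t * w b) = q w / dotn n w w"
      unfolding q_def dotn_scale_right power_mult_distrib
      using t by (simp add: power2_eq_square sum_divide_distrib)
    ultimately show ?thesis using pos by (simp add: divide_le_eq)
  qed
  \<comment> \<open>\<open>q\<close> stays below \<open>l\<close> times the squared norm, with
    equality at \<open>v\<close>; along the line \<open>v + t * w\<close> the terms linear in
    \<open>t\<close> must therefore agree.\<close>
  have stat: "(\<Sum>a<m. dotn n (R a) v * dotn n (R a) w) = l * dotn n v w" for w
  proof -
    define X where "X = (\<Sum>a<m. dotn n (R a) v * dotn n (R a) w)"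
    have "2 * t * (X - l * dotn n v w) \<le> t\<^sup>2 * (l * dotn n w w - q w)" for t
    proof -
      have "q (\<lambda>b. v b + t * w b) = l + 2 * t * X + t\<^sup>2 * q w"
        unfolding q_def dotn_add_right l_def X_def
        by (simp add: power2_eq_square sum.distrib sum_distrib_left algebra_simps)
      moreover have "dotn n (\<lambda>b. v b + t * w b) (\<lambda>b. v b + t * w b)
          = 1 + 2 * t * dotn n v w + t\<^sup>2 * dotn n w w"
        using v dotn_commute[of n w v] dotn_commute[of n "\<lambda>b. v b + t * w b" v]
          dotn_commute[of n "\<lambda>b. v b + t * w b" w]
        by (simp add: dotn_add_right power2_eq_square algebra_simps)
      ultimately show ?thesis
        using bound[of "\<lambda>b. v b + t * w b"] by (simp add: algebra_simps)
    qed
    from linear_le_quadratic_imp_zero[OF this] show ?thesis by (simp add: X_def)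
  qed
  define \<sigma> where "\<sigma> = sqrt l"
  have \<sigma>: "\<sigma> > 0" "\<sigma> * \<sigma> = l" using l by (auto simp: \<sigma>_def)
  define u where "u a = dotn n (R a) v / \<sigma>" for a
  show thesis
  proof (rule that)
    show "0 < \<sigma>" by fact
    have "dotn m u u = q v / l"
      unfolding dotn_def[of m] u_def q_def using \<sigma>
      by (simp add: sum_divide_distrib power2_eq_square)
    then show "dotn m u u = 1" using l by (simp add: l_def)
    show "dotn n v v = 1" by fact
    show "dotn n (R a) v = \<sigma> * u a" for a using \<sigma> by (simp add: u_def)
    show "dotn m (\<lambda>a. R a b) u = \<sigma> * v b" if b: "b < n" for b
    proof -
      have "dotn m (\<lambda>a. R a b) u = (\<Sum>a<m. dotn n (R a) v * R a b) / \<sigma>"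
        unfolding dotn_def[of m] u_def by (simp add: sum_divide_distrib mult.commute)
      also have "\<dots> = l * v b / \<sigma>"
        using stat[of "\<lambda>b'. if b' = b then 1 else 0"] by (simp add: dotn_unit[OF b])
      also have "\<dots> = \<sigma> * v b" using \<sigma> by (simp flip: \<sigma>(2))
      finally show ?thesis .
    qed
  qed
qed

definition orthonormal_fam :: "nat \<Rightarrow> nat \<Rightarrow> (nat \<Rightarrow> nat \<Rightarrow> real) \<Rightarrow> bool" where
  "orthonormal_fam n k v \<longleftrightarrow> (\<forall>i<k. \<forall>j<k. dotn n (v i) (v j) = (if i = j then 1 else 0))"

text \<open>Bessel's inequality for every standard basis vector, summed over the \<open>n\<close>
  coordinates: the squared entries of \<open>k\<close> unit vectors add up to \<open>k\<close>, and
  each coordinate contributes at most 1.\<close>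

lemma orthonormal_fam_card:
  assumes "orthonormal_fam n k v"
  shows "k \<le> n"
proof -
  have bessel: "(\<Sum>i<k. (v i b)\<^sup>2) \<le> 1" if b: "b < n" for b
  proof -
    define e where "e = (\<lambda>b'. if b' = b then 1 else 0 :: real)"
    define p where "p b' = (\<Sum>i<k. v i b * v i b')" for b'
    have ep: "dotn n e p = (\<Sum>i<k. (v i b)\<^sup>2)"
      unfolding e_def by (subst dotn_commute) (simp add: dotn_unit[OF b] p_def power2_eq_square)
    have pv: "dotn n p (v i) = v i b" if "i < k" for i
    proof -
      have "dotn n p (v i) = (\<Sum>j<k. v j b * dotn n (v i) (v j))"
        unfolding p_def by (subst dotn_commute) (simp add: dotn_sum_right dotn_scale_right)
      also have "\<dots> = (\<Sum>j<k. if j = i then v j b else 0)"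
        using assms that by (intro sum.cong refl) (auto simp: orthonormal_fam_def)
      finally show ?thesis using that by simp
    qed
    have "dotn n p p = (\<Sum>i<k. v i b * dotn n p (v i))"
      using dotn_sum_right[of n p "\<lambda>i b'. v i b * v i b'" "{..<k}"]
      by (simp add: dotn_scale_right flip: p_def)
    then have pp: "dotn n p p = (\<Sum>i<k. (v i b)\<^sup>2)"
      by (simp add: pv power2_eq_square)
    have ee: "dotn n e e = 1" unfolding e_def by (simp add: dotn_unit[OF b])
    have "0 \<le> dotn n (\<lambda>x. e x - p x) (\<lambda>x. e x - p x)" by (rule dotn_nonneg)
    also have "\<dots> = 1 - (\<Sum>i<k. (v i b)\<^sup>2)"
      using ee ep pp by (simp add: dotn_diff_right dotn_diff_left dotn_commute[of n p e])
    finally show ?thesis by simp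
  qed
  have "real k = (\<Sum>i<k. dotn n (v i) (v i))"
    using assms by (simp add: orthonormal_fam_def)
  also have "\<dots> = (\<Sum>b<n. \<Sum>i<k. (v i b)\<^sup>2)"
    unfolding dotn_def by (subst sum.swap) (simp add: power2_eq_square)
  also have "\<dots> \<le> (\<Sum>b<n. 1)" by (intro sum_mono) (use bessel in auto)
  finally show ?thesis by simp
qed

text \<open>A partial decomposition. It records genuine singular pairs of \<open>A\<close> instead
  of an expansion of \<open>A\<close>, so the pairs already found survive an extension unchanged and
  the residual vanishes on them.\<close>

definition singular_system ::
  "nat \<Rightarrow> nat \<Rightarrow> (nat \<Rightarrow> nat \<Rightarrow> real) \<Rightarrow> nat \<Rightarrow> (nat \<Rightarrow> nat \<Rightarrow> real) \<Rightarrow> (nat \<Rightarrow> real) \<Rightarrow> (nat \<Rightarrow> nat \<Rightarrow> real) \<Rightarrow> bool"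
  where
  "singular_system m n A k u s v \<longleftrightarrow>
     orthonormal_fam m k u \<and> orthonormal_fam n k v \<and> (\<forall>i<k. 0 < s i) \<and>
     (\<forall>i<k. \<forall>a<m. dotn n (A a) (v i) = s i * u i a) \<and>
     (\<forall>i<k. \<forall>b<n. dotn m (\<lambda>a. A a b) (u i) = s i * v i b)"

lemma orthonormal_fam_extend:
  assumes "orthonormal_fam n k v" "dotn n w w = 1" "\<And>i. i < k \<Longrightarrow> dotn n (v i) w = 0"
  shows "orthonormal_fam n (Suc k) (v(k := w))"
proof -
  have "dotn n w (v i) = 0" if "i < k" for i using assms(3)[OF that] by (simp add: dotn_commute)
  then show ?thesis using assms by (auto simp: orthonormal_fam_def less_Suc_eq)
qed

text \<open>If the system does not exhaust \<open>A\<close>, a top singular pair of the residual is orthogonal to it.\<close>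

lemma singular_system_extend:
  assumes ss: "singular_system m n A k u s v"
    and "a0 < m" "b0 < n" and ne: "A a0 b0 \<noteq> (\<Sum>i<k. s i * u i a0 * v i b0)"
  shows "\<exists>u s v. singular_system m n A (Suc k) u s v"
proof -
  define R where "R a b = A a b - (\<Sum>i<k. s i * u i a * v i b)" for a b
  have on: "orthonormal_fam m k u" "orthonormal_fam n k v"
    and Av: "\<And>i a. i < k \<Longrightarrow> a < m \<Longrightarrow> dotn n (A a) (v i) = s i * u i a"
    and Au: "\<And>i b. i < k \<Longrightarrow> b < n \<Longrightarrow> dotn m (\<lambda>a. A a b) (u i) = s i * v i b"
    using ss by (auto simp: singular_system_def)
  have R1: "dotn n (R a) w = dotn n (A a) w - (\<Sum>i<k. s i * u i a * dotn n (v i) w)" for a w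
    unfolding R_def dotn_diff_left
    by (simp add: dotn_sum_right dotn_scale_right dotn_commute[of n _ w])
  have R2: "dotn m (\<lambda>a. R a b) w = dotn m (\<lambda>a. A a b) w - (\<Sum>i<k. s i * v i b * dotn m (u i) w)" for b w
  proof -
    have "(\<lambda>a. R a b) = (\<lambda>a. A a b - (\<Sum>i<k. (s i * v i b) * u i a))"
      by (simp add: R_def algebra_simps)
    then show ?thesis
      by (simp only: dotn_diff_left) (simp add: dotn_sum_right dotn_scale_right dotn_commute[of m _ w])
  qed
  obtain \<sigma> x y where \<sigma>: "0 < \<sigma>" and xx: "dotn m x x = 1" and yy: "dotn n y y = 1"
    and Ry: "\<And>a. dotn n (R a) y = \<sigma> * x a"
    and Rx: "\<And>b. b < n \<Longrightarrow> dotn m (\<lambda>a. R a b) x = \<sigma> * y b"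
    using top_singular_pair[of a0 m b0 n R] assms by (auto simp: R_def)
  have Rv: "dotn n (R a) (v i) = 0" if "i < k" "a < m" for i a
  proof -
    have "(\<Sum>j<k. s j * u j a * dotn n (v j) (v i)) = (\<Sum>j<k. if j = i then s j * u j a else 0)"
      using on(2) that by (intro sum.cong) (auto simp: orthonormal_fam_def)
    then show ?thesis using that by (simp add: R1 Av)
  qed
  have Ru: "dotn m (\<lambda>a. R a b) (u i) = 0" if "i < k" "b < n" for i b
  proof -
    have "(\<Sum>j<k. s j * v j b * dotn m (u j) (u i)) = (\<Sum>j<k. if j = i then s j * v j b else 0)"
      using on(1) that by (intro sum.cong) (auto simp: orthonormal_fam_def)
    then show ?thesis using that by (simp add: R2 Au)
  qed
  \<comment> \<open>Passing to the adjoint moves \<open>R\<close> onto \<open>v i\<close>, which it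
    annihilates.\<close>
  have vy: "dotn n (v i) y = 0" if "i < k" for i
  proof -
    have "\<sigma> * dotn n (v i) y = dotn n (v i) (\<lambda>b. dotn m (\<lambda>a. R a b) x)"
      unfolding dotn_scale_right[symmetric] by (rule dotn_cong) (auto simp: Rx)
    also have "\<dots> = dotn m x (\<lambda>a. dotn n (R a) (v i))" by (rule dotn_swap)
    also have "\<dots> = 0" using Rv that by (simp add: dotn_def[of m])
    finally show ?thesis using \<sigma> by simp
  qed
  have ux: "dotn m (u i) x = 0" if "i < k" for i
  proof -
    have "\<sigma> * dotn m (u i) x = dotn m (u i) (\<lambda>a. dotn n (R a) y)"
      unfolding dotn_scale_right[symmetric] by (rule dotn_cong) (auto simp: Ry)
    also have "\<dots> = dotn n y (\<lambda>b. dotn m (\<lambda>a. R a b) (u i))" by (rule dotn_swap[symmetric])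
    also have "\<dots> = 0" using Ru that by (simp add: dotn_def[of n])
    finally show ?thesis using \<sigma> by simp
  qed
  \<comment> \<open>By this orthogonality the subtracted rank-one terms do not see the new pair, so
    it is a singular pair of \<open>A\<close> itself.\<close>
  have "dotn n (A a) y = \<sigma> * x a" for a using R1[of a y] Ry[of a] vy by simp
  moreover have "dotn m (\<lambda>a. A a b) x = \<sigma> * y b" if "b < n" for b
    using R2[of b x] Rx[OF that] ux by simp
  ultimately have "singular_system m n A (Suc k) (u(k := x)) (s(k := \<sigma>)) (v(k := y))"
    using ss \<sigma> orthonormal_fam_extend[OF on(1) xx ux] orthonormal_fam_extend[OF on(2) yy vy]
    by (auto simp: singular_system_def less_Suc_eq)
  then show ?thesis by blast
qed

text \<open>Orthonormality bounds the length of a singular system by \<open>n\<close>, so a longest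
  one exists; as it cannot be extended, its residual is zero.\<close>

lemma singular_value_decomposition_fun:
  fixes A :: "nat \<Rightarrow> nat \<Rightarrow> real"
  obtains k u s v where "orthonormal_fam m k u" "orthonormal_fam n k v" "\<And>i. i < k \<Longrightarrow> 0 < s i"
    "\<And>a b. a < m \<Longrightarrow> b < n \<Longrightarrow> A a b = (\<Sum>i<k. s i * u i a * v i b)"
proof -
  let ?P = "\<lambda>k. \<exists>u s v. singular_system m n A k u s v"
  have "?P 0" by (simp add: singular_system_def orthonormal_fam_def)
  moreover have "\<forall>k. ?P k \<longrightarrow> k \<le> n"
    using orthonormal_fam_card by (auto simp: singular_system_def)
  ultimately have P: "?P (GREATEST k. ?P k)" and G: "\<And>k. ?P k \<Longrightarrow> k \<le> (GREATEST k. ?P k)"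
    using GreatestI_nat[of ?P 0 n] Greatest_le_nat[of ?P _ n] by auto
  define k where "k = (GREATEST k. ?P k)"
  obtain u s v where ss: "singular_system m n A k u s v" using P k_def by blast
  have "A a b = (\<Sum>i<k. s i * u i a * v i b)" if "a < m" "b < n" for a b
    using singular_system_extend[OF ss that] G[of "Suc k"] by (auto simp: k_def[symmetric])
  then show thesis using that[of k u v s] ss by (auto simp: singular_system_def)
qed

lemma thin_svd_exists: "\<exists>U s V. thin_svd A U s V"
proof -
  define m n where "m = dim_row A" and "n = dim_col A"
  obtain k u s v where on: "orthonormal_fam m k u" "orthonormal_fam n k v"
    and s: "\<And>i. i < k \<Longrightarrow> 0 < s i"
    and A: "\<And>a b. a < m \<Longrightarrow> b < n \<Longrightarrow> A $$ (a, b) = (\<Sum>i<k. s i * u i a * v i b)"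
    by (rule singular_value_decomposition_fun[of m n "\<lambda>a b. A $$ (a, b)"]) blast
  define U where "U = Matrix.mat m k (\<lambda>(a, i). u i a)"
  define V where "V = Matrix.mat n k (\<lambda>(b, i). v i b)"
  define l where "l = map s [0..<k]"
  have UU: "transpose_mat U * U = 1\<^sub>m k" "transpose_mat V * V = 1\<^sub>m k"
    using on by (auto intro!: eq_matI simp: U_def V_def scalar_prod_def orthonormal_fam_def dotn_def
        atLeast0LessThan)
  have "A = U * mat_diag k (\<lambda>i. l ! i) * transpose_mat V"
    using A by (auto intro!: eq_matI sum.cong simp: U_def V_def l_def scalar_prod_def m_def n_def mat_diag_def
        atLeast0LessThan if_distrib cong: if_cong)
  then have "thin_svd A U l V"
    using UU s by (auto simp: thin_svd_def l_def U_def V_def m_def n_def)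
  then show ?thesis by blast
qed

section \<open>Polar factor and nuclear norm\<close>

text \<open>The Frobenius (trace) inner product.\<close>

definition finner :: "real mat \<Rightarrow> real mat \<Rightarrow> real" where
  "finner A B = (\<Sum>p\<in>{..<dim_row A} \<times> {..<dim_col A}. A $$ p * B $$ p)"

abbreviation frob2 :: "real mat \<Rightarrow> real" where
  "frob2 A \<equiv> finner A A"

lemma frob2_nonneg: "0 \<le> frob2 A"
  unfolding finner_def by (intro sum_nonneg) auto

lemma finner_Cauchy_Schwarz:
  assumes "dim_row A = dim_row B" "dim_col A = dim_col B"
  shows "(finner A B)\<^sup>2 \<le> frob2 A * frob2 B"
  using Cauchy_Schwarz_ineq_sum[of "\<lambda>p. A $$ p" "\<lambda>p. B $$ p" "{..<dim_row A} \<times> {..<dim_col A}"] assms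
  by (simp add: finner_def power2_eq_square)

lemma thin_svd_orthonormal_fam:
  assumes "thin_svd A U s V"
  shows "orthonormal_fam (dim_row A) (length s) (\<lambda>i a. U $$ (a, i))"
    and "orthonormal_fam (dim_col A) (length s) (\<lambda>i b. V $$ (b, i))"
proof -
  have gram: "orthonormal_fam m k (\<lambda>i a. W $$ (a, i))"
    if W: "W \<in> carrier_mat m k" and WW: "transpose_mat W * W = 1\<^sub>m k" for W :: "real mat" and m k
    unfolding orthonormal_fam_def
  proof (intro allI impI)
    fix i j assume ij: "i < k" "j < k"
    have "(transpose_mat W * W) $$ (i, j) = dotn m (\<lambda>a. W $$ (a, i)) (\<lambda>a. W $$ (a, j))"
      using W ij by (auto simp: scalar_prod_def dotn_def atLeast0LessThan)
    then show "dotn m (\<lambda>a. W $$ (a, i)) (\<lambda>a. W $$ (a, j)) = (if i = j then 1 else 0)"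
      using WW ij by simp
  qed
  show "orthonormal_fam (dim_row A) (length s) (\<lambda>i a. U $$ (a, i))"
    "orthonormal_fam (dim_col A) (length s) (\<lambda>i b. V $$ (b, i))"
    using assms by (auto simp: thin_svd_def intro!: gram)
qed

lemma mult_mat_diag_entry:
  fixes U V :: "real mat"
  assumes "U \<in> carrier_mat m k" "V \<in> carrier_mat n k" "a < m" "b < n"
  shows "(U * mat_diag k f * transpose_mat V) $$ (a, b) = (\<Sum>i<k. f i * (U $$ (a, i) * V $$ (b, i)))"
  using assms by (simp add: mat_diag_mult_right scalar_prod_def atLeast0LessThan mult_ac)

text \<open>Orthonormal columns make \<open>P\<close> an isometry from diagonals into matrices. The
  diagonals used later are the singular values and the all-ones diagonal, giving the squared
  Frobenius norm, the nuclear norm and the rank.\<close>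

lemma finner_mat_diag:
  assumes svd: "thin_svd A U s V"
  defines "P \<equiv> \<lambda>f. U * mat_diag (length s) f * transpose_mat V"
  shows "finner (P f) (P g) = (\<Sum>i<length s. f i * g i)"
proof -
  let ?k = "length s" and ?m = "dim_row A" and ?n = "dim_col A"
  have UV: "U \<in> carrier_mat ?m ?k" "V \<in> carrier_mat ?n ?k"
    using svd by (auto simp: thin_svd_def)
  have dim: "dim_row (P f) = ?m" "dim_col (P f) = ?n" using UV by (auto simp: P_def)
  define x where "x i a = U $$ (a, i)" for i a
  define y where "y i b = V $$ (b, i)" for i b
  have "finner (P f) (P g) = (\<Sum>a<?m. \<Sum>b<?n. P f $$ (a, b) * P g $$ (a, b))"
    unfolding finner_def dim by (simp add: sum.cartesian_product)
  also have "\<dots> = (\<Sum>a<?m. \<Sum>b<?n. (\<Sum>i<?k. f i * (x i a * y i b)) * (\<Sum>j<?k. g j * (x j a * y j b)))"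
    unfolding P_def x_def y_def
    by (intro sum.cong refl arg_cong2[where f = "(*)"]) (auto simp: mult_mat_diag_entry[OF UV])
  also have "\<dots> = (\<Sum>a<?m. \<Sum>b<?n. \<Sum>i<?k. \<Sum>j<?k. f i * g j * (x i a * x j a) * (y i b * y j b))"
    unfolding sum_product by (intro sum.cong refl) (simp add: algebra_simps)
  also have "\<dots> = (\<Sum>a<?m. \<Sum>i<?k. \<Sum>b<?n. \<Sum>j<?k. f i * g j * (x i a * x j a) * (y i b * y j b))"
    by (intro sum.cong refl sum.swap)
  also have "\<dots> = (\<Sum>i<?k. \<Sum>a<?m. \<Sum>b<?n. \<Sum>j<?k. f i * g j * (x i a * x j a) * (y i b * y j b))"
    by (rule sum.swap)
  also have "\<dots> = (\<Sum>i<?k. \<Sum>a<?m. \<Sum>j<?k. \<Sum>b<?n. f i * g j * (x i a * x j a) * (y i b * y j b))"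
    by (intro sum.cong refl sum.swap)
  also have "\<dots> = (\<Sum>i<?k. \<Sum>j<?k. \<Sum>a<?m. \<Sum>b<?n. f i * g j * (x i a * x j a) * (y i b * y j b))"
    by (intro sum.cong refl sum.swap)
  also have "\<dots> = (\<Sum>i<?k. \<Sum>j<?k. f i * g j * (dotn ?m (x i) (x j) * dotn ?n (y i) (y j)))"
  proof (intro sum.cong[of "{..<?k}"] refl)
    fix i j
    show "(\<Sum>a<?m. \<Sum>b<?n. f i * g j * (x i a * x j a) * (y i b * y j b))
        = f i * g j * (dotn ?m (x i) (x j) * dotn ?n (y i) (y j))"
      unfolding dotn_def sum_product by (simp only: sum_distrib_left mult.assoc)
  qed
  also have "\<dots> = (\<Sum>i<?k. \<Sum>j<?k. if j = i then f i * g i else 0)"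
  proof (intro sum.cong refl)
    fix i j assume ij: "i \<in> {..<?k}" "j \<in> {..<?k}"
    have "dotn ?m (x i) (x j) = (if i = j then 1 else 0)" "dotn ?n (y i) (y j) = (if i = j then 1 else 0)"
      using thin_svd_orthonormal_fam[OF svd] ij by (auto simp: orthonormal_fam_def x_def[abs_def] y_def[abs_def])
    then show "f i * g j * (dotn ?m (x i) (x j) * dotn ?n (y i) (y j)) = (if j = i then f i * g i else 0)"
      by simp
  qed
  also have "\<dots> = (\<Sum>i<?k. f i * g i)" by simp
  finally show ?thesis .
qed

lemma mult_mat_cancel_middle:
  fixes U V W D E :: "real mat"
  assumes "U \<in> carrier_mat m k" "D \<in> carrier_mat k k" "V \<in> carrier_mat n k" "E \<in> carrier_mat k k"
    "W \<in> carrier_mat l k" "transpose_mat V * V = 1\<^sub>m k"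
  shows "(U * D * transpose_mat V) * (V * E * transpose_mat W) = U * (D * E) * transpose_mat W"
proof -
  have T: "transpose_mat V \<in> carrier_mat k n" "transpose_mat W \<in> carrier_mat k l"
    using assms by auto
  have "(U * D * transpose_mat V) * (V * E * transpose_mat W)
      = (U * D) * (transpose_mat V * (V * E * transpose_mat W))"
    using assms T by (intro assoc_mult_mat[of _ m k _ n _ l]) auto
  also have "transpose_mat V * (V * E * transpose_mat W) = (transpose_mat V * (V * E)) * transpose_mat W"
    using assms T by (intro assoc_mult_mat[of _ k n _ k _ l, symmetric]) auto
  also have "transpose_mat V * (V * E) = (transpose_mat V * V) * E"
    using assms T by (intro assoc_mult_mat[of _ k n _ k _ k, symmetric]) auto
  also have "\<dots> = E" using assms by simp
  also have "(U * D) * (E * transpose_mat W) = ((U * D) * E) * transpose_mat W"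
    using assms T by (intro assoc_mult_mat[of _ m k _ k _ l, symmetric]) auto
  also have "(U * D) * E = U * (D * E)"
    using assms by (intro assoc_mult_mat[of _ m k _ k _ k]) auto
  finally show ?thesis .
qed

text \<open>The iterates are polynomials in \<open>A\<close>, and the scaling puts the singular values in \<open>(0, 1)\<close>, where
  the scalar iteration tends to \<open>1\<close>.  The limit is therefore the polar factor of every singular value
  decomposition of \<open>A\<close>: this gives uniqueness and Borel measurability at once.\<close>

primrec newton_schulz_scalar :: "nat \<Rightarrow> real \<Rightarrow> real" where
  "newton_schulz_scalar 0 x = x"
| "newton_schulz_scalar (Suc j) x =
     3 / 2 * newton_schulz_scalar j x - 1 / 2 * (newton_schulz_scalar j x) ^ 3"

primrec newton_schulz :: "real mat \<Rightarrow> nat \<Rightarrow> real mat" where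
  "newton_schulz A 0 = (1 / (1 + sqrt (frob2 A))) \<cdot>\<^sub>m A"
| "newton_schulz A (Suc j) = (3 / 2) \<cdot>\<^sub>m newton_schulz A j
     - (1 / 2) \<cdot>\<^sub>m (newton_schulz A j * (transpose_mat (newton_schulz A j) * newton_schulz A j))"

lemma newton_schulz_scalar_bounds:
  assumes "0 < x" "x \<le> 1"
  shows "0 < newton_schulz_scalar j x \<and> newton_schulz_scalar j x \<le> 1"
proof (induction j)
  case (Suc j)
  define y where "y = newton_schulz_scalar j x"
  have y: "0 < y" "y \<le> 1" using Suc by (auto simp: y_def)
  have "3 / 2 * y - 1 / 2 * y ^ 3 = y * (3 - y\<^sup>2) / 2"
    by (simp add: power3_eq_cube power2_eq_square algebra_simps)
  moreover have "y\<^sup>2 \<le> 1" using y by (simp add: power_le_one)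
  \<comment> \<open>1 is a double root of this difference, so the iteration does not overshoot its
    fixed point.\<close>
  moreover have "1 - (3 / 2 * y - 1 / 2 * y ^ 3) = (1 - y)\<^sup>2 * (2 + y) / 2"
    by (simp add: power3_eq_cube power2_eq_square field_simps)
  moreover have "0 \<le> (1 - y)\<^sup>2 * (2 + y) / 2" using y by simp
  moreover have "0 < y * (3 - y\<^sup>2) / 2" using y \<open>y\<^sup>2 \<le> 1\<close> by simp
  ultimately show ?case by (simp add: y_def[symmetric])
qed (use assms in simp)

text \<open>The sequence increases and is bounded by 1; its limit solves
  \<open>L * (L\<^sup>2 - 1) = 0\<close> and is at least \<open>x\<close>, which leaves only
  1.\<close>

lemma newton_schulz_scalar_tendsto:
  assumes "0 < x" "x \<le> 1"
  shows "(\<lambda>j. newton_schulz_scalar j x) \<longlonglongrightarrow> 1"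
proof -
  let ?y = "\<lambda>j. newton_schulz_scalar j x"
  note bd = newton_schulz_scalar_bounds[OF assms]
  have inc: "incseq ?y"
  proof (rule incseq_SucI)
    fix j
    have "?y (Suc j) - ?y j = ?y j * (1 - (?y j)\<^sup>2) / 2"
      by (simp add: power3_eq_cube power2_eq_square algebra_simps)
    moreover have "(?y j)\<^sup>2 \<le> 1" using bd[of j] by (simp add: power_le_one)
    ultimately show "?y j \<le> ?y (Suc j)" using bd[of j]
      by (metis diff_ge_0_iff_ge divide_nonneg_pos mult_nonneg_nonneg less_imp_le zero_less_numeral)
  qed
  then obtain L where L: "?y \<longlonglongrightarrow> L" "\<And>j. ?y j \<le> L"
    using incseq_convergent[of ?y 1] bd by blast
  have "L \<ge> x" using L(2)[of 0] by simp
  then have "L > 0" using assms by simp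
  have "(\<lambda>j. ?y (Suc j)) \<longlonglongrightarrow> L" using L(1) by (rule LIMSEQ_Suc)
  moreover have "(\<lambda>j. ?y (Suc j)) \<longlonglongrightarrow> 3 / 2 * L - 1 / 2 * L ^ 3"
    unfolding newton_schulz_scalar.simps by (intro tendsto_intros L)
  ultimately have "L = 3 / 2 * L - 1 / 2 * L ^ 3" using LIMSEQ_unique by blast
  then have "L * (L\<^sup>2 - 1) = 0" by (simp add: power3_eq_cube power2_eq_square algebra_simps)
  then have "L = 1" using \<open>L > 0\<close> by (simp add: power2_eq_1_iff)
  with L(1) show ?thesis by simp
qed

text \<open>An odd polynomial in \<open>A\<close> acts on the singular values alone: scaling,
  subtraction and the triple product all stay of the form \<open>P f\<close>, with both orthogonal
  factors untouched.\<close>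

lemma newton_schulz_svd:
  assumes svd: "thin_svd A U s V"
  shows "newton_schulz A j = U * mat_diag (length s)
      (\<lambda>i. newton_schulz_scalar j (s ! i / (1 + sqrt (frob2 A)))) * transpose_mat V"
proof -
  let ?k = "length s" and ?m = "dim_row A" and ?n = "dim_col A"
  define P where "P f = U * mat_diag ?k f * transpose_mat V" for f
  have UV: "U \<in> carrier_mat ?m ?k" "V \<in> carrier_mat ?n ?k"
      "transpose_mat U * U = 1\<^sub>m ?k" "transpose_mat V * V = 1\<^sub>m ?k"
    and A: "A = P (\<lambda>i. s ! i)"
    using svd by (auto simp: thin_svd_def P_def)
  have PT: "transpose_mat (P f) = V * mat_diag ?k f * transpose_mat U" for f
  proof (rule eq_matI)
    fix a b assume "a < dim_row (V * mat_diag ?k f * transpose_mat U)"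
      "b < dim_col (V * mat_diag ?k f * transpose_mat U)"
    then have ab: "a < ?n" "b < ?m" using UV by auto
    have "transpose_mat (P f) $$ (a, b) = P f $$ (b, a)"
      using ab UV by (auto simp: P_def)
    then show "transpose_mat (P f) $$ (a, b) = (V * mat_diag ?k f * transpose_mat U) $$ (a, b)"
      unfolding P_def using mult_mat_diag_entry[OF UV(1,2) ab(2,1)] mult_mat_diag_entry[OF UV(2,1) ab]
      by (simp add: mult.commute)
  qed (use UV in \<open>auto simp: P_def\<close>)
  have lin: "c \<cdot>\<^sub>m P f - d \<cdot>\<^sub>m P g = P (\<lambda>i. c * f i - d * g i)" for c d f g
  proof (rule eq_matI)
    fix a b assume "a < dim_row (P (\<lambda>i. c * f i - d * g i))" "b < dim_col (P (\<lambda>i. c * f i - d * g i))"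
    then have ab: "a < ?m" "b < ?n" using UV by (auto simp: P_def)
    have "(c \<cdot>\<^sub>m P f - d \<cdot>\<^sub>m P g) $$ (a, b) = c * P f $$ (a, b) - d * P g $$ (a, b)"
      using ab UV(1,2) unfolding P_def by (subst index_minus_mat) auto
    also have "\<dots> = P (\<lambda>i. c * f i - d * g i) $$ (a, b)"
      unfolding P_def mult_mat_diag_entry[OF UV(1,2) ab]
      by (simp add: sum_distrib_left sum_subtractf algebra_simps)
    finally show "(c \<cdot>\<^sub>m P f - d \<cdot>\<^sub>m P g) $$ (a, b) = P (\<lambda>i. c * f i - d * g i) $$ (a, b)" .
  qed (use UV in \<open>auto simp: P_def\<close>)
  have "newton_schulz A j = P (\<lambda>i. newton_schulz_scalar j (s ! i / (1 + sqrt (frob2 A))))"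
  proof (induction j)
    case 0
    \<comment> \<open>The vanishing second term turns a pure scaling into an instance of
      \<open>lin\<close>.\<close>
    have "(1 / (1 + sqrt (frob2 A))) \<cdot>\<^sub>m A = (1 / (1 + sqrt (frob2 A))) \<cdot>\<^sub>m P (\<lambda>i. s ! i) - 0 \<cdot>\<^sub>m P (\<lambda>i. 0)"
      using UV unfolding A[symmetric] by (intro eq_matI) (auto simp: P_def)
    also have "\<dots> = P (\<lambda>i. s ! i / (1 + sqrt (frob2 A)))" by (simp add: lin)
    finally show ?case by simp
  next
    case (Suc j)
    define f where "f i = newton_schulz_scalar j (s ! i / (1 + sqrt (frob2 A)))" for i
    have "transpose_mat (P f) * P f = V * (mat_diag ?k f * mat_diag ?k f) * transpose_mat V"
      unfolding PT unfolding P_def by (rule mult_mat_cancel_middle) (use UV in auto)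
    then have "P f * (transpose_mat (P f) * P f) = P (\<lambda>i. f i ^ 3)"
      unfolding P_def
      by (simp add: mult_mat_cancel_middle[OF UV(1) _ UV(2) _ UV(2) UV(4)] mat_diag_diag
          power3_eq_cube mult.assoc)
    then show ?case using Suc by (simp add: lin f_def[symmetric])
  qed
  then show ?thesis by (simp add: P_def)
qed

lemma thin_svd_frob2:
  assumes "thin_svd A U s V"
  shows "frob2 A = (\<Sum>i<length s. (s ! i)\<^sup>2)"
  using finner_mat_diag[OF assms, of "\<lambda>i. s ! i" "\<lambda>i. s ! i"] assms
  by (simp add: thin_svd_def power2_eq_square)

lemma mat_diag_ones_mult:
  fixes U :: "real mat"
  shows "U \<in> carrier_mat m k \<Longrightarrow> U * mat_diag k (\<lambda>i. 1) = U"
  by (simp add: mat_diag_one)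

lemma newton_schulz_tendsto_polar_factor:
  assumes svd: "thin_svd A U s V" and ab: "a < dim_row A" "b < dim_col A"
  shows "(\<lambda>j. newton_schulz A j $$ (a, b)) \<longlonglongrightarrow> (U * transpose_mat V) $$ (a, b)"
proof -
  let ?k = "length s"
  have UV: "U \<in> carrier_mat (dim_row A) ?k" "V \<in> carrier_mat (dim_col A) ?k"
    using svd by (auto simp: thin_svd_def)
  have "(\<lambda>j. newton_schulz_scalar j (s ! i / (1 + sqrt (frob2 A)))) \<longlonglongrightarrow> 1" if i: "i < ?k" for i
  proof (rule newton_schulz_scalar_tendsto)
    have si: "0 < s ! i" using svd i by (auto simp: thin_svd_def)
    have "0 \<le> sqrt (frob2 A)" by (simp add: frob2_nonneg)
    then show "0 < s ! i / (1 + sqrt (frob2 A))" using si by (intro divide_pos_pos add_pos_nonneg) auto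
    \<comment> \<open>Every singular value is at most the Frobenius norm, so the normalization puts
      it where the scalar iteration converges to 1; the additional 1 in the denominator covers the
      zero matrix.\<close>
    have "(s ! i)\<^sup>2 \<le> frob2 A"
      unfolding thin_svd_frob2[OF svd] by (rule member_le_sum) (use i in auto)
    then have "s ! i \<le> sqrt (frob2 A)" by (rule real_le_rsqrt)
    moreover have "0 < 1 + sqrt (frob2 A)"
      by (intro add_pos_nonneg real_sqrt_ge_zero frob2_nonneg) simp
    ultimately show "s ! i / (1 + sqrt (frob2 A)) \<le> 1" by (simp add: divide_le_eq_1_pos)
  qed
  then have "(\<lambda>j. \<Sum>i<?k. newton_schulz_scalar j (s ! i / (1 + sqrt (frob2 A))) * (U $$ (a, i) * V $$ (b, i)))
      \<longlonglongrightarrow> (\<Sum>i<?k. 1 * (U $$ (a, i) * V $$ (b, i)))"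
    by (intro tendsto_sum tendsto_mult_right) auto
  then show ?thesis
    using mult_mat_diag_entry[OF UV ab, of "\<lambda>i. 1"]
    unfolding newton_schulz_svd[OF svd] mult_mat_diag_entry[OF UV ab] mat_diag_ones_mult[OF UV(1)]
    by simp
qed

lemma polar_eq:
  assumes "thin_svd A U s V"
  shows "polar A = U * transpose_mat V"
  unfolding polar_def
proof (rule the_equality)
  show "\<exists>U' s' V'. thin_svd A U' s' V' \<and> U * transpose_mat V = U' * transpose_mat V'"
    using assms by blast
  fix P assume "\<exists>U s V. thin_svd A U s V \<and> P = U * transpose_mat V"
  then obtain U' s' V' where svd': "thin_svd A U' s' V'" and P: "P = U' * transpose_mat V'" by blast
  show "P = U * transpose_mat V"
  proof (rule eq_matI)
    fix a b assume "a < dim_row (U * transpose_mat V)" "b < dim_col (U * transpose_mat V)"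
    then have ab: "a < dim_row A" "b < dim_col A" using assms by (auto simp: thin_svd_def)
    show "P $$ (a, b) = (U * transpose_mat V) $$ (a, b)"
      unfolding P
      using newton_schulz_tendsto_polar_factor[OF assms ab]
        newton_schulz_tendsto_polar_factor[OF svd' ab] LIMSEQ_unique by blast
  qed (use assms svd' in \<open>auto simp: P thin_svd_def\<close>)
qed

lemma finner_polar_svd:
  assumes svd: "thin_svd A U s V"
  shows "finner A (polar A) = sum_list s"
proof -
  have "U \<in> carrier_mat (dim_row A) (length s)" using svd unfolding thin_svd_def by blast
  then have P: "polar A = U * mat_diag (length s) (\<lambda>i. 1) * transpose_mat V"
    by (simp add: polar_eq[OF svd] mat_diag_one)
  have A: "A = U * mat_diag (length s) (\<lambda>k. s ! k) * transpose_mat V"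
    using svd unfolding thin_svd_def by blast
  show ?thesis
    using finner_mat_diag[OF svd, of "\<lambda>k. s ! k" "\<lambda>i. 1"]
    unfolding P[symmetric] A[symmetric]
    by (simp add: sum_list_sum_nth atLeast0LessThan)
qed

text \<open>Norm duality. The right-hand side refers to no decomposition, so the sum of the singular
  values is well defined; the same formula later yields the descent along the polar factor and the
  measurability of the norm.\<close>

lemma nuclear_norm_eq_finner_polar: "nuclear_norm A = finner A (polar A)"
  unfolding nuclear_norm_def
  by (rule the_equality) (use thin_svd_exists[of A] finner_polar_svd in metis)+

lemma polar_carrier: "polar A \<in> carrier_mat (dim_row A) (dim_col A)"
proof -
  obtain U s V where svd: "thin_svd A U s V" using thin_svd_exists by blast
  then have "U \<in> carrier_mat (dim_row A) (length s)" "V \<in> carrier_mat (dim_col A) (length s)"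
    unfolding thin_svd_def by blast+
  then show ?thesis unfolding polar_eq[OF svd] by auto
qed

text \<open>The squared Frobenius norm of the polar factor is the rank, which orthonormality bounds
  by the number of columns.\<close>

lemma frob2_polar_le: "frob2 (polar A) \<le> real (dim_col A)"
proof -
  obtain U s V where svd: "thin_svd A U s V" using thin_svd_exists by blast
  have "U \<in> carrier_mat (dim_row A) (length s)" using svd unfolding thin_svd_def by blast
  then have P: "polar A = U * mat_diag (length s) (\<lambda>i. 1) * transpose_mat V"
    by (simp add: polar_eq[OF svd] mat_diag_one)
  have "frob2 (polar A) = real (length s)"
    using finner_mat_diag[OF svd, of "\<lambda>i. 1" "\<lambda>i. 1"] unfolding P[symmetric] by simp
  then show ?thesis
    using orthonormal_fam_card[OF thin_svd_orthonormal_fam(2)[OF svd]] by simp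
qed

lemma frob2_le_nuclear_norm_sq: "frob2 A \<le> (nuclear_norm A)\<^sup>2"
  and nuclear_norm_nonneg: "0 \<le> nuclear_norm A"
proof -
  obtain U s V where svd: "thin_svd A U s V" using thin_svd_exists by blast
  have pos: "0 \<le> s ! i" if "i < length s" for i
    using svd that by (auto simp: thin_svd_def less_imp_le)
  have nuc: "nuclear_norm A = (\<Sum>i<length s. s ! i)"
    by (simp add: nuclear_norm_eq_finner_polar finner_polar_svd[OF svd] sum_list_sum_nth atLeast0LessThan)
  have "frob2 A = (\<Sum>i<length s. s ! i * s ! i)"
    by (simp add: thin_svd_frob2[OF svd] power2_eq_square)
  also have "\<dots> \<le> (\<Sum>i<length s. s ! i * (\<Sum>j<length s. s ! j))"
    by (intro sum_mono mult_left_mono member_le_sum) (auto simp: pos)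
  also have "\<dots> = (nuclear_norm A)\<^sup>2" by (simp add: nuc power2_eq_square sum_distrib_right)
  finally show "frob2 A \<le> (nuclear_norm A)\<^sup>2" .
  show "0 \<le> nuclear_norm A" unfolding nuc by (intro sum_nonneg) (auto simp: pos)
qed

lemma finner_polar_bound:
  assumes "dim_row A = dim_row B" "dim_col A = dim_col B"
  shows "\<bar>finner A (polar B)\<bar> \<le> sqrt (real (dim_col B)) * sqrt (frob2 A)"
proof -
  have "(finner A (polar B))\<^sup>2 \<le> frob2 A * frob2 (polar B)"
    using polar_carrier[of B] assms by (intro finner_Cauchy_Schwarz) auto
  also have "\<dots> \<le> frob2 A * real (dim_col B)"
    by (intro mult_left_mono frob2_polar_le frob2_nonneg)
  finally have "\<bar>finner A (polar B)\<bar> \<le> sqrt (frob2 A * real (dim_col B))"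
    by (intro real_le_rsqrt) simp
  then show ?thesis by (simp add: real_sqrt_mult mult.commute)
qed

lemma nuclear_norm_le: "nuclear_norm A \<le> sqrt (real (dim_col A)) * sqrt (frob2 A)"
  using finner_polar_bound[of A A] by (simp add: nuclear_norm_eq_finner_polar)

section \<open>Comparison of the spectral and Frobenius norms\<close>

lemma l2norm_mult_mat_vec_le:
  assumes "v \<in> carrier_vec (dim_col A)" "l2norm v \<le> 1"
  shows "l2norm (mult_mat_vec A v) \<le> sqrt (frob2 A)"
proof -
  let ?n = "dim_col A" and ?m = "dim_row A"
  have v: "(\<Sum>b<?n. (vec_index v b)\<^sup>2) \<le> 1"
    using assms by (simp add: l2norm_def scalar_prod_def power2_eq_square atLeast0LessThan)
  have "scalar_prod (mult_mat_vec A v) (mult_mat_vec A v) = (\<Sum>a<?m. (\<Sum>b<?n. A $$ (a, b) * vec_index v b)\<^sup>2)"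
    using assms by (simp add: scalar_prod_def power2_eq_square atLeast0LessThan)
  also have "\<dots> \<le> (\<Sum>a<?m. (\<Sum>b<?n. (A $$ (a, b))\<^sup>2) * (\<Sum>b<?n. (vec_index v b)\<^sup>2))"
    by (intro sum_mono Cauchy_Schwarz_ineq_sum)
  also have "\<dots> \<le> (\<Sum>a<?m. (\<Sum>b<?n. (A $$ (a, b))\<^sup>2) * 1)"
    by (intro sum_mono mult_left_mono v sum_nonneg) auto
  also have "\<dots> = frob2 A"
    by (simp add: finner_def sum.cartesian_product power2_eq_square)
  finally show ?thesis by (simp add: l2norm_def)
qed

lemma spectral_norm_le_frob: "spectral_norm A \<le> sqrt (frob2 A)"
  and spectral_norm_nonneg: "0 \<le> spectral_norm A"
proof -
  let ?S = "{l2norm (mult_mat_vec A v) | v. v \<in> carrier_vec (dim_col A) \<and> l2norm v \<le> 1}"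
  have z: "0\<^sub>v (dim_col A) \<in> carrier_vec (dim_col A)" "l2norm (0\<^sub>v (dim_col A)) \<le> 1"
    by (auto simp: l2norm_def)
  then have mem: "l2norm (mult_mat_vec A (0\<^sub>v (dim_col A))) \<in> ?S" by blast
  have le: "x \<le> sqrt (frob2 A)" if "x \<in> ?S" for x
    using that l2norm_mult_mat_vec_le by blast
  show "spectral_norm A \<le> sqrt (frob2 A)"
    unfolding spectral_norm_def by (rule cSup_least) (use mem le in blast)+
  have "0 \<le> l2norm (mult_mat_vec A (0\<^sub>v (dim_col A)))"
    unfolding l2norm_def by (auto simp: scalar_prod_def intro!: sum_nonneg)
  also have "\<dots> \<le> spectral_norm A"
    unfolding spectral_norm_def by (rule cSup_upper[OF mem]) (rule bdd_aboveI[OF le])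
  finally show "0 \<le> spectral_norm A" .
qed

section \<open>Borel measurability of matrix-valued maps\<close>

definition measurable_mat :: "'a measure \<Rightarrow> nat \<Rightarrow> nat \<Rightarrow> ('a \<Rightarrow> real mat) \<Rightarrow> bool" where
  "measurable_mat M m n F \<longleftrightarrow> (\<forall>x. F x \<in> carrier_mat m n) \<and>
     (\<forall>a<m. \<forall>b<n. (\<lambda>x. F x $$ (a, b)) \<in> borel_measurable M)"

lemma measurable_matD:
  assumes "measurable_mat M m n F"
  shows "F x \<in> carrier_mat m n" "dim_row (F x) = m" "dim_col (F x) = n"
    "a < m \<Longrightarrow> b < n \<Longrightarrow> (\<lambda>x. F x $$ (a, b)) \<in> borel_measurable M"
proof -
  show c: "F x \<in> carrier_mat m n" using assms unfolding measurable_mat_def by blast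
  show "dim_row (F x) = m" "dim_col (F x) = n" using c by auto
  show "a < m \<Longrightarrow> b < n \<Longrightarrow> (\<lambda>x. F x $$ (a, b)) \<in> borel_measurable M"
    using assms unfolding measurable_mat_def by blast
qed

lemma measurable_mat_mult:
  assumes F: "measurable_mat M m k F" and G: "measurable_mat M k n G"
  shows "measurable_mat M m n (\<lambda>x. F x * G x)"
proof -
  have "(\<lambda>x. (F x * G x) $$ (a, b)) \<in> borel_measurable M" if ab: "a < m" "b < n" for a b
  proof -
    have "(\<lambda>x. (F x * G x) $$ (a, b)) = (\<lambda>x. \<Sum>i<k. F x $$ (a, i) * G x $$ (i, b))"
      using ab measurable_matD[OF F] measurable_matD[OF G]
      by (auto simp: scalar_prod_def atLeast0LessThan fun_eq_iff)
    then show ?thesis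
      using ab measurable_matD(4)[OF F] measurable_matD(4)[OF G] by simp
  qed
  then show ?thesis
    using measurable_matD(1)[OF F] measurable_matD(1)[OF G]
    unfolding measurable_mat_def by (auto intro!: mult_carrier_mat[of _ m k])
qed

lemma measurable_mat_transpose:
  assumes F: "measurable_mat M m n F"
  shows "measurable_mat M n m (\<lambda>x. transpose_mat (F x))"
  unfolding measurable_mat_def
proof (intro conjI allI impI)
  show "transpose_mat (F x) \<in> carrier_mat n m" for x
    using measurable_matD(1)[OF F] by simp
  fix a b assume "a < n" "b < m"
  then show "(\<lambda>x. transpose_mat (F x) $$ (a, b)) \<in> borel_measurable M"
    using measurable_matD(4)[OF F] by (simp add: measurable_matD(2,3)[OF F])
qed

lemma measurable_mat_smult:
  assumes F: "measurable_mat M m n F" and c: "c \<in> borel_measurable M"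
  shows "measurable_mat M m n (\<lambda>x. c x \<cdot>\<^sub>m F x)"
  unfolding measurable_mat_def
proof (intro conjI allI impI)
  show "c x \<cdot>\<^sub>m F x \<in> carrier_mat m n" for x
    using measurable_matD(1)[OF F] by simp
  fix a b assume "a < m" "b < n"
  then show "(\<lambda>x. (c x \<cdot>\<^sub>m F x) $$ (a, b)) \<in> borel_measurable M"
    using measurable_matD(4)[OF F] c by (simp add: measurable_matD(2,3)[OF F])
qed

lemma measurable_mat_minus:
  assumes F: "measurable_mat M m n F" and G: "measurable_mat M m n G"
  shows "measurable_mat M m n (\<lambda>x. F x - G x)"
  unfolding measurable_mat_def
proof (intro conjI allI impI)
  show "F x - G x \<in> carrier_mat m n" for x
    using measurable_matD(1)[OF G] by (rule minus_carrier_mat)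
  fix a b assume "a < m" "b < n"
  then show "(\<lambda>x. (F x - G x) $$ (a, b)) \<in> borel_measurable M"
    using measurable_matD(4)[OF F] measurable_matD(4)[OF G]
    by (simp add: measurable_matD(2,3)[OF F] measurable_matD(2,3)[OF G])
qed

lemma measurable_finner:
  assumes F: "measurable_mat M m n F" and G: "measurable_mat M m n G"
  shows "(\<lambda>x. finner (F x) (G x)) \<in> borel_measurable M"
  unfolding finner_def measurable_matD(2,3)[OF F]
  by (intro borel_measurable_sum borel_measurable_times)
    (auto intro: measurable_matD(4)[OF F] measurable_matD(4)[OF G])

lemma measurable_mat_newton_schulz:
  assumes F: "measurable_mat M m n F"
  shows "measurable_mat M m n (\<lambda>x. newton_schulz (F x) j)"
proof (induction j)
  case 0
  have "(\<lambda>x. 1 / (1 + sqrt (frob2 (F x)))) \<in> borel_measurable M"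
    using measurable_finner[OF F F] by measurable
  then show ?case by (simp add: measurable_mat_smult[OF F])
next
  case (Suc j)
  then show ?case
    by (auto intro!: measurable_mat_minus measurable_mat_smult measurable_mat_mult[of M m n _ n]
        measurable_mat_mult[of M n m _ n] measurable_mat_transpose)
qed

lemma measurable_mat_polar:
  assumes F: "measurable_mat M m n F"
  shows "measurable_mat M m n (\<lambda>x. polar (F x))"
  unfolding measurable_mat_def
proof (intro conjI allI impI)
  show "polar (F x) \<in> carrier_mat m n" for x
    using polar_carrier[of "F x"] measurable_matD(2,3)[OF F] by simp
  fix a b assume ab: "a < m" "b < n"
  show "(\<lambda>x. polar (F x) $$ (a, b)) \<in> borel_measurable M"
  proof (rule borel_measurable_LIMSEQ_real)
    show "(\<lambda>x. newton_schulz (F x) j $$ (a, b)) \<in> borel_measurable M" for j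
      using measurable_matD(4)[OF measurable_mat_newton_schulz[OF F]] ab by blast
    show "(\<lambda>j. newton_schulz (F x) j $$ (a, b)) \<longlonglongrightarrow> polar (F x) $$ (a, b)" for x
    proof -
      obtain U s V where svd: "thin_svd (F x) U s V" using thin_svd_exists by blast
      show ?thesis
        unfolding polar_eq[OF svd]
        using newton_schulz_tendsto_polar_factor[OF svd] ab measurable_matD(2,3)[OF F] by simp
    qed
  qed
qed

lemma measurable_nuclear_norm:
  assumes F: "measurable_mat M m n F"
  shows "(\<lambda>x. nuclear_norm (F x)) \<in> borel_measurable M"
  unfolding nuclear_norm_eq_finner_polar
  by (rule measurable_finner[OF F measurable_mat_polar[OF F]])

section \<open>Layer tuples as Euclidean vectors\<close>

definition layer :: "('l::finite, 'e::finite) shape \<Rightarrow> 'e \<Rightarrow> 'l" where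
  "layer S e = fst (entry S e)"

lemma valid_shape_bij:
  "valid_shape S \<Longrightarrow> bij_betw (entry S) UNIV (SIGMA i:UNIV. {..<rows S i} \<times> {..<cols S i})"
  by (simp add: valid_shape_def)

lemma block_dims [simp]:
  "dim_row (block S X i) = rows S i" "dim_col (block S X i) = cols S i"
  by (simp_all add: block_def)

lemma block_carrier: "block S X i \<in> carrier_mat (rows S i) (cols S i)"
  by (simp add: block_def)

lemma block_diff: "block S (X - Y) i = block S X i - block S Y i"
  by (rule eq_matI) (auto simp: block_def)

lemma entry_cases:
  assumes "valid_shape S"
  obtains a b where "entry S e = (layer S e, a, b)" "a < rows S (layer S e)" "b < cols S (layer S e)"
    "\<And>X. block S X (layer S e) $$ (a, b) = X $ e"
proof -
  obtain i a b where e: "entry S e = (i, a, b)" by (cases "entry S e") auto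
  then have i: "i = layer S e" by (simp add: layer_def)
  have "entry S e \<in> (SIGMA i:UNIV. {..<rows S i} \<times> {..<cols S i})"
    using valid_shape_bij[OF assms] UNIV_I by (rule bij_betw_apply)
  then have ab: "a < rows S i" "b < cols S i" by (simp_all add: e)
  have "inv_into UNIV (entry S) (i, a, b) = e"
    using inv_into_f_f[of "entry S" UNIV e] valid_shape_bij[OF assms] e by (simp add: bij_betw_def)
  then show thesis using that[of a b] e i ab by (simp add: block_def)
qed

text \<open>Reindexing between the positions of one matrix and the coordinates of its layer. The
  free \<open>h\<close> serves three purposes: counting coordinates, Frobenius products and the mean
  absolute value.\<close>

lemma sum_block:
  assumes "valid_shape S"
  shows "(\<Sum>p\<in>{..<rows S i} \<times> {..<cols S i}. h (block S X i $$ p) (block S Y i $$ p))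
    = (\<Sum>e | layer S e = i. h (X $ e) (Y $ e))"
proof (rule sum.reindex_bij_witness[where j = "\<lambda>p. inv_into UNIV (entry S) (i, p)" and i = "\<lambda>e. snd (entry S e)"])
  note bij = valid_shape_bij[OF assms]
  fix p assume p: "p \<in> {..<rows S i} \<times> {..<cols S i}"
  then have E: "entry S (inv_into UNIV (entry S) (i, p)) = (i, p)"
    using bij by (intro f_inv_into_f) (auto simp: bij_betw_def)
  then show "snd (entry S (inv_into UNIV (entry S) (i, p))) = p"
    "inv_into UNIV (entry S) (i, p) \<in> {e. layer S e = i}"
    by (auto simp: layer_def)
  show "h (X $ inv_into UNIV (entry S) (i, p)) (Y $ inv_into UNIV (entry S) (i, p))
      = h (block S X i $$ p) (block S Y i $$ p)"
    using p by (cases p) (simp add: block_def)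
next
  note bij = valid_shape_bij[OF assms]
  fix e assume e: "e \<in> {e. layer S e = i}"
  then have pe: "(i, snd (entry S e)) = entry S e" by (auto simp: layer_def)
  have "entry S e \<in> (SIGMA i:UNIV. {..<rows S i} \<times> {..<cols S i})"
    using bij UNIV_I by (rule bij_betw_apply)
  then show "snd (entry S e) \<in> {..<rows S i} \<times> {..<cols S i}" using pe by (cases "entry S e") auto
  show "inv_into UNIV (entry S) (i, snd (entry S e)) = e"
    unfolding pe using inv_into_f_f[of "entry S" UNIV e] bij by (simp add: bij_betw_def)
qed

lemma card_layer:
  assumes "valid_shape S"
  shows "card {e. layer S e = i} = rows S i * cols S i"
  using sum_block[OF assms, of "\<lambda>_ _. 1::nat" 0 i 0] by simp

lemma layer_size_bounds:
  fixes S :: "('l::finite, 'e::finite) shape"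
  assumes "valid_shape S"
  shows "1 \<le> rows S i * cols S i" "rows S i * cols S i \<le> CARD('e)" "cols S i \<le> CARD('e)"
proof -
  have rc: "1 \<le> rows S i" "1 \<le> cols S i" using assms by (auto simp: valid_shape_def)
  show "1 \<le> rows S i * cols S i" using rc by simp
  show le: "rows S i * cols S i \<le> CARD('e)"
    unfolding card_layer[OF assms, symmetric] by (rule card_mono) auto
  have "1 * cols S i \<le> rows S i * cols S i" using rc(1) by (rule mult_le_mono1)
  with le show "cols S i \<le> CARD('e)" by linarith
qed

lemma finner_block:
  assumes "valid_shape S"
  shows "finner (block S X i) (block S Y i) = (\<Sum>e | layer S e = i. X $ e * Y $ e)"
  using sum_block[OF assms, of "(*)" X i Y] by (simp add: finner_def)

lemma sum_by_layer: "(\<Sum>i\<in>UNIV. \<Sum>e | layer S e = i. h e) = (\<Sum>e\<in>UNIV. h e)"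
  using sum.group[of UNIV UNIV "layer S" h] by simp

lemma inner_eq_sum_finner:
  assumes "valid_shape S"
  shows "inner X Y = (\<Sum>i\<in>UNIV. finner (block S X i) (block S Y i))"
  unfolding finner_block[OF assms] sum_by_layer by (simp add: inner_vec_def)

lemma norm_sq_eq_sum_frob2:
  assumes "valid_shape S"
  shows "(norm X)\<^sup>2 = (\<Sum>i\<in>UNIV. frob2 (block S X i))"
  by (simp add: power2_norm_eq_inner inner_eq_sum_finner[OF assms])

lemma frob2_block_le:
  assumes "valid_shape S"
  shows "frob2 (block S X i) \<le> (norm X)\<^sup>2"
  unfolding norm_sq_eq_sum_frob2[OF assms] by (rule member_le_sum) (auto simp: frob2_nonneg)

lemma nuclear_norm_block_sq_le:
  fixes S :: "('l::finite, 'e::finite) shape"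
  assumes "valid_shape S"
  shows "(nuclear_norm (block S X i))\<^sup>2 \<le> real CARD('e) * frob2 (block S X i)"
proof -
  have "(nuclear_norm (block S X i))\<^sup>2 \<le> (sqrt (real (cols S i)) * sqrt (frob2 (block S X i)))\<^sup>2"
    using nuclear_norm_le[of "block S X i"] nuclear_norm_nonneg by (intro power_mono) auto
  also have "\<dots> = real (cols S i) * frob2 (block S X i)"
    by (simp add: power_mult_distrib frob2_nonneg)
  also have "\<dots> \<le> real CARD('e) * frob2 (block S X i)"
    using layer_size_bounds[OF assms, of i] by (intro mult_right_mono frob2_nonneg) simp
  finally show ?thesis .
qed

lemma nuclear_norm_block_le:
  fixes S :: "('l::finite, 'e::finite) shape"
  assumes "valid_shape S"
  shows "nuclear_norm (block S X i) \<le> real CARD('e) * norm X"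
proof -
  have "(nuclear_norm (block S X i))\<^sup>2 \<le> real CARD('e) * frob2 (block S X i)"
    by (rule nuclear_norm_block_sq_le[OF assms])
  also have "\<dots> \<le> real CARD('e) * (norm X)\<^sup>2"
    by (intro mult_left_mono frob2_block_le[OF assms]) simp
  also have "\<dots> \<le> (real CARD('e))\<^sup>2 * (norm X)\<^sup>2"
    by (intro mult_right_mono) (auto simp: power2_eq_square Suc_leI)
  finally have "(nuclear_norm (block S X i))\<^sup>2 \<le> (real CARD('e) * norm X)\<^sup>2"
    by (simp add: power_mult_distrib)
  then show ?thesis by (rule power2_le_imp_le) simp
qed

lemma norm_sq_le_nuclear_norm_sq:
  assumes "valid_shape S"
  shows "(norm X)\<^sup>2 \<le> nuclear_norm_sq S X"
  unfolding norm_sq_eq_sum_frob2[OF assms] nuclear_norm_sq_def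
  by (intro sum_mono frob2_le_nuclear_norm_sq)

lemma nuclear_norm_sq_le_norm_sq:
  fixes S :: "('l::finite, 'e::finite) shape"
  assumes "valid_shape S"
  shows "nuclear_norm_sq S X \<le> real CARD('e) * (norm X)\<^sup>2"
  unfolding norm_sq_eq_sum_frob2[OF assms] nuclear_norm_sq_def sum_distrib_left
  by (intro sum_mono nuclear_norm_block_sq_le[OF assms])

lemma norm_le_sum_nuclear_norm:
  assumes "valid_shape S"
  shows "norm X \<le> (\<Sum>i\<in>UNIV. nuclear_norm (block S X i))"
proof (rule power2_le_imp_le)
  let ?\<nu> = "\<lambda>i. nuclear_norm (block S X i)"
  have "(norm X)\<^sup>2 \<le> (\<Sum>i\<in>UNIV. ?\<nu> i * ?\<nu> i)"
    using norm_sq_le_nuclear_norm_sq[OF assms] by (simp add: nuclear_norm_sq_def power2_eq_square)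
  also have "\<dots> \<le> (\<Sum>i\<in>UNIV. ?\<nu> i * (\<Sum>j\<in>UNIV. ?\<nu> j))"
    by (intro sum_mono mult_left_mono member_le_sum) (auto simp: nuclear_norm_nonneg)
  also have "\<dots> = (\<Sum>i\<in>UNIV. ?\<nu> i)\<^sup>2" by (simp add: power2_eq_square sum_distrib_right)
  finally show "(norm X)\<^sup>2 \<le> (\<Sum>i\<in>UNIV. ?\<nu> i)\<^sup>2" .
qed (auto intro: sum_nonneg simp: nuclear_norm_nonneg)

lemma spectral_norm_block_le:
  assumes "valid_shape S"
  shows "spectral_norm (block S X i) \<le> norm X"
proof -
  have "spectral_norm (block S X i) \<le> sqrt (frob2 (block S X i))" by (rule spectral_norm_le_frob)
  also have "\<dots> \<le> sqrt ((norm X)\<^sup>2)" by (intro real_sqrt_le_mono frob2_block_le[OF assms])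
  finally show ?thesis by simp
qed

lemma norm_of_blocks_inner:
  assumes "valid_shape S" "\<And>i. B i \<in> carrier_mat (rows S i) (cols S i)"
  shows "inner X (of_blocks S B) = (\<Sum>i\<in>UNIV. finner (block S X i) (B i))"
    and "(norm (of_blocks S B))\<^sup>2 = (\<Sum>i\<in>UNIV. frob2 (B i))"
  by (simp_all add: inner_eq_sum_finner[OF assms(1)] norm_sq_eq_sum_frob2[OF assms(1)] block_of_blocks[OF assms])

section \<open>The update direction and its inner product with a gradient\<close>

definition muon_direction ::
  "('l::finite, 'e::finite) shape \<Rightarrow> ('l \<Rightarrow> real mat \<Rightarrow> real) \<Rightarrow> real ^ 'e \<Rightarrow> real ^ 'e" where
  "muon_direction S lr g = of_blocks S (\<lambda>i. lr i (block S g i) \<cdot>\<^sub>m polar (block S g i))"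

lemma finner_smult_right: "B \<in> carrier_mat (dim_row A) (dim_col A) \<Longrightarrow> finner A (c \<cdot>\<^sub>m B) = c * finner A B"
  by (auto simp: finner_def sum_distrib_left mult_ac intro!: sum.cong)

lemma frob2_smult: "frob2 (c \<cdot>\<^sub>m A) = c\<^sup>2 * frob2 A"
  by (auto simp: finner_def sum_distrib_left mult_ac power2_eq_square intro!: sum.cong)

lemma polar_block_carrier: "polar (block S g i) \<in> carrier_mat (rows S i) (cols S i)"
  using polar_carrier[of "block S g i"] by simp

lemma muon_update_eq:
  assumes "valid_shape S"
  shows "of_blocks S (\<lambda>i. block S X i - lr i (block S g i) \<cdot>\<^sub>m polar (block S g i))
    = X - muon_direction S lr g"
unfolding Finite_Cartesian_Product.vec_eq_iff
proof
  fix e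
  obtain a b where e: "entry S e = (layer S e, a, b)" "a < rows S (layer S e)" "b < cols S (layer S e)"
    "\<And>X. block S X (layer S e) $$ (a, b) = X $ e"
    using entry_cases[OF assms] by metis
  then show "of_blocks S (\<lambda>i. block S X i - lr i (block S g i) \<cdot>\<^sub>m polar (block S g i)) $ e
      = (X - muon_direction S lr g) $ e"
    using polar_block_carrier[of S g "layer S e"]
    by (simp add: of_blocks_def muon_direction_def)
qed

lemma inner_muon_direction:
  assumes "valid_shape S"
  shows "inner X (muon_direction S lr g)
    = (\<Sum>i\<in>UNIV. lr i (block S g i) * finner (block S X i) (polar (block S g i)))"
proof -
  have "finner (block S X i) (lr i (block S g i) \<cdot>\<^sub>m polar (block S g i))
      = lr i (block S g i) * finner (block S X i) (polar (block S g i))" for i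
    using polar_block_carrier[of S g i] by (intro finner_smult_right) auto
  then show ?thesis
    unfolding muon_direction_def using polar_block_carrier[of S g]
    by (subst norm_of_blocks_inner[OF assms]) (auto intro!: smult_carrier_mat)
qed

lemma norm_muon_direction_sq_le:
  fixes S :: "('l::finite, 'e::finite) shape"
  assumes "valid_shape S"
  shows "(norm (muon_direction S lr g))\<^sup>2 \<le> real CARD('e) * (\<Sum>i\<in>UNIV. (lr i (block S g i))\<^sup>2)"
proof -
  have "(norm (muon_direction S lr g))\<^sup>2
      = (\<Sum>i\<in>UNIV. (lr i (block S g i))\<^sup>2 * frob2 (polar (block S g i)))"
    unfolding muon_direction_def using polar_block_carrier[of S g]
    by (subst norm_of_blocks_inner[OF assms]) (auto intro!: smult_carrier_mat simp: frob2_smult)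
  also have "\<dots> \<le> (\<Sum>i\<in>UNIV. (lr i (block S g i))\<^sup>2 * real CARD('e))"
  proof (intro sum_mono mult_left_mono)
    fix i
    have "frob2 (polar (block S g i)) \<le> real (cols S i)" using frob2_polar_le[of "block S g i"] by simp
    also have "\<dots> \<le> real CARD('e)" using layer_size_bounds(3)[OF assms, of i] by simp
    finally show "frob2 (polar (block S g i)) \<le> real CARD('e)" .
  qed auto
  finally show ?thesis by (simp only: sum_distrib_left mult.commute)
qed

lemma finner_block_diff_left:
  assumes "valid_shape S" "P \<in> carrier_mat (rows S i) (cols S i)"
  shows "finner (block S (X - Y) i) P = finner (block S X i) P - finner (block S Y i) P"
proof -
  have "finner (block S (X - Y) i) P
      = (\<Sum>p\<in>{..<rows S i} \<times> {..<cols S i}. block S X i $$ p * P $$ p - block S Y i $$ p * P $$ p)"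
    unfolding finner_def block_dims
    by (intro sum.cong refl) (auto simp: block_def left_diff_distrib)
  then show ?thesis by (simp add: finner_def sum_subtractf)
qed

text \<open>By duality the polar factor of \<open>g\<close> pairs with \<open>g\<close> to the
  nuclear norm; replacing \<open>g\<close> by \<open>X\<close> costs the pairing with
  \<open>X - g\<close>, bounded by Cauchy-Schwarz. Later \<open>X\<close> is the gradient and
  \<open>g\<close> the server estimate.\<close>

lemma finner_block_polar_ge:
  fixes S :: "('l::finite, 'e::finite) shape"
  assumes "valid_shape S"
  shows "nuclear_norm (block S g i) - sqrt (real CARD('e)) * sqrt (frob2 (block S (X - g) i))
    \<le> finner (block S X i) (polar (block S g i))"
proof -
  let ?P = "polar (block S g i)"
  have "\<bar>finner (block S (X - g) i) ?P\<bar> \<le> sqrt (real (cols S i)) * sqrt (frob2 (block S (X - g) i))"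
    using finner_polar_bound[of "block S (X - g) i" "block S g i"] by simp
  also have "\<dots> \<le> sqrt (real CARD('e)) * sqrt (frob2 (block S (X - g) i))"
    using layer_size_bounds(3)[OF assms, of i] by (intro mult_right_mono) (auto simp: frob2_nonneg)
  finally have "- (sqrt (real CARD('e)) * sqrt (frob2 (block S (X - g) i))) \<le> finner (block S (X - g) i) ?P"
    by linarith
  moreover have "finner (block S X i) ?P = nuclear_norm (block S g i) + finner (block S (X - g) i) ?P"
    unfolding finner_block_diff_left[OF assms polar_block_carrier] nuclear_norm_eq_finner_polar by simp
  ultimately show ?thesis by linarith
qed

section \<open>The scaled sign as a contraction\<close>

lemma compress_nth:
  assumes "valid_shape S"
  shows "compress S R Y $ e = (\<Sum>e' | layer S e' = layer S e. \<bar>Y $ e'\<bar>) / real (card {e'. layer S e' = layer S e})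
    * (if Y $ e = 0 then R $ e else sgn (Y $ e))"
proof -
  have "mean_abs (block S Y i) = (\<Sum>e' | layer S e' = i. \<bar>Y $ e'\<bar>) / real (card {e'. layer S e' = i})" for i
    using sum_block[OF assms, of "\<lambda>y _. \<bar>y\<bar>" Y i Y]
    by (simp add: mean_abs_def card_layer[OF assms] sum.cartesian_product case_prod_beta)
  moreover obtain a b where "entry S e = (layer S e, a, b)" "a < rows S (layer S e)" "b < cols S (layer S e)"
    "\<And>X. block S X (layer S e) $$ (a, b) = X $ e"
    using entry_cases[OF assms] by metis
  ultimately show ?thesis by (simp add: compress_def of_blocks_def scaled_sign_def)
qed

text \<open>In a layer with \<open>d\<close> entries of mean absolute value \<open>m\<close> and
  squared norm \<open>Q\<close> the squared error is exactly \<open>Q - d * m\<^sup>2\<close>. Since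
  the Euclidean norm is at most the 1-norm, \<open>Q \<le> (d * m)\<^sup>2\<close>, and the error is
  at most \<open>Q - Q / d\<close>.\<close>

lemma compress_contraction:
  fixes S :: "('l::finite, 'e::finite) shape"
  assumes S: "valid_shape S" and R: "\<And>e. R $ e \<in> {-1, 1}"
  shows "(norm (compress S R Y - Y))\<^sup>2 \<le> (1 - 1 / real CARD('e)) * (norm Y)\<^sup>2"
proof -
  have layerwise: "(\<Sum>e | layer S e = i. (compress S R Y $ e - Y $ e)\<^sup>2)
      \<le> (1 - 1 / real CARD('e)) * (\<Sum>e | layer S e = i. (Y $ e)\<^sup>2)" for i
  proof -
    let ?I = "{e. layer S e = i}"
    define d where "d = real (card ?I)"
    define m where "m = (\<Sum>e\<in>?I. \<bar>Y $ e\<bar>) / d"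
    define Q where "Q = (\<Sum>e\<in>?I. (Y $ e)\<^sup>2)"
    have "1 \<le> card ?I" "card ?I \<le> CARD('e)"
      using layer_size_bounds[OF S, of i] by (simp_all add: card_layer[OF S])
    then have d: "1 \<le> d" "d \<le> real CARD('e)" unfolding d_def by linarith+
    have dm: "(\<Sum>e\<in>?I. \<bar>Y $ e\<bar>) = d * m" using d by (simp add: m_def)
    have "(\<Sum>e\<in>?I. (compress S R Y $ e - Y $ e)\<^sup>2) = (\<Sum>e\<in>?I. m\<^sup>2 - 2 * m * \<bar>Y $ e\<bar> + (Y $ e)\<^sup>2)"
    proof (intro sum.cong refl)
      fix e assume "e \<in> ?I"
      then have "compress S R Y $ e = m * (if Y $ e = 0 then R $ e else sgn (Y $ e))"
        unfolding compress_nth[OF S] m_def d_def by simp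
      \<comment> \<open>A zero entry is sent to plus or minus \<open>m\<close>; its error is
        \<open>m\<^sup>2\<close> for either sign, in agreement with the formula.\<close>
      then show "(compress S R Y $ e - Y $ e)\<^sup>2 = m\<^sup>2 - 2 * m * \<bar>Y $ e\<bar> + (Y $ e)\<^sup>2"
        using R[of e] by (auto simp: power2_eq_square sgn_if algebra_simps)
    qed
    also have "\<dots> = d * m\<^sup>2 - 2 * m * (\<Sum>e\<in>?I. \<bar>Y $ e\<bar>) + Q"
      by (simp add: sum.distrib sum_subtractf sum_distrib_left d_def Q_def)
    also have "\<dots> = Q - d * m\<^sup>2" by (simp add: dm power2_eq_square)
    also have "\<dots> \<le> Q - Q / d"
    proof -
      have "Q \<le> (\<Sum>e\<in>?I. \<bar>Y $ e\<bar> * (\<Sum>e\<in>?I. \<bar>Y $ e\<bar>))"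
      proof -
        have "Q = (\<Sum>e\<in>?I. \<bar>Y $ e\<bar> * \<bar>Y $ e\<bar>)" by (simp add: Q_def power2_eq_square)
        also have "\<dots> \<le> (\<Sum>e\<in>?I. \<bar>Y $ e\<bar> * (\<Sum>e\<in>?I. \<bar>Y $ e\<bar>))"
          by (intro sum_mono mult_left_mono member_le_sum) auto
        finally show ?thesis .
      qed
      also have "\<dots> = (d * m)\<^sup>2" by (simp add: dm power2_eq_square flip: sum_distrib_right)
      also have "\<dots> = d * (d * m\<^sup>2)" by (simp add: power2_eq_square)
      finally have "Q / d \<le> d * m\<^sup>2" using d by (simp add: divide_le_eq mult.commute)
      then show ?thesis by simp
    qed
    also have "\<dots> \<le> (1 - 1 / real CARD('e)) * Q"
    proof -
      have "0 \<le> Q" by (simp add: Q_def sum_nonneg)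
      then have "Q / real CARD('e) \<le> Q / d" using d by (intro divide_left_mono) auto
      then show ?thesis by (simp add: left_diff_distrib)
    qed
    finally show ?thesis by (simp add: Q_def)
  qed
  have sq: "(norm Z)\<^sup>2 = (\<Sum>i\<in>UNIV. \<Sum>e | layer S e = i. (Z $ e)\<^sup>2)" for Z :: "real ^ 'e"
    unfolding sum_by_layer power2_norm_eq_inner by (simp add: inner_vec_def power2_eq_square)
  show ?thesis
    unfolding sq sum_distrib_left[of _ _ UNIV] using layerwise by (intro sum_mono) simp
qed

section \<open>Gradients\<close>

lemma GDERIV_grad:
  fixes f :: "real ^ 'e::finite \<Rightarrow> real"
  assumes "f differentiable (at X)"
  shows "GDERIV f X :> grad f X"
proof -
  obtain f' where f': "(f has_derivative f') (at X)" using assms by (auto simp: differentiable_def)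
  then have lin: "linear f'" using has_derivative_linear by blast
  define D where "D = (\<Sum>b\<in>Basis. f' b *\<^sub>R b)"
  have "f' = (\<lambda>h. inner h D)"
  proof
    fix h :: "real ^ 'e"
    have "f' h = f' (\<Sum>b\<in>Basis. inner h b *\<^sub>R b)" by (simp add: euclidean_representation)
    also have "\<dots> = (\<Sum>b\<in>Basis. inner h b * f' b)"
      by (simp add: linear_sum[OF lin] linear_cmul[OF lin])
    also have "\<dots> = inner h D" by (simp add: D_def inner_sum_right mult.commute)
    finally show "f' h = inner h D" .
  qed
  with f' have D: "GDERIV f X :> D" by (simp add: gderiv_def)
  show ?thesis
    unfolding grad_def
  proof (rule theI[where a = D])
    show "GDERIV f X :> D" by (rule D)
    fix E assume "GDERIV f X :> E"
    then have "(\<lambda>h. inner h E) = (\<lambda>h. inner h D)"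
      using D has_derivative_unique unfolding gderiv_def by blast
    then have "inner h (E - D) = 0" for h by (simp add: inner_diff_right fun_eq_iff)
    from this[of "E - D"] show "E = D" by simp
  qed
qed

lemma grad_eqI: "GDERIV f X :> D \<Longrightarrow> grad f X = D" for f :: "real ^ 'e::finite \<Rightarrow> real"
proof -
  assume D: "GDERIV f X :> D"
  then have "f differentiable (at X)" by (auto simp: gderiv_def differentiable_def)
  then have E: "GDERIV f X :> grad f X" by (rule GDERIV_grad)
  then have "(\<lambda>h. inner h (grad f X)) = (\<lambda>h. inner h D)"
    using D has_derivative_unique unfolding gderiv_def by blast
  then have "inner h (grad f X - D) = 0" for h by (simp add: inner_diff_right fun_eq_iff)
  from this[of "grad f X - D"] show ?thesis by simp
qed

lemma has_derivative_average:
  fixes fs :: "'c::finite \<Rightarrow> real ^ 'e::finite \<Rightarrow> real"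
  assumes "\<And>j. fs j differentiable (at X)"
  shows "GDERIV (average fs) X :> (1 / real CARD('c)) *\<^sub>R (\<Sum>j\<in>UNIV. grad (fs j) X)"
proof -
  have "(fs j has_derivative (\<lambda>h. inner h (grad (fs j) X))) (at X)" for j
    using GDERIV_grad[OF assms] by (simp add: gderiv_def)
  then have "(average fs has_derivative (\<lambda>h. (\<Sum>j\<in>UNIV. inner h (grad (fs j) X)) / real CARD('c))) (at X)"
    unfolding average_def[abs_def] by (auto intro!: derivative_eq_intros)
  then show ?thesis by (simp add: gderiv_def inner_sum_right)
qed

lemma grad_average:
  fixes fs :: "'c::finite \<Rightarrow> real ^ 'e::finite \<Rightarrow> real"
  assumes "\<And>j. fs j differentiable (at X)"
  shows "grad (average fs) X = (1 / real CARD('c)) *\<^sub>R (\<Sum>j\<in>UNIV. grad (fs j) X)"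
  by (rule grad_eqI[OF has_derivative_average[OF assms]])

text \<open>The mean value theorem on the segment from \<open>X\<close> to \<open>Y\<close>. The
  Lipschitz bound is required only from the base point, because under generalized smoothness
  \<open>K\<close> depends on \<open>X\<close>.\<close>

lemma descent_inequality:
  fixes f :: "real ^ 'e::finite \<Rightarrow> real"
  assumes diff: "\<And>X. f differentiable (at X)"
    and lip: "\<And>Y. norm (grad f Y - grad f X) \<le> K * norm (Y - X)"
  shows "f Y \<le> f X + inner (grad f X) (Y - X) + K * (norm (Y - X))\<^sup>2"
proof -
  define \<phi> where "\<phi> t = f (X + t *\<^sub>R (Y - X))" for t
  have der: "DERIV \<phi> t :> inner (Y - X) (grad f (X + t *\<^sub>R (Y - X)))" for t
  proof -
    have 1: "((\<lambda>t. X + t *\<^sub>R (Y - X)) has_derivative (\<lambda>h. h *\<^sub>R (Y - X))) (at t)"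
      by (auto intro!: derivative_eq_intros)
    have 2: "(f has_derivative (\<lambda>h. inner h (grad f (X + t *\<^sub>R (Y - X))))) (at (X + t *\<^sub>R (Y - X)))"
      using GDERIV_grad[OF diff] by (simp add: gderiv_def)
    show ?thesis
      using has_derivative_compose[OF 1 2]
      by (simp add: \<phi>_def[abs_def] has_field_derivative_def mult_commute_abs)
  qed
  have "\<exists>t>0. t < 1 \<and> \<phi> 1 - \<phi> 0 = (1 - 0) * inner (Y - X) (grad f (X + t *\<^sub>R (Y - X)))"
    by (rule MVT2) (use der in auto)
  then obtain t where t: "0 < t" "t < 1" "f Y - f X = inner (Y - X) (grad f (X + t *\<^sub>R (Y - X)))"
    by (auto simp: \<phi>_def)
  let ?Z = "X + t *\<^sub>R (Y - X)"
  have "inner (Y - X) (grad f ?Z - grad f X) \<le> norm (Y - X) * norm (grad f ?Z - grad f X)"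
    by (rule norm_cauchy_schwarz)
  also have "\<dots> \<le> norm (Y - X) * (K * norm (Y - X))"
  proof (intro mult_left_mono)
    have "0 \<le> K * norm (Y - X)" using lip[of Y] norm_ge_zero order_trans by blast
    then have "t * (K * norm (Y - X)) \<le> 1 * (K * norm (Y - X))" using t by (intro mult_right_mono) auto
    then show "norm (grad f ?Z - grad f X) \<le> K * norm (Y - X)"
      using lip[of ?Z] t by (simp add: mult_ac)
  qed simp
  finally show ?thesis using t(3) by (simp add: inner_diff_right inner_commute power2_eq_square algebra_simps)
qed

section \<open>From layer-wise smoothness to Euclidean gradient bounds\<close>

lemma layer_L0_L1_smooth_imp_norm:
  fixes S :: "('l::finite, 'e::finite) shape"
  assumes S: "valid_shape S" and sm: "layer_L0_L1_smooth S g L0 L1"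
  obtains A B where "0 \<le> A" "0 \<le> B"
    "\<And>X Y. norm (grad g X - grad g Y) \<le> (A + B * norm (grad g X)) * norm (X - Y)"
proof -
  have L: "0 \<le> L0 i" "0 \<le> L1 i" for i using sm by (auto simp: layer_L0_L1_smooth_def)
  have bound: "norm (grad g X - grad g Y)
      \<le> ((\<Sum>i\<in>UNIV. L0 i) + (\<Sum>i\<in>UNIV. L1 i * real CARD('e)) * norm (grad g X)) * norm (X - Y)" for X Y
  proof -
    have "norm (grad g X - grad g Y) \<le> (\<Sum>i\<in>UNIV. nuclear_norm (block S (grad g X - grad g Y) i))"
      by (rule norm_le_sum_nuclear_norm[OF S])
    also have "\<dots> \<le> (\<Sum>i\<in>UNIV. (L0 i + L1 i * real CARD('e) * norm (grad g X)) * norm (X - Y))"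
    proof (intro sum_mono)
      fix i
      have "nuclear_norm (block S (grad g X - grad g Y) i)
          \<le> (L0 i + L1 i * nuclear_norm (block S (grad g X) i)) * spectral_norm (block S (X - Y) i)"
        using sm unfolding layer_L0_L1_smooth_def block_diff by blast
      also have "\<dots> \<le> (L0 i + L1 i * (real CARD('e) * norm (grad g X))) * norm (X - Y)"
        using L[of i] nuclear_norm_block_le[OF S, of "grad g X" i]
        by (intro mult_mono add_left_mono mult_left_mono spectral_norm_block_le[OF S])
          (auto simp: nuclear_norm_nonneg spectral_norm_nonneg intro!: add_nonneg_nonneg)
      finally show "nuclear_norm (block S (grad g X - grad g Y) i)
          \<le> (L0 i + L1 i * real CARD('e) * norm (grad g X)) * norm (X - Y)" by (simp add: mult.assoc)
    qed
    finally show ?thesis by (simp add: sum.distrib flip: sum_distrib_right)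
  qed
  show thesis
    by (rule that[OF _ _ bound]) (auto intro!: sum_nonneg mult_nonneg_nonneg L)
qed

lemma layer_smooth_imp_lipschitz:
  fixes S :: "('l::finite, 'e::finite) shape"
  assumes S: "valid_shape S" and sm: "layer_smooth S g L"
  obtains A where "0 \<le> A" "\<And>X Y. norm (grad g X - grad g Y) \<le> A * norm (X - Y)"
proof -
  have bound: "norm (grad g X - grad g Y) \<le> (\<Sum>i\<in>UNIV. \<bar>L i\<bar>) * norm (X - Y)" for X Y
  proof -
    have "norm (grad g X - grad g Y) \<le> (\<Sum>i\<in>UNIV. nuclear_norm (block S (grad g X - grad g Y) i))"
      by (rule norm_le_sum_nuclear_norm[OF S])
    also have "\<dots> \<le> (\<Sum>i\<in>UNIV. \<bar>L i\<bar> * norm (X - Y))"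
    proof (intro sum_mono)
      fix i
      have "nuclear_norm (block S (grad g X - grad g Y) i) \<le> L i * spectral_norm (block S (X - Y) i)"
        using sm unfolding layer_smooth_def block_diff by blast
      also have "\<dots> \<le> \<bar>L i\<bar> * norm (X - Y)"
        by (intro mult_mono spectral_norm_block_le[OF S]) (auto simp: spectral_norm_nonneg)
      finally show "nuclear_norm (block S (grad g X - grad g Y) i) \<le> \<bar>L i\<bar> * norm (X - Y)" .
    qed
    finally show ?thesis by (simp flip: sum_distrib_right)
  qed
  show thesis
    by (rule that[OF _ bound]) (auto intro!: sum_nonneg)
qed

text \<open>A step along the negative gradient cannot fall below \<open>gstar\<close>, and it gains
  an amount proportional to the gradient norm. The bound is linear in the gap, not a square root as
  for a Lipschitz gradient, because the admissible step length is limited by \<open>B\<close>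
  however large the gradient is.\<close>

lemma norm_grad_le_of_bounded_below:
  fixes g :: "real ^ 'e::finite \<Rightarrow> real"
  assumes diff: "\<And>X. g differentiable (at X)" and below: "\<And>X. gstar \<le> g X"
    and AB: "0 \<le> A" "0 \<le> B"
    and smooth: "\<And>X Y. norm (grad g X - grad g Y) \<le> (A + B * norm (grad g X)) * norm (X - Y)"
  shows "norm (grad g X) \<le> 4 * (B + 1) * (g X - gstar) + A"
proof (cases "grad g X = 0")
  case True
  then show ?thesis using below[of X] AB by simp
next
  case False
  define n where "n = norm (grad g X)"
  have n: "n > 0" using False by (simp add: n_def)
  define s where "s = 1 / (2 * (B + 1))"
  have s: "s > 0" using AB by (simp add: s_def)
  \<comment> \<open>a step of fixed length, short enough for the second-order term to cost at most half the descent\<close>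
  define Y where "Y = X - (s / n) *\<^sub>R grad g X"
  have "g Y \<le> g X + inner (grad g X) (Y - X) + (A + B * n) * (norm (Y - X))\<^sup>2"
    by (rule descent_inequality[OF diff]) (use smooth[of X] in \<open>simp add: n_def norm_minus_commute\<close>)
  moreover have "inner (grad g X) (Y - X) = - s * n"
    using n by (simp add: Y_def n_def power2_norm_eq_inner[symmetric] power2_eq_square)
  moreover have "norm (Y - X) = s" using n s by (simp add: Y_def n_def[symmetric])
  ultimately have "gstar \<le> g X - s * n + (A + B * n) * s\<^sup>2" using below[of Y] by simp
  moreover have "B * n * s\<^sup>2 \<le> s * n / 2"
  proof -
    have "B * s \<le> 1 / 2" using AB by (simp add: s_def field_simps)
    then have "(B * s) * (n * s) \<le> 1 / 2 * (n * s)" using n s by (intro mult_right_mono) auto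
    then show ?thesis by (simp add: power2_eq_square mult_ac)
  qed
  ultimately have "s * n / 2 \<le> (g X - gstar) + A * s\<^sup>2" by (simp add: algebra_simps)
  then have "n \<le> (2 / s) * ((g X - gstar) + A * s\<^sup>2)" using s by (simp add: field_simps)
  also have "\<dots> = (2 / s) * (g X - gstar) + 2 * s * A"
    using s by (simp add: power2_eq_square field_simps)
  also have "2 / s = 4 * (B + 1)" by (simp add: s_def)
  also have "2 * s * A \<le> 1 * A" using AB by (intro mult_right_mono) (auto simp: s_def field_simps)
  finally show ?thesis by (simp add: n_def)
qed

section \<open>Measurability and independence of the past\<close>

lemma borel_measurable_vec_nth:
  fixes X :: "'a \<Rightarrow> real ^ 'e::finite"
  assumes "X \<in> borel_measurable M"
  shows "(\<lambda>\<omega>. X \<omega> $ e) \<in> borel_measurable M"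
proof -
  have "(\<lambda>\<omega>. inner (X \<omega>) (axis e 1)) \<in> borel_measurable M" using assms by measurable
  then show ?thesis by (simp add: inner_axis)
qed

lemma borel_measurable_vecI:
  fixes X :: "'a \<Rightarrow> real ^ 'e::finite"
  assumes "\<And>e. (\<lambda>\<omega>. X \<omega> $ e) \<in> borel_measurable M"
  shows "X \<in> borel_measurable M"
  unfolding borel_measurable_euclidean_space[of X]
  using assms by (auto simp: Basis_vec_def inner_axis)

lemma measurable_mat_block:
  assumes "X \<in> borel_measurable M"
  shows "measurable_mat M (rows S i) (cols S i) (\<lambda>\<omega>. block S (X \<omega>) i)"
  unfolding measurable_mat_def
proof (intro conjI allI impI)
  show "block S (X \<omega>) i \<in> carrier_mat (rows S i) (cols S i)" for \<omega> by (rule block_carrier)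
  fix a b assume "a < rows S i" "b < cols S i"
  then show "(\<lambda>\<omega>. block S (X \<omega>) i $$ (a, b)) \<in> borel_measurable M"
    by (simp add: block_def borel_measurable_vec_nth[OF assms])
qed

lemma borel_measurable_nuclear_norm_block:
  assumes "X \<in> borel_measurable M"
  shows "(\<lambda>\<omega>. nuclear_norm (block S (X \<omega>) i)) \<in> borel_measurable M"
  by (rule measurable_nuclear_norm[OF measurable_mat_block[OF assms]])

lemma borel_measurable_of_blocks:
  assumes S: "valid_shape S"
    and B: "\<And>i. measurable_mat M (rows S i) (cols S i) (\<lambda>\<omega>. B \<omega> i)"
  shows "(\<lambda>\<omega>. of_blocks S (B \<omega>)) \<in> borel_measurable M"
proof (rule borel_measurable_vecI)
  fix e
  obtain a b where "entry S e = (layer S e, a, b)" "a < rows S (layer S e)" "b < cols S (layer S e)"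
    using entry_cases[OF S] by metis
  then show "(\<lambda>\<omega>. of_blocks S (B \<omega>) $ e) \<in> borel_measurable M"
    using measurable_matD(4)[OF B] by (simp add: of_blocks_def)
qed

lemma borel_measurable_compress:
  assumes S: "valid_shape S"
    and R: "\<And>e. (\<lambda>\<omega>. R \<omega> $ e) \<in> borel_measurable M" and Y: "Y \<in> borel_measurable M"
  shows "(\<lambda>\<omega>. compress S (R \<omega>) (Y \<omega>)) \<in> borel_measurable M"
proof (rule borel_measurable_vecI)
  fix e
  note [measurable] = R borel_measurable_vec_nth[OF Y]
  show "(\<lambda>\<omega>. compress S (R \<omega>) (Y \<omega>) $ e) \<in> borel_measurable M"
    unfolding compress_nth[OF S] by measurable
qed

definition measurable_rate :: "('l::finite, 'e::finite) shape \<Rightarrow> ('l \<Rightarrow> real mat \<Rightarrow> real) \<Rightarrow> 'w measure \<Rightarrow> bool" where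
  "measurable_rate S lr M \<longleftrightarrow>
     (\<forall>i. \<forall>X::'w \<Rightarrow> real ^ 'e. X \<in> borel_measurable M \<longrightarrow> (\<lambda>\<omega>. lr i (block S (X \<omega>) i)) \<in> borel_measurable M)"

lemma borel_measurable_muon_direction:
  assumes S: "valid_shape S" and lr: "measurable_rate S lr M" and g: "g \<in> borel_measurable M"
  shows "(\<lambda>\<omega>. muon_direction S lr (g \<omega>)) \<in> borel_measurable M"
  unfolding muon_direction_def
  using lr g by (intro borel_measurable_of_blocks[OF S] measurable_mat_smult measurable_mat_polar
      measurable_mat_block) (auto simp: measurable_rate_def)

text \<open>The right-hand sides mention other components of the new state, so the components can be
  treated one after the other in the order in which a round computes them.\<close>

lemma muon_step_simps:
  "momentum (muon_step S meth G \<mu> lr z u d st) j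
     = \<mu> *\<^sub>R momentum st j + (1 - \<mu>) *\<^sub>R G j (broadcast st) (z j)"
  "client_est (muon_step S meth G \<mu> lr z u d st) j = client_est st j
     + compress S (u j) (momentum (muon_step S meth G \<mu> lr z u d st) j - client_est st j)"
  "server_est (muon_step S meth G \<mu> lr z u d st) = server_est st
     + (1 / real CARD('c)) *\<^sub>R (\<Sum>j\<in>UNIV. client_est (muon_step S meth G \<mu> lr z u d st) j - client_est st j)"
  "valid_shape S \<Longrightarrow> model (muon_step S meth G \<mu> lr z u d st)
     = model st - muon_direction S lr (server_est (muon_step S meth G \<mu> lr z u d st))"
  "broadcast (muon_step S meth G \<mu> lr z u d st) = (case meth of
       EF21_MuonUSign \<Rightarrow> model (muon_step S meth G \<mu> lr z u d st)
     | EF21_MuonSign \<Rightarrow> broadcast st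
         + compress S d (model (muon_step S meth G \<mu> lr z u d st) - broadcast st))"
  for st :: "('c::finite, 'e::finite) state"
  by (simp_all add: muon_step_def Let_def muon_update_eq split: muon.split)

section \<open>The filtration of the rounds and the independence of fresh samples\<close>

definition past :: "('c::finite, 'e::finite, 's, 'w) stochastics \<Rightarrow> nat \<Rightarrow> 'w measure" where
  "past R t = sigma (space (base R)) (\<Union>k\<in>{k. 1 \<le> rnd k \<and> rnd k \<le> t}. source_events R k)"

text \<open>Closure under intersection is what lets independence pass from these events to the
  sigma-algebras they generate.\<close>

lemma Int_stable_source_events: "Int_stable (source_events R k)"
proof -
  have *: "Int_stable {f -` A \<inter> \<Omega> | A. A \<in> sets N}" for f :: "'w \<Rightarrow> 'x" and \<Omega> and N :: "'x measure"
  proof (rule Int_stableI)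
    fix a b assume "a \<in> {f -` A \<inter> \<Omega> | A. A \<in> sets N}" "b \<in> {f -` A \<inter> \<Omega> | A. A \<in> sets N}"
    then obtain A B where "a = f -` A \<inter> \<Omega>" "b = f -` B \<inter> \<Omega>" "A \<in> sets N" "B \<in> sets N" by auto
    then have "a \<inter> b = f -` (A \<inter> B) \<inter> \<Omega> \<and> A \<inter> B \<in> sets N" by auto
    then show "a \<inter> b \<in> {f -` A \<inter> \<Omega> | A. A \<in> sets N}" by blast
  qed
  show ?thesis by (cases k) (simp_all add: *)
qed

locale stochastic_clients =
  fixes S :: "('l::finite, 'e::finite) shape" and \<sigma> :: real
    and fs :: "'c::finite \<Rightarrow> real ^ 'e \<Rightarrow> real" and R :: "('c, 'e, 's, 'w) stochastics"
  assumes shape: "valid_shape S" and C1: "\<And>j. cont_differentiable (fs j)"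
    and adm: "admissible S \<sigma> fs R"
begin

lemma sources: "independent_sources R"
  using adm by (simp add: admissible_def)

sublocale prob_space "base R"
  using sources by (simp add: independent_sources_def)

lemma stoch: "stochastic_gradient S \<sigma> (fs j) (law R j) (stoch_grad R j)"
  using adm by (simp add: admissible_def)

lemma diff: "fs j differentiable (at X)"
  using C1 by (simp add: cont_differentiable_def)

lemma borel_measurable_grad [measurable]: "grad (fs j) \<in> borel_measurable borel"
  using C1 by (intro borel_measurable_continuous_onI) (simp add: cont_differentiable_def)

lemma indep_sources: "indep_sets (source_events R) {k. 1 \<le> rnd k}"
  using sources by (simp add: independent_sources_def)

lemma source_events_events: "1 \<le> rnd k \<Longrightarrow> source_events R k \<subseteq> events"
  using indep_sources by (auto simp: indep_sets_def)

lemma space_past [simp]: "space (past R t) = space (base R)"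
  by (simp add: past_def space_measure_of_conv)

lemma sets_past: "sets (past R t)
    = sigma_sets (space (base R)) (\<Union>k\<in>{k. 1 \<le> rnd k \<and> rnd k \<le> t}. source_events R k)"
  unfolding past_def
proof (rule sets_measure_of)
  have "source_events R k \<subseteq> Pow (space (base R))" if "1 \<le> rnd k" for k
    using source_events_events[OF that] sets.sets_into_space by blast
  then show "(\<Union>k\<in>{k. 1 \<le> rnd k \<and> rnd k \<le> t}. source_events R k) \<subseteq> Pow (space (base R))" by blast
qed

lemma past_mono: "t \<le> t' \<Longrightarrow> sets (past R t) \<subseteq> sets (past R t')"
  unfolding sets_past by (rule sigma_sets_mono') auto

lemma sets_past_subset: "sets (past R t) \<subseteq> events"
  unfolding sets_past using source_events_events by (intro sets.sigma_sets_subset) blast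

lemma measurable_past_mono: "f \<in> measurable (past R t) N \<Longrightarrow> t \<le> t' \<Longrightarrow> f \<in> measurable (past R t') N"
  using past_mono[of t t'] by (rule_tac measurable_mono[THEN subsetD]) auto

lemma measurable_past_base: "f \<in> measurable (past R t) N \<Longrightarrow> f \<in> measurable (base R) N"
  using sets_past_subset[of t] by (rule_tac measurable_mono[THEN subsetD]) auto

lemma source_events_past: "1 \<le> rnd k \<Longrightarrow> rnd k \<le> t \<Longrightarrow> A \<in> source_events R k \<Longrightarrow> A \<in> sets (past R t)"
  unfolding sets_past by blast

lemma sample_measurable: "sample R (Suc t) j \<in> measurable (base R) (law R j)"
  and distr_sample: "distr (base R) (law R j) (sample R (Suc t) j) = law R j"
  using sources by (auto simp: independent_sources_def)

lemma up_sign_values: "\<omega> \<in> space (base R) \<Longrightarrow> up_sign R (Suc t) j \<omega> $ e \<in> {-1, 1}"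
  and down_sign_values: "\<omega> \<in> space (base R) \<Longrightarrow> down_sign R (Suc t) \<omega> $ e \<in> {-1, 1}"
  using sources by (auto simp: independent_sources_def)

lemma sample_past: "sample R (Suc t) j \<in> measurable (past R (Suc t)) (law R j)"
proof (rule measurableI)
  fix \<omega> assume "\<omega> \<in> space (past R (Suc t))"
  then show "sample R (Suc t) j \<omega> \<in> space (law R j)"
    using measurable_space[OF sample_measurable] by simp
next
  fix A assume "A \<in> sets (law R j)"
  then have "sample R (Suc t) j -` A \<inter> space (base R) \<in> source_events R (Sample (Suc t) j)" by auto
  then show "sample R (Suc t) j -` A \<inter> space (past R (Suc t)) \<in> sets (past R (Suc t))"
    using source_events_past[of "Sample (Suc t) j" "Suc t"] by simp
qed

lemma up_sign_past: "(\<lambda>\<omega>. up_sign R (Suc t) j \<omega> $ e) \<in> borel_measurable (past R (Suc t))"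
proof (rule measurableI)
  fix A :: "real set" assume "A \<in> sets borel"
  then have "(\<lambda>\<omega>. up_sign R (Suc t) j \<omega> $ e) -` A \<inter> space (base R) \<in> source_events R (Up_Sign (Suc t) j e)"
    by auto
  then show "(\<lambda>\<omega>. up_sign R (Suc t) j \<omega> $ e) -` A \<inter> space (past R (Suc t)) \<in> sets (past R (Suc t))"
    using source_events_past[of "Up_Sign (Suc t) j e" "Suc t"] by simp
qed simp

lemma down_sign_past: "(\<lambda>\<omega>. down_sign R (Suc t) \<omega> $ e) \<in> borel_measurable (past R (Suc t))"
proof (rule measurableI)
  fix A :: "real set" assume "A \<in> sets borel"
  then have "(\<lambda>\<omega>. down_sign R (Suc t) \<omega> $ e) -` A \<inter> space (base R) \<in> source_events R (Down_Sign (Suc t) e)"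
    by auto
  then show "(\<lambda>\<omega>. down_sign R (Suc t) \<omega> $ e) -` A \<inter> space (past R (Suc t)) \<in> sets (past R (Suc t))"
    using source_events_past[of "Down_Sign (Suc t) e" "Suc t"] by simp
qed simp

text \<open>The sources are grouped into two disjoint blocks, all those of the first
  \<open>t\<close> rounds and the single sample \<open>Sample (Suc t) j\<close>; the sigma-algebras
  generated by disjoint blocks are independent.\<close>

lemma prob_past_Int_sample:
  assumes A: "A \<in> sets (past R t)" and B: "B \<in> sets (law R j)"
  shows "prob (A \<inter> (sample R (Suc t) j -` B \<inter> space (base R)))
    = prob A * prob (sample R (Suc t) j -` B \<inter> space (base R))"
proof -
  define I where "I = case_bool {k. 1 \<le> rnd k \<and> rnd k \<le> t} {Sample (Suc t) j :: ('c, 'e) source}"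
  have "indep_sets (\<lambda>b. sigma_sets (space (base R)) (\<Union>i\<in>I b. source_events R i)) UNIV"
  proof (rule indep_sets_collect_sigma)
    show "indep_sets (source_events R) (\<Union>b\<in>UNIV. I b)"
      by (rule indep_sets_mono_index[OF _ indep_sources]) (auto simp: I_def split: bool.splits)
    show "disjoint_family_on I UNIV"
      by (auto simp: disjoint_family_on_def I_def split: bool.splits)
  qed (rule Int_stable_source_events)
  moreover have "sample R (Suc t) j -` B \<inter> space (base R)
      \<in> sigma_sets (space (base R)) (source_events R (Sample (Suc t) j))"
    using B by (intro sigma_sets.Basic) auto
  ultimately have "prob (\<Inter>b\<in>UNIV. case_bool A (sample R (Suc t) j -` B \<inter> space (base R)) b)
      = (\<Prod>b\<in>UNIV. prob (case_bool A (sample R (Suc t) j -` B \<inter> space (base R)) b))"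
    using A by (intro indep_setsD) (auto simp: I_def sets_past split: bool.splits)
  then show ?thesis by (simp add: UNIV_bool mult.commute Int_commute)
qed

text \<open>Independence gives the product formula on rectangles, and these determine the joint law.
  The product form opens the way to Fubini's theorem.\<close>

lemma distr_past_sample:
  fixes Y :: "'w \<Rightarrow> 'b::second_countable_topology"
  assumes Y: "Y \<in> borel_measurable (past R t)"
  shows "distr (base R) borel Y \<Otimes>\<^sub>M law R j
    = distr (base R) (borel \<Otimes>\<^sub>M law R j) (\<lambda>\<omega>. (Y \<omega>, sample R (Suc t) j \<omega>))"
proof (rule pair_measure_eqI)
  have Y': "Y \<in> borel_measurable (base R)" using Y by (rule measurable_past_base)
  have YZ: "(\<lambda>\<omega>. (Y \<omega>, sample R (Suc t) j \<omega>)) \<in> measurable (base R) (borel \<Otimes>\<^sub>M law R j)"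
    using Y' sample_measurable by (rule measurable_Pair)
  interpret D: prob_space "law R j" using stoch by (simp add: stochastic_gradient_def)
  interpret Q: prob_space "distr (base R) borel Y" using Y' by (rule prob_space_distr)
  show "sigma_finite_measure (law R j)" "sigma_finite_measure (distr (base R) borel Y)"
    by unfold_locales
  show "sets (distr (base R) borel Y \<Otimes>\<^sub>M law R j)
      = sets (distr (base R) (borel \<Otimes>\<^sub>M law R j) (\<lambda>\<omega>. (Y \<omega>, sample R (Suc t) j \<omega>)))"
    by (simp cong: sets_pair_measure_cong)
  fix A B assume A: "A \<in> sets (distr (base R) borel Y)" and B: "B \<in> sets (law R j)"
  have pA: "Y -` A \<inter> space (base R) \<in> sets (past R t)"
    using measurable_sets[OF Y, of A] A by simp
  have "emeasure (law R j) B = emeasure (base R) (sample R (Suc t) j -` B \<inter> space (base R))"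
    using B sample_measurable by (subst distr_sample[of j t, symmetric]) (rule emeasure_distr)
  moreover have "emeasure (distr (base R) borel Y) A = emeasure (base R) (Y -` A \<inter> space (base R))"
    using A Y' by (intro emeasure_distr) auto
  moreover have "emeasure (distr (base R) (borel \<Otimes>\<^sub>M law R j) (\<lambda>\<omega>. (Y \<omega>, sample R (Suc t) j \<omega>))) (A \<times> B)
      = emeasure (base R) ((\<lambda>\<omega>. (Y \<omega>, sample R (Suc t) j \<omega>)) -` (A \<times> B) \<inter> space (base R))"
    using A B YZ by (intro emeasure_distr) auto
  moreover have "(\<lambda>\<omega>. (Y \<omega>, sample R (Suc t) j \<omega>)) -` (A \<times> B) \<inter> space (base R)
      = (Y -` A \<inter> space (base R)) \<inter> (sample R (Suc t) j -` B \<inter> space (base R))" by auto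
  ultimately show "emeasure (distr (base R) borel Y) A * emeasure (law R j) B
      = emeasure (distr (base R) (borel \<Otimes>\<^sub>M law R j) (\<lambda>\<omega>. (Y \<omega>, sample R (Suc t) j \<omega>))) (A \<times> B)"
    using prob_past_Int_sample[OF pA B]
    by (simp add: emeasure_eq_measure ennreal_mult)
qed

text \<open>The freezing lemma: conditioning on the past means integrating over the fresh sample
  while the past variable is held fixed.\<close>

lemma nn_integral_past_sample:
  fixes Y :: "'w \<Rightarrow> 'b::second_countable_topology"
  assumes Y: "Y \<in> borel_measurable (past R t)"
    and h: "(\<lambda>(y, z). h y z) \<in> borel_measurable (borel \<Otimes>\<^sub>M law R j)"
  shows "(\<integral>\<^sup>+ \<omega>. h (Y \<omega>) (sample R (Suc t) j \<omega>) \<partial>base R)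
    = (\<integral>\<^sup>+ \<omega>. (\<integral>\<^sup>+ z. h (Y \<omega>) z \<partial>law R j) \<partial>base R)"
proof -
  have Y': "Y \<in> borel_measurable (base R)" using Y by (rule measurable_past_base)
  have YZ: "(\<lambda>\<omega>. (Y \<omega>, sample R (Suc t) j \<omega>)) \<in> measurable (base R) (borel \<Otimes>\<^sub>M law R j)"
    using Y' sample_measurable by (rule measurable_Pair)
  interpret D: prob_space "law R j" using stoch by (simp add: stochastic_gradient_def)
  have h': "(\<lambda>(y, z). h y z) \<in> borel_measurable (distr (base R) borel Y \<Otimes>\<^sub>M law R j)"
    using h by (simp cong: measurable_cong_sets sets_pair_measure_cong)
  have "(\<integral>\<^sup>+ \<omega>. h (Y \<omega>) (sample R (Suc t) j \<omega>) \<partial>base R)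
      = (\<integral>\<^sup>+ p. (case p of (y, z) \<Rightarrow> h y z) \<partial>distr (base R) (borel \<Otimes>\<^sub>M law R j) (\<lambda>\<omega>. (Y \<omega>, sample R (Suc t) j \<omega>)))"
    using h by (subst nn_integral_distr[OF YZ]) auto
  also have "\<dots> = (\<integral>\<^sup>+ p. (case p of (y, z) \<Rightarrow> h y z) \<partial>(distr (base R) borel Y \<Otimes>\<^sub>M law R j))"
    by (simp add: distr_past_sample[OF Y])
  also have "\<dots> = (\<integral>\<^sup>+ y. (\<integral>\<^sup>+ z. h y z \<partial>law R j) \<partial>distr (base R) borel Y)"
    using D.nn_integral_fst[OF h'] by simp
  also have "\<dots> = (\<integral>\<^sup>+ \<omega>. (\<integral>\<^sup>+ z. h (Y \<omega>) z \<partial>law R j) \<partial>base R)"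
    using D.borel_measurable_nn_integral[OF h] by (intro nn_integral_distr[OF Y']) simp
  finally show ?thesis .
qed

lemma nn_integral_noise_sq: "(\<integral>\<^sup>+ z. ennreal ((norm (stoch_grad R j X z - grad (fs j) X))\<^sup>2) \<partial>law R j) \<le> ennreal (\<sigma>\<^sup>2)"
proof -
  have "(\<integral>\<^sup>+ z. ennreal ((norm (stoch_grad R j X z - grad (fs j) X))\<^sup>2) \<partial>law R j)
      \<le> (\<integral>\<^sup>+ z. ennreal (nuclear_norm_sq S (stoch_grad R j X z - grad (fs j) X)) \<partial>law R j)"
    by (intro nn_integral_mono ennreal_leI norm_sq_le_nuclear_norm_sq[OF shape])
  also have "\<dots> \<le> ennreal (\<sigma>\<^sup>2)" using stoch by (simp add: stochastic_gradient_def)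
  finally show ?thesis .
qed

text \<open>The cross term integrates to zero because the noise is centred.\<close>

lemma nn_integral_shifted_noise_sq:
  "(\<integral>\<^sup>+ z. ennreal ((norm (v + \<beta> *\<^sub>R (stoch_grad R j X z - grad (fs j) X)))\<^sup>2) \<partial>law R j)
     \<le> ennreal ((norm v)\<^sup>2 + \<beta>\<^sup>2 * \<sigma>\<^sup>2)"
proof -
  interpret D: prob_space "law R j" using stoch by (simp add: stochastic_gradient_def)
  define n where "n z = stoch_grad R j X z - grad (fs j) X" for z
  have G: "has_bochner_integral (law R j) (stoch_grad R j X) (grad (fs j) X)"
    using stoch by (simp add: stochastic_gradient_def)
  have "has_bochner_integral (law R j) (\<lambda>z. grad (fs j) X) (grad (fs j) X)"
    using D.prob_space by (simp add: has_bochner_integral_iff)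
  then have n: "has_bochner_integral (law R j) n 0"
    using has_bochner_integral_diff[OF G] unfolding n_def[abs_def] by fastforce
  then have n_int: "integrable (law R j) n" and n0: "(\<integral>z. n z \<partial>law R j) = 0"
    by (auto simp: has_bochner_integral_iff)
  have [measurable]: "n \<in> borel_measurable (law R j)" using n_int by auto
  have fin: "(\<integral>\<^sup>+ z. ennreal ((norm (n z))\<^sup>2) \<partial>law R j) \<le> ennreal (\<sigma>\<^sup>2)"
    unfolding n_def by (rule nn_integral_noise_sq)
  \<comment> \<open>The variance bound makes the square integrable, so the expansion below may be
    integrated term by term.\<close>
  then have sq_int: "integrable (law R j) (\<lambda>z. (norm (n z))\<^sup>2)"
    by (intro integrableI_nonneg) (auto intro: le_less_trans)
  have "ennreal (\<integral>z. (norm (n z))\<^sup>2 \<partial>law R j) \<le> ennreal (\<sigma>\<^sup>2)"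
    using fin by (subst nn_integral_eq_integral[symmetric, OF sq_int]) auto
  then have sq_le: "(\<integral>z. (norm (n z))\<^sup>2 \<partial>law R j) \<le> \<sigma>\<^sup>2" by (subst (asm) ennreal_le_iff) auto
  have expand: "(norm (v + \<beta> *\<^sub>R n z))\<^sup>2 = (norm v)\<^sup>2 + 2 * \<beta> * inner v (n z) + \<beta>\<^sup>2 * (norm (n z))\<^sup>2" for z
    unfolding power2_norm_eq_inner
    by (simp add: inner_add_left inner_add_right inner_commute power2_eq_square algebra_simps)
  have int: "integrable (law R j) (\<lambda>z. (norm v)\<^sup>2 + 2 * \<beta> * inner v (n z) + \<beta>\<^sup>2 * (norm (n z))\<^sup>2)"
    using n_int sq_int by (intro Bochner_Integration.integrable_add integrable_mult_right integrable_inner_right) auto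
  have iv: "integrable (law R j) (\<lambda>z. 2 * \<beta> * inner v (n z))" "integrable (law R j) (\<lambda>z. \<beta>\<^sup>2 * (norm (n z))\<^sup>2)"
    using n_int sq_int by (auto intro!: integrable_mult_right integrable_inner_right)
  have "(\<integral>\<^sup>+ z. ennreal ((norm (v + \<beta> *\<^sub>R n z))\<^sup>2) \<partial>law R j)
      = ennreal (\<integral>z. (norm v)\<^sup>2 + 2 * \<beta> * inner v (n z) + \<beta>\<^sup>2 * (norm (n z))\<^sup>2 \<partial>law R j)"
    using int by (subst nn_integral_eq_integral[symmetric]) (auto simp flip: expand)
  also have "(\<integral>z. (norm v)\<^sup>2 + 2 * \<beta> * inner v (n z) + \<beta>\<^sup>2 * (norm (n z))\<^sup>2 \<partial>law R j)
      = (norm v)\<^sup>2 + \<beta>\<^sup>2 * (\<integral>z. (norm (n z))\<^sup>2 \<partial>law R j)"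
    using iv n_int n0 D.prob_space by simp
  also have "ennreal \<dots> \<le> ennreal ((norm v)\<^sup>2 + \<beta>\<^sup>2 * \<sigma>\<^sup>2)"
    using sq_le by (intro ennreal_leI add_left_mono mult_left_mono) auto
  finally show ?thesis by (simp add: n_def)
qed

lemma stoch_grad_measurable:
  assumes "f \<in> measurable N (borel :: (real ^ 'e) measure)" "g \<in> measurable N (law R j)"
  shows "(\<lambda>x. stoch_grad R j (f x) (g x)) \<in> borel_measurable N"
proof -
  have "(\<lambda>(X, z). stoch_grad R j X z) \<in> borel_measurable (borel \<Otimes>\<^sub>M law R j)"
    using stoch by (simp add: stochastic_gradient_def)
  from measurable_compose[OF measurable_Pair[OF assms] this] show ?thesis by simp
qed

text \<open>The shift of the index matters: the sample of round \<open>Suc t\<close> is evaluated at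
  the model available after round \<open>t\<close>, which is measurable with respect to
  \<open>past R t\<close>.\<close>

definition noise :: "(nat \<Rightarrow> 'w \<Rightarrow> real ^ 'e) \<Rightarrow> nat \<Rightarrow> 'c \<Rightarrow> 'w \<Rightarrow> real ^ 'e" where
  "noise W t j \<omega> = stoch_grad R j (W t \<omega>) (sample R (Suc t) j \<omega>) - grad (fs j) (W t \<omega>)"

lemma noise_measurable:
  assumes "W t \<in> borel_measurable (past R t)"
  shows "noise W t j \<in> borel_measurable (past R (Suc t))"
proof -
  have W [measurable]: "W t \<in> borel_measurable (past R (Suc t))"
    using assms by (rule measurable_past_mono) simp
  note [measurable] = stoch_grad_measurable[OF W sample_past]
  show ?thesis unfolding noise_def[abs_def] by measurable
qed

lemma expectation_shifted_noise_sq: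
  assumes W: "W t \<in> borel_measurable (past R t)" and v: "v \<in> borel_measurable (past R t)"
  shows "(\<integral>\<^sup>+ \<omega>. ennreal ((norm (v \<omega> + \<beta> *\<^sub>R noise W t j \<omega>))\<^sup>2) \<partial>base R)
    \<le> (\<integral>\<^sup>+ \<omega>. ennreal ((norm (v \<omega>))\<^sup>2) \<partial>base R) + ennreal (\<beta>\<^sup>2 * \<sigma>\<^sup>2)"
proof -
  define h where "h y z = ennreal ((norm (snd y + \<beta> *\<^sub>R (stoch_grad R j (fst y) z - grad (fs j) (fst y))))\<^sup>2)"
    for y :: "(real ^ 'e) \<times> (real ^ 'e)" and z
  \<comment> \<open>Model and shift form one past variable, so a single application of the freezing
    lemma fixes both.\<close>
  have WV: "(\<lambda>\<omega>. (W t \<omega>, v \<omega>)) \<in> borel_measurable (past R t)"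
    using W v by (rule borel_measurable_Pair)
  have [measurable]: "(\<lambda>p. stoch_grad R j (fst (fst p)) (snd p))
      \<in> borel_measurable ((borel :: ((real ^ 'e) \<times> (real ^ 'e)) measure) \<Otimes>\<^sub>M law R j)"
    by (rule stoch_grad_measurable) (auto simp: borel_prod[symmetric])
  have [measurable]: "(\<lambda>p. fst (fst p)) \<in> measurable ((borel :: ((real ^ 'e) \<times> (real ^ 'e)) measure) \<Otimes>\<^sub>M law R j) borel"
     "(\<lambda>p. snd (fst p)) \<in> measurable ((borel :: ((real ^ 'e) \<times> (real ^ 'e)) measure) \<Otimes>\<^sub>M law R j) borel"
    by (auto simp: borel_prod[symmetric])
  have h: "(\<lambda>(y, z). h y z) \<in> borel_measurable (borel \<Otimes>\<^sub>M law R j)"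
    unfolding h_def case_prod_beta by measurable
  have "(\<integral>\<^sup>+ \<omega>. ennreal ((norm (v \<omega> + \<beta> *\<^sub>R noise W t j \<omega>))\<^sup>2) \<partial>base R)
      = (\<integral>\<^sup>+ \<omega>. h (W t \<omega>, v \<omega>) (sample R (Suc t) j \<omega>) \<partial>base R)"
    by (simp add: h_def noise_def)
  also have "\<dots> = (\<integral>\<^sup>+ \<omega>. (\<integral>\<^sup>+ z. h (W t \<omega>, v \<omega>) z \<partial>law R j) \<partial>base R)"
    by (rule nn_integral_past_sample[OF WV h])
  also have "\<dots> \<le> (\<integral>\<^sup>+ \<omega>. ennreal ((norm (v \<omega>))\<^sup>2) + ennreal (\<beta>\<^sup>2 * \<sigma>\<^sup>2) \<partial>base R)"
    using nn_integral_shifted_noise_sq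
    by (intro nn_integral_mono) (simp add: h_def flip: ennreal_plus)
  also have "\<dots> = (\<integral>\<^sup>+ \<omega>. ennreal ((norm (v \<omega>))\<^sup>2) \<partial>base R) + ennreal (\<beta>\<^sup>2 * \<sigma>\<^sup>2)"
    using measurable_past_base[OF v] by (subst nn_integral_add) (auto simp: emeasure_space_1)
  finally show ?thesis .
qed

lemma expectation_noise_sq:
  assumes W: "W t \<in> borel_measurable (past R t)"
  shows "(\<integral>\<^sup>+ \<omega>. ennreal ((norm (noise W t j \<omega>))\<^sup>2) \<partial>base R) \<le> ennreal (\<sigma>\<^sup>2)"
  using expectation_shifted_noise_sq[where v = "\<lambda>_. 0" and \<beta> = 1, of W t j] W by simp

definition state_measurable :: "'w measure \<Rightarrow> ('w \<Rightarrow> ('c, 'e) state) \<Rightarrow> bool" where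
  "state_measurable M st \<longleftrightarrow> (\<lambda>\<omega>. model (st \<omega>)) \<in> borel_measurable M
     \<and> (\<lambda>\<omega>. broadcast (st \<omega>)) \<in> borel_measurable M
     \<and> (\<lambda>\<omega>. server_est (st \<omega>)) \<in> borel_measurable M
     \<and> (\<forall>j. (\<lambda>\<omega>. momentum (st \<omega>) j) \<in> borel_measurable M)
     \<and> (\<forall>j. (\<lambda>\<omega>. client_est (st \<omega>) j) \<in> borel_measurable M)"

lemma state_measurableD:
  assumes "state_measurable M st"
  shows "(\<lambda>\<omega>. model (st \<omega>)) \<in> borel_measurable M" "(\<lambda>\<omega>. broadcast (st \<omega>)) \<in> borel_measurable M"
    "(\<lambda>\<omega>. server_est (st \<omega>)) \<in> borel_measurable M" "(\<lambda>\<omega>. momentum (st \<omega>) j) \<in> borel_measurable M"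
    "(\<lambda>\<omega>. client_est (st \<omega>) j) \<in> borel_measurable M"
  using assms by (auto simp: state_measurable_def)

text \<open>The state process is adapted to the filtration, which makes the freezing lemma
  applicable in every round.\<close>

lemma muon_state_measurable:
  assumes lr: "\<And>M :: 'w measure. measurable_rate S lr M"
  shows "state_measurable (past R t) (muon_state S meth X0 \<mu> lr R t)"
proof (induction t)
  case 0
  show ?case by (simp add: state_measurable_def)
next
  case (Suc t)
  let ?M = "past R (Suc t)"
  let ?st = "muon_state S meth X0 \<mu> lr R t" and ?st' = "muon_state S meth X0 \<mu> lr R (Suc t)"
  have st: "state_measurable ?M ?st"
    using Suc unfolding state_measurable_def by (auto intro: measurable_past_mono)
  note [measurable] = state_measurableD[OF st]
  have G [measurable]: "(\<lambda>\<omega>. stoch_grad R j (broadcast (?st \<omega>)) (sample R (Suc t) j \<omega>)) \<in> borel_measurable ?M" for j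
    by (rule stoch_grad_measurable[OF state_measurableD(2)[OF st] sample_past])
  have m [measurable]: "(\<lambda>\<omega>. momentum (?st' \<omega>) j) \<in> borel_measurable ?M" for j
    by (simp add: muon_step_simps(1))
  have c [measurable]: "(\<lambda>\<omega>. client_est (?st' \<omega>) j) \<in> borel_measurable ?M" for j
  proof -
    have "(\<lambda>\<omega>. compress S (up_sign R (Suc t) j \<omega>) (momentum (?st' \<omega>) j - client_est (?st \<omega>) j)) \<in> borel_measurable ?M"
      by (rule borel_measurable_compress[OF shape up_sign_past]) measurable
    then have "(\<lambda>\<omega>. client_est (?st \<omega>) j
        + compress S (up_sign R (Suc t) j \<omega>) (momentum (?st' \<omega>) j - client_est (?st \<omega>) j)) \<in> borel_measurable ?M"
      by measurable
    then show ?thesis by (simp add: muon_step_simps(2))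
  qed
  have s [measurable]: "(\<lambda>\<omega>. server_est (?st' \<omega>)) \<in> borel_measurable ?M"
  proof -
    have "(\<lambda>\<omega>. server_est (?st \<omega>) + (1 / real CARD('c)) *\<^sub>R
        (\<Sum>j\<in>UNIV. client_est (?st' \<omega>) j - client_est (?st \<omega>) j)) \<in> borel_measurable ?M"
      by measurable
    then show ?thesis by (simp add: muon_step_simps(3)[symmetric])
  qed
  have x [measurable]: "(\<lambda>\<omega>. model (?st' \<omega>)) \<in> borel_measurable ?M"
  proof -
    note [measurable] = borel_measurable_muon_direction[OF shape lr s]
    have "(\<lambda>\<omega>. model (?st \<omega>) - muon_direction S lr (server_est (?st' \<omega>))) \<in> borel_measurable ?M"
      by measurable
    then show ?thesis by (simp add: muon_step_simps(4)[OF shape])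
  qed
  have "(\<lambda>\<omega>. broadcast (?st' \<omega>)) \<in> borel_measurable ?M"
  proof (cases meth)
    case EF21_MuonUSign
    with x show ?thesis by (simp add: muon_step_simps(5))
  next
    case EF21_MuonSign
    have "(\<lambda>\<omega>. compress S (down_sign R (Suc t) \<omega>) (model (?st' \<omega>) - broadcast (?st \<omega>))) \<in> borel_measurable ?M"
      by (rule borel_measurable_compress[OF shape down_sign_past]) measurable
    then have "(\<lambda>\<omega>. broadcast (?st \<omega>)
        + compress S (down_sign R (Suc t) \<omega>) (model (?st' \<omega>) - broadcast (?st \<omega>))) \<in> borel_measurable ?M"
      by measurable
    with EF21_MuonSign show ?thesis by (simp add: muon_step_simps(5))
  qed
  with m c s x show ?case unfolding state_measurable_def by blast
qed

end

section \<open>Error recursions of one round\<close>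

abbreviation norm_sum :: "('c::finite \<Rightarrow> 'a::real_normed_vector) \<Rightarrow> real" where
  "norm_sum x \<equiv> \<Sum>j\<in>UNIV. norm (x j)"

abbreviation sq_sum :: "('c::finite \<Rightarrow> 'a::real_normed_vector) \<Rightarrow> real" where
  "sq_sum x \<equiv> \<Sum>j\<in>UNIV. (norm (x j))\<^sup>2"

text \<open>Young's inequality; \<epsilon> trades the inflation of the first square against the
  weight of the second.\<close>

lemma norm_add_sq_le:
  fixes x y :: "'a::real_inner"
  assumes "0 < \<epsilon>"
  shows "(norm (x + y))\<^sup>2 \<le> (1 + \<epsilon>) * (norm x)\<^sup>2 + (1 + 1 / \<epsilon>) * (norm y)\<^sup>2"
proof -
  have "(norm (x + y))\<^sup>2 \<le> (norm x + norm y)\<^sup>2" by (intro power_mono norm_triangle_ineq) simp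
  also have "\<dots> = (norm x)\<^sup>2 + 2 * norm x * norm y + (norm y)\<^sup>2" by (simp add: power2_sum)
  also have "2 * norm x * norm y \<le> \<epsilon> * (norm x)\<^sup>2 + (1 / \<epsilon>) * (norm y)\<^sup>2"
  proof -
    have "0 \<le> (\<epsilon> * norm x - norm y)\<^sup>2 / \<epsilon>" using assms by simp
    also have "\<dots> = \<epsilon> * (norm x)\<^sup>2 - 2 * norm x * norm y + (1 / \<epsilon>) * (norm y)\<^sup>2"
      using assms by (simp add: power2_eq_square field_simps)
    finally show ?thesis by simp
  qed
  finally show ?thesis by (simp add: algebra_simps)
qed

lemma norm_add_sq_le2: "(norm (x + y))\<^sup>2 \<le> 2 * (norm x)\<^sup>2 + 2 * (norm y)\<^sup>2" for x y :: "'a::real_inner"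
  using norm_add_sq_le[of 1 x y] by simp

lemma norm_mean_le:
  fixes x :: "'c::finite \<Rightarrow> 'a::real_normed_vector"
  shows "norm ((1 / real CARD('c)) *\<^sub>R (\<Sum>j\<in>UNIV. x j)) \<le> norm_sum x"
proof -
  have "norm ((1 / real CARD('c)) *\<^sub>R (\<Sum>j\<in>UNIV. x j)) \<le> (1 / real CARD('c)) * norm_sum x"
    by (simp add: divide_right_mono norm_sum)
  also have "\<dots> \<le> 1 * norm_sum x"
    by (intro mult_right_mono sum_nonneg) (auto simp: Suc_leI)
  finally show ?thesis by simp
qed

lemma norm_mean_sq_le:
  fixes x :: "'c::finite \<Rightarrow> 'a::real_normed_vector"
  shows "(norm ((1 / real CARD('c)) *\<^sub>R (\<Sum>j\<in>UNIV. x j)))\<^sup>2 \<le> sq_sum x"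
proof -
  let ?N = "real CARD('c)"
  have N: "?N \<ge> 1" by (simp add: Suc_leI)
  have "norm ((1 / ?N) *\<^sub>R (\<Sum>j\<in>UNIV. x j)) \<le> norm_sum x / ?N"
    by (simp add: divide_right_mono norm_sum)
  then have "(norm ((1 / ?N) *\<^sub>R (\<Sum>j\<in>UNIV. x j)))\<^sup>2 \<le> (norm_sum x / ?N)\<^sup>2"
    by (intro power_mono) auto
  also have "\<dots> = (\<Sum>j\<in>UNIV. norm (x j) * 1)\<^sup>2 / ?N\<^sup>2" by (simp add: power_divide)
  also have "\<dots> \<le> (sq_sum x * (\<Sum>j\<in>(UNIV::'c set). 1\<^sup>2)) / ?N\<^sup>2"
    by (intro divide_right_mono Cauchy_Schwarz_ineq_sum) simp
  also have "\<dots> = sq_sum x / ?N" by (simp add: power2_eq_square)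
  also have "\<dots> \<le> sq_sum x / 1"
    using N by (intro divide_left_mono sum_nonneg) auto
  finally show ?thesis by simp
qed

definition mom_err :: "('c \<Rightarrow> real ^ 'e::finite \<Rightarrow> real) \<Rightarrow> ('c, 'e) state \<Rightarrow> 'c \<Rightarrow> real ^ 'e" where
  "mom_err fs st j = momentum st j - grad (fs j) (broadcast st)"

definition est_err :: "('c, 'e::finite) state \<Rightarrow> 'c \<Rightarrow> real ^ 'e" where
  "est_err st j = client_est st j - momentum st j"

definition lag :: "('c, 'e::finite) state \<Rightarrow> real ^ 'e" where
  "lag st = broadcast st - model st"

text \<open>An invariant of the rounds: server and clients add the same compressed increments. It
  lets the error of the server estimate be split into client errors.\<close>

definition consistent :: "('c::finite, 'e::finite) state \<Rightarrow> bool" where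
  "consistent st \<longleftrightarrow> server_est st = (1 / real CARD('c)) *\<^sub>R (\<Sum>j\<in>UNIV. client_est st j)"

section \<open>One round for fixed samples and signs\<close>

locale muon_round =
  fixes S :: "('l::finite, 'e::finite) shape" and meth :: muon
    and fs :: "'c::finite \<Rightarrow> real ^ 'e \<Rightarrow> real"
    and G :: "'c \<Rightarrow> real ^ 'e \<Rightarrow> 's \<Rightarrow> real ^ 'e" and \<mu> :: real
    and lr :: "'l \<Rightarrow> real mat \<Rightarrow> real" and z :: "'c \<Rightarrow> 's" and u :: "'c \<Rightarrow> real ^ 'e"
    and d :: "real ^ 'e" and st :: "('c, 'e) state"
  assumes shape: "valid_shape S" and diff: "\<And>j X. fs j differentiable (at X)"
    and u: "\<And>j e. u j $ e \<in> {-1, 1}" and d: "\<And>e. d $ e \<in> {-1, 1}"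
    and cons: "consistent st"
begin

definition st' where "st' = muon_step S meth G \<mu> lr z u d st"

definition noise_at :: "'c \<Rightarrow> real ^ 'e" where
  "noise_at j = G j (broadcast st) (z j) - grad (fs j) (broadcast st)"

text \<open>The new momentum error measured at the model where the gradients were sampled, before
  that model moves. Old error and centred noise enter it additively, so this is the quantity whose
  square is averaged later.\<close>

definition fresh_err :: "'c \<Rightarrow> real ^ 'e" where
  "fresh_err j = \<mu> *\<^sub>R mom_err fs st j + (1 - \<mu>) *\<^sub>R noise_at j"

definition move :: "real ^ 'e" where
  "move = muon_direction S lr (server_est st')"

lemma momentum_step: "momentum st' j = grad (fs j) (broadcast st) + fresh_err j"
  by (simp add: st'_def muon_step_simps(1) fresh_err_def mom_err_def noise_at_def algebra_simps)

lemma mom_err_step: "mom_err fs st' j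
    = fresh_err j + (grad (fs j) (broadcast st) - grad (fs j) (broadcast st'))"
  by (simp add: mom_err_def momentum_step)

text \<open>The compressor sees the old estimation error together with the change of the momentum,
  \<open>(1 - \<mu>) *\<^sub>R (noise_at j - mom_err fs st j)\<close>; the new error is the
  compression error of this sum.\<close>

lemma est_err_step:
  "est_err st' j = compress S (u j) ((1 - \<mu>) *\<^sub>R (noise_at j - mom_err fs st j) - est_err st j)
     - ((1 - \<mu>) *\<^sub>R (noise_at j - mom_err fs st j) - est_err st j)"
proof -
  define y where "y = (1 - \<mu>) *\<^sub>R (noise_at j - mom_err fs st j) - est_err st j"
  have m: "momentum st' j = client_est st j + y"
    by (simp add: y_def momentum_step est_err_def fresh_err_def mom_err_def algebra_simps)
  have "client_est st' j = client_est st j + compress S (u j) (momentum st' j - client_est st j)"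
    unfolding st'_def by (rule muon_step_simps(2))
  then have "est_err st' j = compress S (u j) y - y" by (simp add: est_err_def m)
  then show ?thesis unfolding y_def .
qed

lemma consistent_step: "consistent st'"
proof -
  have "server_est st' = server_est st
      + (1 / real CARD('c)) *\<^sub>R (\<Sum>j\<in>UNIV. client_est st' j - client_est st j)"
    unfolding st'_def by (rule muon_step_simps(3))
  then show ?thesis using cons by (simp add: consistent_def sum_subtractf algebra_simps)
qed

lemma model_step: "model st' = model st - move"
  unfolding st'_def move_def by (rule muon_step_simps(4)[OF shape])

lemma broadcast_step: "broadcast st' = (case meth of EF21_MuonUSign \<Rightarrow> model st'
    | EF21_MuonSign \<Rightarrow> broadcast st + compress S d (model st' - broadcast st))"
  unfolding st'_def by (rule muon_step_simps(5))

text \<open>The three sources of error: gradients sampled at the broadcast model instead of the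
  iterate, imperfect momentum, and compression. Consistency of server and clients makes the split
  possible.\<close>

lemma grad_minus_server:
  "grad (average fs) (model st) - server_est st'
     = (1 / real CARD('c)) *\<^sub>R (\<Sum>j\<in>UNIV. grad (fs j) (model st) - grad (fs j) (broadcast st))
       - (1 / real CARD('c)) *\<^sub>R (\<Sum>j\<in>UNIV. fresh_err j)
       - (1 / real CARD('c)) *\<^sub>R (\<Sum>j\<in>UNIV. est_err st' j)"
proof -
  have "client_est st' j = grad (fs j) (broadcast st) + fresh_err j + est_err st' j" for j
    by (simp add: est_err_def momentum_step)
  then show ?thesis
    using consistent_step
    by (simp add: consistent_def grad_average[OF diff] sum_subtractf sum.distrib algebra_simps)
qed

text \<open>Half of the contraction constant of the scaled sign; the other half pays for Young's inequality.\<close>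

definition \<delta> :: real where "\<delta> = 1 / (2 * real CARD('e))"

lemma \<delta>: "0 < \<delta>" "\<delta> \<le> 1 / 2" "1 - 1 / real CARD('e) = 1 - 2 * \<delta>"
proof -
  have "1 \<le> real CARD('e)" by (simp add: Suc_leI)
  then show "0 < \<delta>" "\<delta> \<le> 1 / 2" "1 - 1 / real CARD('e) = 1 - 2 * \<delta>"
    by (auto simp: \<delta>_def field_simps)
qed

text \<open>Here \<open>y\<close> is an old error and \<open>x\<close> a new perturbation. Young's
  inequality with parameter \<delta> spends half of the contraction, so that \<open>y\<close> still
  shrinks while \<open>x\<close> is weighted by \<open>1 / \<delta>\<close>.\<close>

lemma compress_sum_error:
  assumes "\<And>e. v $ e \<in> {-1, 1}"
  shows "(norm (compress S v (x + y) - (x + y)))\<^sup>2 \<le> (1 - \<delta>) * (norm y)\<^sup>2 + (1 / \<delta>) * (norm x)\<^sup>2"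
proof -
  have "(norm (compress S v (x + y) - (x + y)))\<^sup>2 \<le> (1 - 2 * \<delta>) * (norm (y + x))\<^sup>2"
    using compress_contraction[OF shape assms] unfolding \<delta>(3) by (simp add: add.commute)
  also have "\<dots> \<le> (1 - 2 * \<delta>) * ((1 + \<delta>) * (norm y)\<^sup>2 + (1 + 1 / \<delta>) * (norm x)\<^sup>2)"
    using \<delta> by (intro mult_left_mono norm_add_sq_le) auto
  also have "\<dots> = ((1 - 2 * \<delta>) * (1 + \<delta>)) * (norm y)\<^sup>2 + ((1 - 2 * \<delta>) * (1 + 1 / \<delta>)) * (norm x)\<^sup>2"
    by (simp only: distrib_left[of "1 - 2 * \<delta>" "(1 + \<delta>) * (norm y)\<^sup>2"] mult.assoc)
  also have "\<dots> \<le> (1 - \<delta>) * (norm y)\<^sup>2 + (1 / \<delta>) * (norm x)\<^sup>2"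
  proof (intro add_mono mult_right_mono)
    have "(1 - 2 * \<delta>) * (1 + \<delta>) = 1 - \<delta> - 2 * (\<delta> * \<delta>)" by (simp add: algebra_simps)
    then show "(1 - 2 * \<delta>) * (1 + \<delta>) \<le> 1 - \<delta>" by simp
    have "(1 - 2 * \<delta>) * (1 + 1 / \<delta>) = 1 / \<delta> - 1 - 2 * \<delta>" using \<delta>(1) by (simp add: field_simps)
    then show "(1 - 2 * \<delta>) * (1 + 1 / \<delta>) \<le> 1 / \<delta>" using \<delta>(1) by simp
  qed auto
  finally show ?thesis .
qed

lemma compress_norm_sq_le:
  assumes "\<And>e. v $ e \<in> {-1, 1}"
  shows "(norm (compress S v y))\<^sup>2 \<le> 4 * (norm y)\<^sup>2"
proof -
  have "(norm (compress S v y))\<^sup>2 \<le> 2 * (norm (compress S v y - y))\<^sup>2 + 2 * (norm y)\<^sup>2"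
    using norm_add_sq_le2[of "compress S v y - y" y] by simp
  moreover have "(norm (compress S v y - y))\<^sup>2 \<le> (1 - 2 * \<delta>) * (norm y)\<^sup>2"
    using compress_contraction[OF shape assms] unfolding \<delta>(3) .
  moreover have "(1 - 2 * \<delta>) * (norm y)\<^sup>2 \<le> 1 * (norm y)\<^sup>2"
    using \<delta> by (intro mult_right_mono) auto
  ultimately show ?thesis by simp
qed

lemma est_err_step_sq_le:
  "(norm (est_err st' j))\<^sup>2 \<le> (1 - \<delta>) * (norm (est_err st j))\<^sup>2
     + (2 / \<delta>) * (1 - \<mu>)\<^sup>2 * ((norm (mom_err fs st j))\<^sup>2 + (norm (noise_at j))\<^sup>2)"
proof -
  define x where "x = (1 - \<mu>) *\<^sub>R (noise_at j - mom_err fs st j)"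
  have "(norm (est_err st' j))\<^sup>2 \<le> (1 - \<delta>) * (norm (- est_err st j))\<^sup>2 + (1 / \<delta>) * (norm x)\<^sup>2"
    using compress_sum_error[OF u, of j x "- est_err st j"] by (simp add: est_err_step x_def)
  also have "(norm x)\<^sup>2 \<le> (1 - \<mu>)\<^sup>2 * (2 * (norm (noise_at j))\<^sup>2 + 2 * (norm (mom_err fs st j))\<^sup>2)"
    using norm_add_sq_le2[of "noise_at j" "- mom_err fs st j"]
    by (simp add: x_def power_mult_distrib mult_left_mono)
  finally show ?thesis using \<delta>(1) by (simp add: mult_left_mono field_simps)
qed

text \<open>One inequality serves both methods: with an exact broadcast the left-hand side is 0,
  otherwise the lag is itself a compression error with perturbation \<open>- move\<close>.\<close>

lemma lag_step_sq_le:
  "(norm (lag st'))\<^sup>2 \<le> (1 - \<delta>) * (norm (lag st))\<^sup>2 + (1 / \<delta>) * (norm move)\<^sup>2"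
proof (cases meth)
  case EF21_MuonUSign
  then have "broadcast st' = model st'" unfolding broadcast_step by simp
  then show ?thesis using \<delta> by (simp add: lag_def)
next
  case EF21_MuonSign
  then have "broadcast st' = broadcast st + compress S d (model st' - broadcast st)"
    unfolding broadcast_step by simp
  then have "lag st' = compress S d (model st' - broadcast st) - (model st' - broadcast st)"
    by (simp add: lag_def)
  moreover have "model st' - broadcast st = - move + - lag st" by (simp add: model_step lag_def)
  ultimately have "lag st' = compress S d (- move + - lag st) - (- move + - lag st)" by simp
  then show ?thesis using compress_sum_error[OF d, of "- move" "- lag st"] by simp
qed

lemma broadcast_change_sq_le:
  "(norm (broadcast st - broadcast st'))\<^sup>2 \<le> 8 * ((norm (lag st))\<^sup>2 + (norm move)\<^sup>2)"
proof -
  have z: "model st' - broadcast st = - move + - lag st" by (simp add: model_step lag_def)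
  have zz: "(norm (model st' - broadcast st))\<^sup>2 \<le> 2 * (norm move)\<^sup>2 + 2 * (norm (lag st))\<^sup>2"
    unfolding z using norm_add_sq_le2[of "- move" "- lag st"] by simp
  have "(norm (broadcast st - broadcast st'))\<^sup>2 \<le> 4 * (norm (model st' - broadcast st))\<^sup>2"
  proof (cases meth)
    case EF21_MuonUSign
    then have "broadcast st' = model st'" unfolding broadcast_step by simp
    then show ?thesis by (simp add: norm_minus_commute)
  next
    case EF21_MuonSign
    then have "broadcast st' = broadcast st + compress S d (model st' - broadcast st)"
      unfolding broadcast_step by simp
    then show ?thesis using compress_norm_sq_le[OF d, of "model st' - broadcast st"] by simp
  qed
  with zz show ?thesis by simp
qed

text \<open>Young's inequality with parameter \<beta> = 1 - \<mu>. An inflation by 1 + \<beta> is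
  the largest order that the contraction by \<mu> can undo; the price is the factor 1 / \<beta> on
  the drift.\<close>

lemma mom_err_step_sq_le:
  assumes lip: "\<And>X Y. norm (grad (fs j) X - grad (fs j) Y) \<le> K * norm (X - Y)" and "0 \<le> K"
    and \<mu>: "0 \<le> \<mu>" "\<mu> < 1"
  shows "(norm (mom_err fs st' j))\<^sup>2 \<le> (1 + (1 - \<mu>)) * (norm (fresh_err j))\<^sup>2
     + (2 * K\<^sup>2 / (1 - \<mu>)) * (norm (broadcast st - broadcast st'))\<^sup>2"
proof -
  define \<beta> where "\<beta> = 1 - \<mu>"
  have \<beta>: "0 < \<beta>" "\<beta> \<le> 1" using \<mu> by (auto simp: \<beta>_def)
  let ?D = "grad (fs j) (broadcast st) - grad (fs j) (broadcast st')"
  have "(norm (mom_err fs st' j))\<^sup>2 \<le> (1 + \<beta>) * (norm (fresh_err j))\<^sup>2 + (1 + 1 / \<beta>) * (norm ?D)\<^sup>2"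
    unfolding mom_err_step using \<beta> by (intro norm_add_sq_le)
  also have "(1 + 1 / \<beta>) * (norm ?D)\<^sup>2 \<le> (2 / \<beta>) * (K * norm (broadcast st - broadcast st'))\<^sup>2"
    using \<beta> lip by (intro mult_mono power_mono) (auto simp: field_simps)
  finally show ?thesis by (simp add: \<beta>_def power_mult_distrib)
qed

lemma grad_error_sq_le:
  assumes lip: "\<And>j X Y. norm (grad (fs j) X - grad (fs j) Y) \<le> K * norm (X - Y)"
  shows "(norm (grad (average fs) (model st) - server_est st'))\<^sup>2
    \<le> 4 * real CARD('c) * K\<^sup>2 * (norm (lag st))\<^sup>2 + 4 * sq_sum fresh_err
      + 2 * sq_sum (est_err st')"
proof -
  let ?m = "\<lambda>x. (1 / real CARD('c)) *\<^sub>R (\<Sum>j\<in>UNIV. x j)"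
  let ?a = "?m (\<lambda>j. grad (fs j) (model st) - grad (fs j) (broadcast st))"
  let ?b = "?m fresh_err" and ?c = "?m (est_err st')"
  have "(norm (grad (average fs) (model st) - server_est st'))\<^sup>2 \<le> 2 * (norm (?a + - ?b))\<^sup>2 + 2 * (norm (- ?c))\<^sup>2"
    unfolding grad_minus_server using norm_add_sq_le2[of "?a + - ?b" "- ?c"] by simp
  moreover have "(norm (?a + - ?b))\<^sup>2 \<le> 2 * (norm ?a)\<^sup>2 + 2 * (norm (- ?b))\<^sup>2" by (rule norm_add_sq_le2)
  moreover have "(norm ?a)\<^sup>2 \<le> real CARD('c) * K\<^sup>2 * (norm (lag st))\<^sup>2"
  proof -
    have "(norm ?a)\<^sup>2 \<le> (\<Sum>j\<in>UNIV. (norm (grad (fs j) (model st) - grad (fs j) (broadcast st)))\<^sup>2)"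
      by (rule norm_mean_sq_le)
    also have "\<dots> \<le> (\<Sum>j\<in>(UNIV :: 'c set). (K * norm (lag st))\<^sup>2)"
      using lip by (intro sum_mono power_mono) (auto simp: lag_def norm_minus_commute)
    finally show ?thesis by (simp add: power_mult_distrib)
  qed
  moreover have "(norm ?b)\<^sup>2 \<le> sq_sum fresh_err"
    "(norm ?c)\<^sup>2 \<le> sq_sum (est_err st')" by (rule norm_mean_sq_le)+
  ultimately show ?thesis unfolding norm_minus_cancel by linarith
qed

end

text \<open>\<open>F, G, E, H, D, V\<close> are the optimality gap and the squared norms of the server estimate, of its
  error, of the gradient, of the lag and of the change of the broadcast model; \<open>A, B, Y, n\<close> are the
  squared norms of the estimation error, the momentum error, the fresh error and the noise, summed
  over the clients.  Primes mark the values after the round.\<close>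

lemma lyapunov_smooth_round:
  fixes F F' G E H D D' V A A' B B' Y n :: real
  assumes pos: "0 < \<gamma>" "0 < \<beta>" "0 < s" "s \<le> 1" "1 \<le> c" "0 \<le> P" "0 \<le> Q" "0 \<le> R" "0 \<le> E" "0 \<le> G" "0 \<le> D" "0 \<le> A"
    and F: "F' \<le> F - s * \<gamma> * G + c * \<gamma> * E"
    and E: "E \<le> c * (D + Y + A')"
    and A: "A' \<le> (1 - \<delta>) * A + c * \<beta>\<^sup>2 * (B + n)"
    and B: "B' \<le> (1 + \<beta>) * Y + c / \<beta> * V"
    and V: "V \<le> c * (D + \<gamma>\<^sup>2 * G)"
    and D: "D' \<le> (1 - \<delta>) * D + c * \<gamma>\<^sup>2 * G"
    and H: "H \<le> 2 * G + 2 * E"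
    and hQ: "(Q + 2 * c\<^sup>2 * \<gamma>) * (1 - \<delta>) \<le> Q"
    and hR: "2 * c\<^sup>2 * \<gamma> + P * c\<^sup>2 / \<beta> \<le> R * \<delta>"
    and hG: "P * c\<^sup>2 * \<gamma>\<^sup>2 / \<beta> + R * c * \<gamma>\<^sup>2 \<le> 3 / 4 * s * \<gamma>"
  shows "F' + P * B' + Q * A' + R * D' + s / 8 * \<gamma> * H
    \<le> F + Q * A + R * D + (Q + 2 * c\<^sup>2 * \<gamma>) * c * \<beta>\<^sup>2 * B + (P * (1 + \<beta>) + 2 * c\<^sup>2 * \<gamma>) * Y
      + (Q + 2 * c\<^sup>2 * \<gamma>) * c * \<beta>\<^sup>2 * n"
proof -
  define k where "k = 2 * c\<^sup>2 * \<gamma>"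
  have k: "0 \<le> k" using pos by (simp add: k_def)
  \<comment> \<open>A quarter of the decrease is traded for the true gradient: the rate concerns
    \<open>H\<close>, whereas the descent controls \<open>G\<close>. Three quarters remain for the
    second-order terms.\<close>
  have 1: "F' + s / 8 * \<gamma> * H \<le> F - 3 / 4 * s * \<gamma> * G + 2 * c * \<gamma> * E"
  proof -
    have "s / 8 * \<gamma> * H \<le> s / 8 * \<gamma> * (2 * G + 2 * E)" using pos H by (intro mult_left_mono) auto
    moreover have "s * (\<gamma> * E) \<le> c * (\<gamma> * E)" using pos by (intro mult_right_mono) auto
    moreover have "0 \<le> c * (\<gamma> * E)" using pos by simp
    ultimately show ?thesis using F by (simp add: algebra_simps)
  qed
  have 2: "2 * c * \<gamma> * E \<le> k * (D + Y + A')"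
  proof -
    have "2 * c * \<gamma> * E \<le> 2 * c * \<gamma> * (c * (D + Y + A'))" using pos E by (intro mult_left_mono) auto
    then show ?thesis by (simp add: k_def power2_eq_square mult_ac)
  qed
  have 3: "P * B' \<le> P * (1 + \<beta>) * Y + P * c\<^sup>2 / \<beta> * D + P * c\<^sup>2 * \<gamma>\<^sup>2 / \<beta> * G"
  proof -
    have "P * B' \<le> P * ((1 + \<beta>) * Y + c / \<beta> * (c * (D + \<gamma>\<^sup>2 * G)))"
      using pos B V by (intro mult_left_mono order_trans[OF B] add_left_mono) auto
    then show ?thesis by (simp add: power2_eq_square algebra_simps add_divide_distrib)
  qed
  \<comment> \<open>\<open>A'\<close> is paid for twice, as a term of the new potential and inside
    the gradient error with weight \<open>k\<close>; \<open>hQ\<close> says that the contraction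
    covers both.\<close>
  have 4: "(Q + k) * A' \<le> Q * A + (Q + k) * c * \<beta>\<^sup>2 * (B + n)"
  proof -
    have "(Q + k) * A' \<le> (Q + k) * ((1 - \<delta>) * A + c * \<beta>\<^sup>2 * (B + n))"
      using pos k A by (intro mult_left_mono) auto
    also have "\<dots> = (Q + k) * (1 - \<delta>) * A + (Q + k) * c * \<beta>\<^sup>2 * (B + n)" by (simp add: algebra_simps)
    also have "(Q + k) * (1 - \<delta>) * A \<le> Q * A"
      using hQ pos by (intro mult_right_mono) (auto simp: k_def)
    finally show ?thesis by simp
  qed
  have 5: "R * D' \<le> R * D - R * \<delta> * D + R * c * \<gamma>\<^sup>2 * G"
  proof -
    have "R * D' \<le> R * ((1 - \<delta>) * D + c * \<gamma>\<^sup>2 * G)" using pos D by (intro mult_left_mono) auto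
    then show ?thesis by (simp add: algebra_simps)
  qed
  have 6: "(k + P * c\<^sup>2 / \<beta>) * D \<le> R * \<delta> * D" using hR pos by (intro mult_right_mono) (auto simp: k_def)
  have 7: "(P * c\<^sup>2 * \<gamma>\<^sup>2 / \<beta> + R * c * \<gamma>\<^sup>2) * G \<le> 3 / 4 * s * \<gamma> * G"
    using hG pos by (intro mult_right_mono) auto
  have "F' + P * B' + Q * A' + R * D' + s / 8 * \<gamma> * H
      \<le> F + Q * A + R * D + (Q + k) * c * \<beta>\<^sup>2 * (B + n) + (P * (1 + \<beta>) + k) * Y"
    using 1 2 3 4 5 6 7 unfolding distrib_right distrib_left by linarith
  then show ?thesis by (simp add: k_def algebra_simps)
qed

text \<open>\<open>Q\<close>, \<open>P\<close> and \<open>R\<close> are chosen in this order to absorb the estimation error, the momentum error and the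
  lag; the bound on \<open>\<epsilon>\<close> keeps their contributions below the descent term.\<close>

lemma lyapunov_smooth_weights:
  fixes c \<delta> \<beta> \<epsilon> s :: real
  assumes c: "1 \<le> c" and \<delta>: "0 < \<delta>" "\<delta> \<le> 1" and \<beta>: "0 < \<beta>" "\<beta> \<le> 1"
    and s: "0 < s" and \<epsilon>: "0 < \<epsilon>" "\<epsilon>\<^sup>2 \<le> s * \<delta>\<^sup>2 / (28 * c ^ 6)"
  defines "\<gamma> \<equiv> \<epsilon> * \<beta>"
  defines "P \<equiv> 6 * c ^ 3 * \<gamma> / (\<delta> * \<beta>)" and "Q \<equiv> 2 * c\<^sup>2 * \<gamma> / \<delta>"
    and "R \<equiv> 8 * c ^ 5 * \<gamma> / (\<delta>\<^sup>2 * \<beta>\<^sup>2)"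
  shows "(Q + 2 * c\<^sup>2 * \<gamma>) * (1 - \<delta>) \<le> Q"
    and "2 * c\<^sup>2 * \<gamma> + P * c\<^sup>2 / \<beta> \<le> R * \<delta>"
    and "P * c\<^sup>2 * \<gamma>\<^sup>2 / \<beta> + R * c * \<gamma>\<^sup>2 \<le> 3 / 4 * s * \<gamma>"
    and "(P * (1 + \<beta>) + 2 * c\<^sup>2 * \<gamma>) * (1 - \<beta>)\<^sup>2 + (Q + 2 * c\<^sup>2 * \<gamma>) * c * \<beta>\<^sup>2 \<le> P"
    and "(P * (1 + \<beta>) + 2 * c\<^sup>2 * \<gamma>) * \<beta>\<^sup>2 + (Q + 2 * c\<^sup>2 * \<gamma>) * c * \<beta>\<^sup>2 \<le> 18 * c ^ 3 * \<epsilon> / \<delta> * \<beta>\<^sup>2"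
    and "0 \<le> P" "0 \<le> Q" "0 \<le> R"
proof -
  have \<gamma>: "0 < \<gamma>" using \<epsilon> \<beta> by (simp add: \<gamma>_def)
  have cp: "c ^ 2 \<le> c ^ 3" "c ^ 2 \<le> c ^ 5" "c ^ 5 \<le> c ^ 6" using c by (auto intro: power_increasing)
  show P: "0 \<le> P" and "0 \<le> Q" "0 \<le> R" using \<gamma> c \<delta> \<beta> by (auto simp: P_def Q_def R_def)
  have "(Q + 2 * c\<^sup>2 * \<gamma>) * (1 - \<delta>) = Q - 2 * c\<^sup>2 * \<gamma> * \<delta>"
    using \<delta> by (simp add: Q_def field_simps)
  then show "(Q + 2 * c\<^sup>2 * \<gamma>) * (1 - \<delta>) \<le> Q" using \<gamma> \<delta> by simp
  have b2: "\<beta>\<^sup>2 \<le> \<beta>" "\<beta>\<^sup>2 \<le> 1" using \<beta> by (auto simp: power2_eq_square mult_le_one mult_left_le)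
  show "2 * c\<^sup>2 * \<gamma> + P * c\<^sup>2 / \<beta> \<le> R * \<delta>"
  proof -
    have eq: "P * c\<^sup>2 / \<beta> = 6 * (c ^ 5 * \<gamma> / (\<delta> * \<beta>\<^sup>2))" "R * \<delta> = 8 * (c ^ 5 * \<gamma> / (\<delta> * \<beta>\<^sup>2))"
      using \<delta> \<beta> by (simp_all add: P_def R_def power2_eq_square numeral_eq_Suc field_simps)
    have "\<delta> * \<beta>\<^sup>2 \<le> 1" using \<delta> b2 by (intro mult_le_one) auto
    then have "c\<^sup>2 * \<gamma> * (\<delta> * \<beta>\<^sup>2) \<le> c\<^sup>2 * \<gamma> * 1" using \<gamma> by (intro mult_left_mono) auto
    also have "\<dots> \<le> c ^ 5 * \<gamma>" using cp \<gamma> by (simp add: mult_right_mono)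
    finally have "c\<^sup>2 * \<gamma> \<le> c ^ 5 * \<gamma> / (\<delta> * \<beta>\<^sup>2)" using \<delta> \<beta> by (simp add: le_divide_eq)
    \<comment> \<open>The 8 in \<open>R\<close> is the sum of these 2 and 6.\<close>
    moreover have key: "2 * a + 6 * b \<le> 8 * b" if "a \<le> b" for a b :: real using that by simp
    ultimately show ?thesis unfolding eq mult.assoc[of 2] by (intro key)
  qed
  show "P * c\<^sup>2 * \<gamma>\<^sup>2 / \<beta> + R * c * \<gamma>\<^sup>2 \<le> 3 / 4 * s * \<gamma>"
  proof -
    have eq: "P * c\<^sup>2 * \<gamma>\<^sup>2 / \<beta> = 6 * (c ^ 5 * \<epsilon>\<^sup>2 / \<delta>) * \<gamma>" "R * c * \<gamma>\<^sup>2 = 8 * (c ^ 6 * \<epsilon>\<^sup>2 / \<delta>\<^sup>2) * \<gamma>"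
      using \<delta> \<beta> by (simp_all add: P_def R_def \<gamma>_def power2_eq_square numeral_eq_Suc field_simps)
    have "c ^ 5 * \<epsilon>\<^sup>2 / \<delta> \<le> c ^ 6 * \<epsilon>\<^sup>2 / \<delta>\<^sup>2"
    proof -
      have "\<delta>\<^sup>2 \<le> \<delta>" using \<delta> by (simp add: power2_eq_square mult_left_le)
      moreover have "c ^ 5 * \<epsilon>\<^sup>2 \<le> c ^ 6 * \<epsilon>\<^sup>2" using cp(3) by (rule mult_right_mono) simp
      ultimately show ?thesis using \<delta> c by (intro frac_le) (assumption | simp)+
    qed
    moreover have "c ^ 6 * \<epsilon>\<^sup>2 / \<delta>\<^sup>2 \<le> s / 28"
    proof -
      have "28 * c ^ 6 * \<epsilon>\<^sup>2 \<le> s * \<delta>\<^sup>2" using \<epsilon>(2) c by (simp add: le_divide_eq mult_ac)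
      then show ?thesis using \<delta> by (simp add: divide_le_eq)
    qed
    \<comment> \<open>With \<open>a \<le> b\<close> the two terms amount to at most
      \<open>14 * b\<close>, hence to \<open>s / 2\<close>; the 28 in the bound on \<epsilon> is
      made for this.\<close>
    moreover have key: "6 * a + 8 * b \<le> 3 / 4 * s" if "a \<le> b" "b \<le> s / 28" for a b
      using that s by linarith
    ultimately have "6 * (c ^ 5 * \<epsilon>\<^sup>2 / \<delta>) + 8 * (c ^ 6 * \<epsilon>\<^sup>2 / \<delta>\<^sup>2) \<le> 3 / 4 * s" by (intro key)
    then have "(6 * (c ^ 5 * \<epsilon>\<^sup>2 / \<delta>) + 8 * (c ^ 6 * \<epsilon>\<^sup>2 / \<delta>\<^sup>2)) * \<gamma> \<le> 3 / 4 * s * \<gamma>"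
      using \<gamma> by (intro mult_right_mono) auto
    then show ?thesis unfolding eq by (simp add: algebra_simps)
  qed
  have cg: "c\<^sup>2 * \<gamma> \<le> c ^ 3 * \<gamma> / \<delta>"
  proof -
    have "c\<^sup>2 * \<gamma> * \<delta> \<le> c\<^sup>2 * \<gamma> * 1" using \<delta> \<gamma> by (intro mult_left_mono) auto
    also have "\<dots> \<le> c ^ 3 * \<gamma>" using cp \<gamma> by (simp add: mult_right_mono)
    finally show ?thesis using \<delta> by (simp add: le_divide_eq)
  qed
  have Pb: "P * \<beta> = 6 * (c ^ 3 * \<gamma> / \<delta>)" using \<beta> \<delta> by (simp add: P_def)
  have Qc: "(Q + 2 * c\<^sup>2 * \<gamma>) * c \<le> 4 * (c ^ 3 * \<gamma> / \<delta>)"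
  proof -
    have "c\<^sup>2 * \<gamma> \<le> c\<^sup>2 * \<gamma> / \<delta>" using \<delta> \<gamma> by (simp add: le_divide_eq mult_left_le)
    moreover have key: "2 * b + 2 * a \<le> 4 * b" if "a \<le> b" for a b :: real using that by simp
    moreover have "Q + 2 * c\<^sup>2 * \<gamma> = 2 * (c\<^sup>2 * \<gamma> / \<delta>) + 2 * (c\<^sup>2 * \<gamma>)" by (simp add: Q_def)
    ultimately have "Q + 2 * c\<^sup>2 * \<gamma> \<le> 4 * (c\<^sup>2 * \<gamma> / \<delta>)" by (simp only: key)
    then have "(Q + 2 * c\<^sup>2 * \<gamma>) * c \<le> (4 * (c\<^sup>2 * \<gamma> / \<delta>)) * c"
      using c by (intro mult_right_mono) auto
    then show ?thesis by (simp add: power2_eq_square power3_eq_cube mult_ac)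
  qed
  show "(P * (1 + \<beta>) + 2 * c\<^sup>2 * \<gamma>) * (1 - \<beta>)\<^sup>2 + (Q + 2 * c\<^sup>2 * \<gamma>) * c * \<beta>\<^sup>2 \<le> P"
  proof -
    \<comment> \<open>The contraction more than undoes the inflation and releases
      \<open>P * \<beta>\<close>. Its factor 6 pays 2 for the weight of the fresh error in the
      gradient error and 4 for that of the momentum error in the estimation error.\<close>
    have "(1 + \<beta>) * (1 - \<beta>)\<^sup>2 = (1 - \<beta>) * (1 - \<beta>\<^sup>2)" by (simp add: power2_eq_square algebra_simps)
    also have "\<dots> \<le> (1 - \<beta>) * 1" using \<beta> by (intro mult_left_mono) auto
    finally have 1: "P * ((1 + \<beta>) * (1 - \<beta>)\<^sup>2) \<le> P * (1 - \<beta>)" using P by (intro mult_left_mono) auto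
    have 2: "2 * c\<^sup>2 * \<gamma> * (1 - \<beta>)\<^sup>2 \<le> 2 * c\<^sup>2 * \<gamma> * 1"
      using \<beta> \<gamma> by (intro mult_left_mono power_le_one) auto
    have 3: "(Q + 2 * c\<^sup>2 * \<gamma>) * c * \<beta>\<^sup>2 \<le> (4 * (c ^ 3 * \<gamma> / \<delta>)) * 1"
      by (rule mult_mono[OF Qc]) (use b2 c \<gamma> \<delta> in auto)
    have 4: "2 * c\<^sup>2 * \<gamma> \<le> 2 * (c ^ 3 * \<gamma> / \<delta>)" using cg by simp
    have key: "(P * (1 + \<beta>) + k) * b + q \<le> P"
      if "P * ((1 + \<beta>) * b) \<le> P * (1 - \<beta>)" "k * b \<le> k * 1" "q \<le> 4 * x * 1" "k \<le> 2 * x" "P * \<beta> = 6 * x"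
      for k b q x :: real
    proof -
      have "(P * (1 + \<beta>) + k) * b = P * ((1 + \<beta>) * b) + k * b" by (simp add: distrib_right mult.assoc)
      moreover have "P * (1 - \<beta>) = P - P * \<beta>" by (simp add: right_diff_distrib)
      ultimately show ?thesis using that by linarith
    qed
    show ?thesis by (rule key[OF 1 2 3 4 Pb])
  qed
  show "(P * (1 + \<beta>) + 2 * c\<^sup>2 * \<gamma>) * \<beta>\<^sup>2 + (Q + 2 * c\<^sup>2 * \<gamma>) * c * \<beta>\<^sup>2 \<le> 18 * c ^ 3 * \<epsilon> / \<delta> * \<beta>\<^sup>2"
  proof -
    have gb: "c ^ 3 * \<gamma> / \<delta> \<le> c ^ 3 * \<epsilon> / \<delta>"
      using \<beta> \<epsilon> c \<delta> by (intro divide_right_mono mult_left_mono) (auto simp: \<gamma>_def mult_left_le)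
    have P6: "P = 6 * (c ^ 3 * \<epsilon> / \<delta>)" using \<beta> by (simp add: P_def \<gamma>_def)
    have Pb2: "P * (1 + \<beta>) \<le> P * 2" using P \<beta> by (intro mult_left_mono) auto
    have "2 * c\<^sup>2 * \<gamma> \<le> 2 * (c ^ 3 * \<gamma> / \<delta>)" using cg by simp
    \<comment> \<open>The 18 is 12 from \<open>P * 2\<close>, 2 from the gradient error and 4 from
      the estimation error.\<close>
    moreover have key: "x + k + q \<le> 18 * e" if "k \<le> 2 * g" "x \<le> P * 2" "P = 6 * e" "q \<le> 4 * g" "g \<le> e"
      for x k q e g :: real
      using that by linarith
    ultimately have "(P * (1 + \<beta>) + 2 * c\<^sup>2 * \<gamma>) + (Q + 2 * c\<^sup>2 * \<gamma>) * c \<le> 18 * (c ^ 3 * \<epsilon> / \<delta>)"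
      using Pb2 P6 Qc gb by (intro key)
    then have "((P * (1 + \<beta>) + 2 * c\<^sup>2 * \<gamma>) + (Q + 2 * c\<^sup>2 * \<gamma>) * c) * \<beta>\<^sup>2 \<le> 18 * (c ^ 3 * \<epsilon> / \<delta>) * \<beta>\<^sup>2"
      by (intro mult_right_mono) auto
    then show ?thesis by (simp add: algebra_simps)
  qed
qed

section \<open>Layer-wise smooth functions\<close>

lemma norm_grad_average_diff_le:
  fixes fs :: "'c::finite \<Rightarrow> real ^ 'e::finite \<Rightarrow> real"
  assumes diff: "\<And>j X. fs j differentiable (at X)"
    and lip: "\<And>j. norm (grad (fs j) Y - grad (fs j) X) \<le> K * norm (Y - X)"
  shows "norm (grad (average fs) Y - grad (average fs) X) \<le> real CARD('c) * K * norm (Y - X)"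
proof -
  have "grad (average fs) Y - grad (average fs) X
      = (1 / real CARD('c)) *\<^sub>R (\<Sum>j\<in>UNIV. grad (fs j) Y - grad (fs j) X)"
    by (simp add: grad_average[OF diff] sum_subtractf algebra_simps)
  then have "norm (grad (average fs) Y - grad (average fs) X)
      \<le> (\<Sum>j\<in>UNIV. norm (grad (fs j) Y - grad (fs j) X))"
    by (simp only: norm_mean_le)
  also have "\<dots> \<le> (\<Sum>j\<in>(UNIV :: 'c set). K * norm (Y - X))"
    using lip by (intro sum_mono) auto
  finally show ?thesis by (simp add: mult.assoc)
qed

lemma average_differentiable:
  fixes fs :: "'c::finite \<Rightarrow> real ^ 'e::finite \<Rightarrow> real"
  assumes diff: "\<And>j X. fs j differentiable (at X)"
  shows "average fs differentiable (at X)"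
  using has_derivative_average[where fs = fs, OF diff] by (auto simp: gderiv_def differentiable_def)

context muon_round
begin

lemma move_adaptive_sq_le:
  assumes lr: "\<And>i M. lr i M = \<gamma> * \<rho> i * nuclear_norm M" and \<rho>: "\<And>i. 0 < \<rho> i" "\<And>i. \<rho> i \<le> \<rho>max"
  shows "(norm move)\<^sup>2 \<le> real CARD('e) * \<gamma>\<^sup>2 * \<rho>max\<^sup>2 * nuclear_norm_sq S (server_est st')"
proof -
  let ?\<nu> = "\<lambda>i. nuclear_norm (block S (server_est st') i)"
  have "(norm move)\<^sup>2 \<le> real CARD('e) * (\<Sum>i\<in>UNIV. (\<gamma> * \<rho> i * ?\<nu> i)\<^sup>2)"
    unfolding move_def using norm_muon_direction_sq_le[OF shape, of lr "server_est st'"] by (simp add: lr)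
  also have "\<dots> \<le> real CARD('e) * (\<Sum>i\<in>UNIV. \<gamma>\<^sup>2 * \<rho>max\<^sup>2 * (?\<nu> i)\<^sup>2)"
  proof (intro mult_left_mono sum_mono)
    fix i
    have "(\<rho> i)\<^sup>2 \<le> \<rho>max\<^sup>2" using \<rho>[of i] by (intro power_mono) auto
    then show "(\<gamma> * \<rho> i * ?\<nu> i)\<^sup>2 \<le> \<gamma>\<^sup>2 * \<rho>max\<^sup>2 * (?\<nu> i)\<^sup>2"
      unfolding power_mult_distrib by (intro mult_right_mono mult_left_mono) auto
  qed simp
  finally show ?thesis by (simp add: nuclear_norm_sq_def sum_distrib_left mult_ac)
qed

text \<open>A rate proportional to the nuclear norm of the estimate turns the duality pairing into a
  square, as for gradient descent. Young's inequality gives up half of it to the estimation error,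
  and the smallness of \<gamma> lets the second-order term consume only another quarter.\<close>

lemma adaptive_descent:
  assumes lip: "\<And>j X Y. norm (grad (fs j) X - grad (fs j) Y) \<le> K * norm (X - Y)" and K: "0 \<le> K"
    and lr: "\<And>i M. lr i M = \<gamma> * \<rho> i * nuclear_norm M" and \<gamma>: "0 < \<gamma>"
    and \<rho>: "0 < \<rho>min" "\<And>i. \<rho>min \<le> \<rho> i" "\<And>i. \<rho> i \<le> \<rho>max"
    and small: "4 * real CARD('c) * K * real CARD('e) * \<rho>max\<^sup>2 * \<gamma> \<le> \<rho>min"
  shows "average fs (model st') \<le> average fs (model st) - \<rho>min / 4 * \<gamma> * (norm (server_est st'))\<^sup>2
    + \<rho>max * real CARD('e) * \<gamma> * (norm (grad (average fs) (model st) - server_est st'))\<^sup>2"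
proof -
  let ?f = "average fs" and ?X = "model st" and ?g = "server_est st'" and ?K = "real CARD('e)"
  let ?\<nu> = "\<lambda>i. nuclear_norm (block S ?g i)" and ?e = "\<lambda>i. frob2 (block S (grad ?f ?X - ?g) i)"
  have \<rho>0: "0 < \<rho> i" for i using \<rho>(1,2) less_le_trans by blast
  then have \<rho>max: "0 < \<rho>max" using \<rho>(3) less_le_trans by blast
  have "\<gamma> * \<rho>min / 2 * nuclear_norm_sq S ?g - \<gamma> * \<rho>max * ?K / 2 * (norm (grad ?f ?X - ?g))\<^sup>2
      \<le> inner (grad ?f ?X) move"
  proof -
    have "\<gamma> * \<rho>min / 2 * (?\<nu> i)\<^sup>2 - \<gamma> * \<rho>max * ?K / 2 * ?e i
        \<le> \<gamma> * \<rho> i * ?\<nu> i * finner (block S (grad ?f ?X) i) (polar (block S ?g i))" for i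
    proof -
      have "?\<nu> i * (sqrt ?K * sqrt (?e i)) \<le> (?\<nu> i)\<^sup>2 / 2 + ?K / 2 * ?e i"
      proof -
        have "0 \<le> (?\<nu> i - sqrt ?K * sqrt (?e i))\<^sup>2" by simp
        also have "\<dots> = (?\<nu> i)\<^sup>2 - 2 * (?\<nu> i * (sqrt ?K * sqrt (?e i))) + ?K * ?e i"
          by (simp add: power2_diff power_mult_distrib frob2_nonneg)
        finally show ?thesis by simp
      qed
      moreover have "?\<nu> i * (?\<nu> i - sqrt ?K * sqrt (?e i))
          \<le> ?\<nu> i * finner (block S (grad ?f ?X) i) (polar (block S ?g i))"
        by (intro mult_left_mono finner_block_polar_ge[OF shape] nuclear_norm_nonneg)
      ultimately have "(?\<nu> i)\<^sup>2 / 2 - ?K / 2 * ?e i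
          \<le> ?\<nu> i * finner (block S (grad ?f ?X) i) (polar (block S ?g i))"
        by (simp add: right_diff_distrib power2_eq_square)
      then have "\<gamma> * \<rho> i * ((?\<nu> i)\<^sup>2 / 2 - ?K / 2 * ?e i)
          \<le> \<gamma> * \<rho> i * (?\<nu> i * finner (block S (grad ?f ?X) i) (polar (block S ?g i)))"
        using \<gamma> \<rho>0[of i] by (intro mult_left_mono) auto
      moreover have "\<gamma> * \<rho>min * (?\<nu> i)\<^sup>2 \<le> \<gamma> * \<rho> i * (?\<nu> i)\<^sup>2"
        using \<gamma> \<rho> by (intro mult_right_mono mult_left_mono) auto
      moreover have "\<gamma> * \<rho> i * (?K * ?e i) \<le> \<gamma> * \<rho>max * (?K * ?e i)"
        using \<gamma> \<rho> by (intro mult_right_mono mult_left_mono mult_nonneg_nonneg frob2_nonneg) auto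
      ultimately show ?thesis by (simp add: algebra_simps)
    qed
    then have "(\<Sum>i\<in>UNIV. \<gamma> * \<rho>min / 2 * (?\<nu> i)\<^sup>2 - \<gamma> * \<rho>max * ?K / 2 * ?e i)
        \<le> (\<Sum>i\<in>UNIV. \<gamma> * \<rho> i * ?\<nu> i * finner (block S (grad ?f ?X) i) (polar (block S ?g i)))"
      by (intro sum_mono)
    also have "\<dots> = inner (grad ?f ?X) move"
      unfolding move_def inner_muon_direction[OF shape] by (simp add: lr)
    finally show ?thesis
      by (simp add: sum_subtractf nuclear_norm_sq_def norm_sq_eq_sum_frob2[OF shape] sum_distrib_left)
  qed
  moreover have "?f (model st') \<le> ?f ?X + inner (grad ?f ?X) (model st' - ?X)
      + real CARD('c) * K * (norm (model st' - ?X))\<^sup>2"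
    by (rule descent_inequality[OF average_differentiable[OF diff]])
      (rule norm_grad_average_diff_le[OF diff lip])
  moreover have "real CARD('c) * K * (norm move)\<^sup>2 \<le> \<gamma> * \<rho>min / 4 * nuclear_norm_sq S ?g"
  proof -
    have "real CARD('c) * K * (norm move)\<^sup>2
        \<le> real CARD('c) * K * (?K * \<gamma>\<^sup>2 * \<rho>max\<^sup>2 * nuclear_norm_sq S ?g)"
      using K by (intro mult_left_mono move_adaptive_sq_le[OF lr \<rho>0 \<rho>(3)]) auto
    also have "\<dots> = (4 * real CARD('c) * K * ?K * \<rho>max\<^sup>2 * \<gamma>) * (\<gamma> / 4 * nuclear_norm_sq S ?g)"
      by (simp add: power2_eq_square)
    also have "\<dots> \<le> \<rho>min * (\<gamma> / 4 * nuclear_norm_sq S ?g)"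
      using \<gamma> by (intro mult_right_mono small mult_nonneg_nonneg) (auto simp: nuclear_norm_sq_def sum_nonneg)
    finally show ?thesis by (simp add: mult_ac)
  qed
  moreover have "\<gamma> * \<rho>min / 4 * (norm ?g)\<^sup>2 \<le> \<gamma> * \<rho>min / 4 * nuclear_norm_sq S ?g"
    using \<gamma> \<rho> by (intro mult_left_mono norm_sq_le_nuclear_norm_sq[OF shape]) auto
  moreover have "0 \<le> \<gamma> * \<rho>max * ?K / 2 * (norm (grad ?f ?X - ?g))\<^sup>2" using \<gamma> \<rho>max by simp
  ultimately show ?thesis by (simp add: model_step algebra_simps)
qed

text \<open>A pathwise inequality in which one constant \<open>c\<close> dominates all problem
  constants. The fresh error and the noise stay on the right-hand side because their useful bounds
  hold only in expectation.\<close>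

lemma smooth_round_bound:
  assumes lip: "\<And>j X Y. norm (grad (fs j) X - grad (fs j) Y) \<le> K * norm (X - Y)" and K: "0 \<le> K"
    and lr: "\<And>i M. lr i M = \<gamma> * \<rho> i * nuclear_norm M" and \<gamma>: "0 < \<gamma>"
    and \<rho>: "0 < \<rho>min" "\<And>i. \<rho>min \<le> \<rho> i" "\<And>i. \<rho> i \<le> \<rho>max"
    and small: "4 * real CARD('c) * K * real CARD('e) * \<rho>max\<^sup>2 * \<gamma> \<le> \<rho>min"
    and \<mu>: "\<mu> = 1 - \<beta>" "0 < \<beta>" "\<beta> \<le> 1"
    and s: "0 < s" "s \<le> 1" "s \<le> \<rho>min / 4"
    and c: "8 \<le> c" "\<rho>max * real CARD('e) \<le> c" "4 * real CARD('c) * K\<^sup>2 \<le> c" "2 / \<delta> \<le> c"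
      "8 * (real CARD('e))\<^sup>2 * \<rho>max\<^sup>2 \<le> c" "(real CARD('e))\<^sup>2 * \<rho>max\<^sup>2 / \<delta> \<le> c"
    and PQR: "0 \<le> P" "0 \<le> Q" "0 \<le> R"
    and hQ: "(Q + 2 * c\<^sup>2 * \<gamma>) * (1 - \<delta>) \<le> Q"
    and hR: "2 * c\<^sup>2 * \<gamma> + P * c\<^sup>2 / \<beta> \<le> R * \<delta>"
    and hG: "P * c\<^sup>2 * \<gamma>\<^sup>2 / \<beta> + R * c * \<gamma>\<^sup>2 \<le> 3 / 4 * s * \<gamma>"
  shows "average fs (model st') - fstar + P * sq_sum (mom_err fs st')
      + Q * sq_sum (est_err st') + R * (norm (lag st'))\<^sup>2
      + s / 8 * \<gamma> * (norm (grad (average fs) (model st)))\<^sup>2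
    \<le> average fs (model st) - fstar + Q * sq_sum (est_err st) + R * (norm (lag st))\<^sup>2
      + (Q + 2 * c\<^sup>2 * \<gamma>) * c * \<beta>\<^sup>2 * sq_sum (mom_err fs st)
      + (P * (1 + \<beta>) + 2 * c\<^sup>2 * \<gamma>) * sq_sum fresh_err
      + (Q + 2 * c\<^sup>2 * \<gamma>) * c * \<beta>\<^sup>2 * sq_sum noise_at"
proof (rule lyapunov_smooth_round[where E = "(norm (grad (average fs) (model st) - server_est st'))\<^sup>2"
      and G = "(norm (server_est st'))\<^sup>2" and D = "(norm (lag st))\<^sup>2"
      and V = "(norm (broadcast st - broadcast st'))\<^sup>2" and \<delta> = \<delta> and c = c])
  let ?E = "(norm (grad (average fs) (model st) - server_est st'))\<^sup>2" and ?G = "(norm (server_est st'))\<^sup>2"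
  have \<rho>0: "0 < \<rho> i" for i using \<rho>(1,2) less_le_trans by blast
  have move: "(norm move)\<^sup>2 \<le> (real CARD('e))\<^sup>2 * \<rho>max\<^sup>2 * (\<gamma>\<^sup>2 * ?G)"
  proof -
    have "(norm move)\<^sup>2 \<le> real CARD('e) * \<gamma>\<^sup>2 * \<rho>max\<^sup>2 * nuclear_norm_sq S (server_est st')"
      by (rule move_adaptive_sq_le[OF lr \<rho>0 \<rho>(3)])
    also have "\<dots> \<le> real CARD('e) * \<gamma>\<^sup>2 * \<rho>max\<^sup>2 * (real CARD('e) * ?G)"
      by (intro mult_left_mono nuclear_norm_sq_le_norm_sq[OF shape]) auto
    finally show ?thesis by (simp add: power2_eq_square mult_ac)
  qed
  have gG: "0 \<le> \<gamma>\<^sup>2 * ?G" by simp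
  show "average fs (model st') - fstar \<le> average fs (model st) - fstar - s * \<gamma> * ?G + c * \<gamma> * ?E"
  proof -
    have "s * (\<gamma> * ?G) \<le> \<rho>min / 4 * (\<gamma> * ?G)" using s \<gamma> by (intro mult_right_mono) auto
    moreover have "\<rho>max * real CARD('e) * (\<gamma> * ?E) \<le> c * (\<gamma> * ?E)" using c \<gamma> by (intro mult_right_mono) auto
    ultimately show ?thesis
      using adaptive_descent[OF lip K lr \<gamma> \<rho> small] by (simp add: mult.assoc)
  qed
  show "?E \<le> c * ((norm (lag st))\<^sup>2 + sq_sum fresh_err + sq_sum (est_err st'))"
  proof -
    have "4 * real CARD('c) * K\<^sup>2 * (norm (lag st))\<^sup>2 \<le> c * (norm (lag st))\<^sup>2"
      "4 * sq_sum fresh_err \<le> c * sq_sum fresh_err"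
      "2 * sq_sum (est_err st') \<le> c * sq_sum (est_err st')"
      using c by (intro mult_right_mono sum_nonneg; simp)+
    then show ?thesis using grad_error_sq_le[OF lip] by (simp add: distrib_left)
  qed
  show "sq_sum (est_err st') \<le> (1 - \<delta>) * sq_sum (est_err st)
      + c * \<beta>\<^sup>2 * (sq_sum (mom_err fs st) + sq_sum noise_at)"
  proof -
    have "sq_sum (est_err st') \<le> (\<Sum>j\<in>UNIV. (1 - \<delta>) * (norm (est_err st j))\<^sup>2
       + (c * \<beta>\<^sup>2) * ((norm (mom_err fs st j))\<^sup>2 + (norm (noise_at j))\<^sup>2))"
    proof (rule sum_mono)
      fix j
      have "(2 / \<delta>) * \<beta>\<^sup>2 * ((norm (mom_err fs st j))\<^sup>2 + (norm (noise_at j))\<^sup>2)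
          \<le> (c * \<beta>\<^sup>2) * ((norm (mom_err fs st j))\<^sup>2 + (norm (noise_at j))\<^sup>2)"
        using c by (intro mult_right_mono) auto
      then show "(norm (est_err st' j))\<^sup>2 \<le> (1 - \<delta>) * (norm (est_err st j))\<^sup>2
          + (c * \<beta>\<^sup>2) * ((norm (mom_err fs st j))\<^sup>2 + (norm (noise_at j))\<^sup>2)"
        using est_err_step_sq_le[of j] \<mu> by simp
    qed
    then show ?thesis by (simp add: sum.distrib distrib_left flip: sum_distrib_left)
  qed
  show "sq_sum (mom_err fs st') \<le> (1 + \<beta>) * sq_sum fresh_err
      + c / \<beta> * (norm (broadcast st - broadcast st'))\<^sup>2"
  proof -
    have "sq_sum (mom_err fs st') \<le> (\<Sum>j\<in>UNIV. (1 + \<beta>) * (norm (fresh_err j))\<^sup>2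
       + (2 * K\<^sup>2 / \<beta>) * (norm (broadcast st - broadcast st'))\<^sup>2)"
      using mom_err_step_sq_le[OF lip K] \<mu> by (intro sum_mono) auto
    also have "\<dots> = (1 + \<beta>) * sq_sum fresh_err
        + (2 * real CARD('c) * K\<^sup>2) / \<beta> * (norm (broadcast st - broadcast st'))\<^sup>2"
      by (simp add: sum.distrib sum_distrib_left)
    also have "\<dots> \<le> (1 + \<beta>) * sq_sum fresh_err
      + c / \<beta> * (norm (broadcast st - broadcast st'))\<^sup>2"
    proof (intro add_left_mono mult_right_mono divide_right_mono)
      have "2 * real CARD('c) * K\<^sup>2 \<le> 4 * real CARD('c) * K\<^sup>2" by (intro mult_right_mono) auto
      then show "2 * real CARD('c) * K\<^sup>2 \<le> c" using c by linarith
    qed (use \<mu> in auto)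
    finally show ?thesis .
  qed
  show "(norm (broadcast st - broadcast st'))\<^sup>2 \<le> c * ((norm (lag st))\<^sup>2 + \<gamma>\<^sup>2 * ?G)"
  proof -
    have "8 * (norm (lag st))\<^sup>2 \<le> c * (norm (lag st))\<^sup>2" using c by (intro mult_right_mono) auto
    moreover have "8 * (norm move)\<^sup>2 \<le> c * (\<gamma>\<^sup>2 * ?G)"
    proof -
      have "8 * (norm move)\<^sup>2 \<le> (8 * (real CARD('e))\<^sup>2 * \<rho>max\<^sup>2) * (\<gamma>\<^sup>2 * ?G)" using move by simp
      also have "\<dots> \<le> c * (\<gamma>\<^sup>2 * ?G)" using c gG by (intro mult_right_mono) auto
      finally show ?thesis .
    qed
    ultimately show ?thesis using broadcast_change_sq_le by (simp add: distrib_left)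
  qed
  show "(norm (lag st'))\<^sup>2 \<le> (1 - \<delta>) * (norm (lag st))\<^sup>2 + c * \<gamma>\<^sup>2 * ?G"
  proof -
    have "(1 / \<delta>) * (norm move)\<^sup>2 \<le> (1 / \<delta>) * ((real CARD('e))\<^sup>2 * \<rho>max\<^sup>2 * (\<gamma>\<^sup>2 * ?G))"
      using move \<delta>(1) by (intro mult_left_mono) auto
    also have "\<dots> = ((real CARD('e))\<^sup>2 * \<rho>max\<^sup>2 / \<delta>) * (\<gamma>\<^sup>2 * ?G)" by simp
    also have "\<dots> \<le> c * (\<gamma>\<^sup>2 * ?G)" using c gG by (intro mult_right_mono) auto
    finally show ?thesis using lag_step_sq_le by (simp add: mult.assoc)
  qed
  show "(norm (grad (average fs) (model st)))\<^sup>2 \<le> 2 * ?G + 2 * ?E"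
    using norm_add_sq_le2[of "server_est st'" "grad (average fs) (model st) - server_est st'"] by simp
  show "(Q + 2 * c\<^sup>2 * \<gamma>) * (1 - \<delta>) \<le> Q" "2 * c\<^sup>2 * \<gamma> + P * c\<^sup>2 / \<beta> \<le> R * \<delta>"
    "P * c\<^sup>2 * \<gamma>\<^sup>2 / \<beta> + R * c * \<gamma>\<^sup>2 \<le> 3 / 4 * s * \<gamma>" by fact+
qed (use \<gamma> \<mu> s c PQR in \<open>auto intro: sum_nonneg\<close>)

end

section \<open>Expected progress of a round in the smooth case\<close>

context stochastic_clients
begin

abbreviation expect :: "('w \<Rightarrow> real) \<Rightarrow> ennreal" where
  "expect h \<equiv> \<integral>\<^sup>+ \<omega>. ennreal (h \<omega>) \<partial>base R"

lemma consistent_muon_state: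
  assumes "\<omega> \<in> space (base R)"
  shows "consistent (muon_state S meth X0 \<mu> lr R t \<omega>)"
proof (induction t)
  case 0
  show ?case by (simp add: consistent_def)
next
  case (Suc t)
  interpret muon_round S meth fs "stoch_grad R" \<mu> lr "\<lambda>j. sample R (Suc t) j \<omega>"
      "\<lambda>j. up_sign R (Suc t) j \<omega>" "down_sign R (Suc t) \<omega>" "muon_state S meth X0 \<mu> lr R t \<omega>"
    using shape diff up_sign_values[OF assms] down_sign_values[OF assms] Suc by unfold_locales auto
  show ?case using consistent_step by (simp add: st'_def)
qed

lemma muon_round_state:
  assumes "\<omega> \<in> space (base R)"
  shows "muon_round S fs (\<lambda>j. up_sign R (Suc t) j \<omega>) (down_sign R (Suc t) \<omega>) (muon_state S meth X0 \<mu> lr R t \<omega>)"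
  using shape diff up_sign_values[OF assms] down_sign_values[OF assms] consistent_muon_state[OF assms]
  by unfold_locales auto

text \<open>\<open>U\<close> and \<open>v\<close> are known from the past, so only the explicit
  noise depends on the new samples. The squares are replaced by their conditional bounds, after
  which the shift \<open>v\<close> loses its noise and rejoins \<open>U\<close>. Integrals in
  \<open>ennreal\<close> keep integrability out of the way.\<close>

lemma expectation_round_le:
  assumes W: "W t \<in> borel_measurable (past R t)" and v: "\<And>j. v j \<in> borel_measurable (past R t)"
    and U: "U \<in> borel_measurable (past R t)" "\<And>\<omega>. \<omega> \<in> space (base R) \<Longrightarrow> 0 \<le> U \<omega>"
    and pq: "0 \<le> p" "0 \<le> q"
    and le: "\<And>\<omega>. \<omega> \<in> space (base R) \<Longrightarrow> \<psi> \<omega> \<le> U \<omega>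
      + p * (\<Sum>j\<in>UNIV. (norm (v j \<omega> + \<beta> *\<^sub>R noise W t j \<omega>))\<^sup>2) + q * (\<Sum>j\<in>UNIV. (norm (noise W t j \<omega>))\<^sup>2)"
  shows "expect \<psi>
    \<le> (\<integral>\<^sup>+ \<omega>. ennreal (U \<omega> + p * (\<Sum>j\<in>UNIV. (norm (v j \<omega>))\<^sup>2)) \<partial>base R)
      + ennreal (real CARD('c) * \<sigma>\<^sup>2 * (p * \<beta>\<^sup>2 + q))"
proof -
  let ?y = "\<lambda>j \<omega>. (norm (v j \<omega> + \<beta> *\<^sub>R noise W t j \<omega>))\<^sup>2" and ?n = "\<lambda>j \<omega>. (norm (noise W t j \<omega>))\<^sup>2"
  note [measurable] = measurable_past_base[OF U(1)] measurable_past_base[OF v]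
    measurable_past_base[OF noise_measurable[of W t, OF W]]
  have "expect \<psi> \<le> (\<integral>\<^sup>+ \<omega>. ennreal (U \<omega>)
      + (ennreal p * (\<Sum>j\<in>UNIV. ennreal (?y j \<omega>)) + ennreal q * (\<Sum>j\<in>UNIV. ennreal (?n j \<omega>))) \<partial>base R)"
  proof (rule nn_integral_mono)
    fix \<omega> assume \<omega>: "\<omega> \<in> space (base R)"
    have "ennreal (\<psi> \<omega>) \<le> ennreal (U \<omega> + (p * (\<Sum>j\<in>UNIV. ?y j \<omega>) + q * (\<Sum>j\<in>UNIV. ?n j \<omega>)))"
      using le[OF \<omega>] by (intro ennreal_leI) simp
    also have "\<dots> = ennreal (U \<omega>) + (ennreal p * (\<Sum>j\<in>UNIV. ennreal (?y j \<omega>)) + ennreal q * (\<Sum>j\<in>UNIV. ennreal (?n j \<omega>)))"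
      using U(2)[OF \<omega>] pq by (simp add: ennreal_plus ennreal_mult sum_nonneg)
    finally show "ennreal (\<psi> \<omega>) \<le> \<dots>" .
  qed
  also have "\<dots> = expect U
      + (ennreal p * (\<Sum>j\<in>UNIV. \<integral>\<^sup>+ \<omega>. ennreal (?y j \<omega>) \<partial>base R)
      + ennreal q * (\<Sum>j\<in>UNIV. \<integral>\<^sup>+ \<omega>. ennreal (?n j \<omega>) \<partial>base R))"
    by (simp add: nn_integral_add nn_integral_cmult nn_integral_sum del: sum_ennreal)
  also have "\<dots> \<le> expect U
      + (ennreal p * (\<Sum>j\<in>UNIV. (\<integral>\<^sup>+ \<omega>. ennreal ((norm (v j \<omega>))\<^sup>2) \<partial>base R) + ennreal (\<beta>\<^sup>2 * \<sigma>\<^sup>2))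
      + ennreal q * (\<Sum>j\<in>(UNIV :: 'c set). ennreal (\<sigma>\<^sup>2)))"
    by (intro add_mono mult_left_mono sum_mono expectation_shifted_noise_sq[of W t, OF W v] expectation_noise_sq[of W t, OF W])
      auto
  also have "\<dots> = expect U
      + ennreal p * (\<Sum>j\<in>UNIV. \<integral>\<^sup>+ \<omega>. ennreal ((norm (v j \<omega>))\<^sup>2) \<partial>base R)
      + (ennreal p * (real CARD('c) * ennreal (\<beta>\<^sup>2 * \<sigma>\<^sup>2)) + ennreal q * (real CARD('c) * ennreal (\<sigma>\<^sup>2)))"
    by (simp add: sum.distrib distrib_left add_ac ennreal_of_nat_eq_real_of_nat)
  also have "ennreal p * (real CARD('c) * ennreal (\<beta>\<^sup>2 * \<sigma>\<^sup>2)) + ennreal q * (real CARD('c) * ennreal (\<sigma>\<^sup>2))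
      = ennreal (real CARD('c) * \<sigma>\<^sup>2 * (p * \<beta>\<^sup>2 + q))"
    using pq by (simp add: algebra_simps flip: ennreal_mult ennreal_plus)
  also have "expect U
      + ennreal p * (\<Sum>j\<in>UNIV. \<integral>\<^sup>+ \<omega>. ennreal ((norm (v j \<omega>))\<^sup>2) \<partial>base R)
      = (\<integral>\<^sup>+ \<omega>. ennreal (U \<omega>) + ennreal p * (\<Sum>j\<in>UNIV. ennreal ((norm (v j \<omega>))\<^sup>2)) \<partial>base R)"
    by (simp add: nn_integral_add nn_integral_cmult nn_integral_sum del: sum_ennreal)
  also have "\<dots> = (\<integral>\<^sup>+ \<omega>. ennreal (U \<omega> + p * (\<Sum>j\<in>UNIV. (norm (v j \<omega>))\<^sup>2)) \<partial>base R)"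
    using U(2) pq by (intro nn_integral_cong) (simp add: ennreal_plus ennreal_mult sum_nonneg)
  finally show ?thesis .
qed

end

text \<open>A discrete Gronwall inequality. The sum collected so far may be inflated by
  \<open>1 + q\<close> as well, since this factor is at least 1. The smooth case uses
  \<open>q = 0\<close>, the generalized case a \<open>q\<close> of order 1 / T.\<close>

lemma lyapunov_telescope:
  fixes a b :: "nat \<Rightarrow> ennreal"
  assumes "\<And>t. a (Suc t) + b t \<le> ennreal (1 + q) * a t + ennreal \<kappa>"
    and q: "0 \<le> q" "0 \<le> \<kappa>" and a0: "a 0 \<le> ennreal \<Phi>0" "0 \<le> \<Phi>0"
  shows "a T + (\<Sum>t<T. b t) \<le> ennreal ((1 + q) ^ T * (\<Phi>0 + real T * \<kappa>))"
proof (induction T)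
  case 0
  show ?case using a0 by simp
next
  case (Suc T)
  let ?s = "\<Sum>t<T. b t"
  have "a (Suc T) + (\<Sum>t<Suc T. b t) = (a (Suc T) + b T) + ?s" by (simp add: add_ac)
  also have "\<dots> \<le> (ennreal (1 + q) * a T + ennreal \<kappa>) + ennreal (1 + q) * ?s"
  proof (rule add_mono[OF assms(1)])
    have "1 * ?s \<le> ennreal (1 + q) * ?s" using q by (intro mult_right_mono) (auto simp flip: ennreal_1 intro!: ennreal_leI simp del: ennreal_1)
    then show "?s \<le> ennreal (1 + q) * ?s" by simp
  qed
  also have "\<dots> = ennreal (1 + q) * (a T + ?s) + ennreal \<kappa>" by (simp add: distrib_left add_ac)
  also have "\<dots> \<le> ennreal (1 + q) * ennreal ((1 + q) ^ T * (\<Phi>0 + real T * \<kappa>)) + ennreal \<kappa>"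
    by (intro add_right_mono mult_left_mono Suc) auto
  also have "\<dots> = ennreal ((1 + q) ^ Suc T * (\<Phi>0 + real T * \<kappa>) + \<kappa>)"
    using q a0 by (simp add: mult.assoc flip: ennreal_mult ennreal_plus)
  also have "\<dots> \<le> ennreal ((1 + q) ^ Suc T * (\<Phi>0 + real (Suc T) * \<kappa>))"
  proof (rule ennreal_leI)
    have "1 * \<kappa> \<le> (1 + q) ^ Suc T * \<kappa>" using q by (intro mult_right_mono one_le_power) auto
    then show "(1 + q) ^ Suc T * (\<Phi>0 + real T * \<kappa>) + \<kappa> \<le> (1 + q) ^ Suc T * (\<Phi>0 + real (Suc T) * \<kappa>)"
      by (simp only: of_nat_Suc distrib_left distrib_right mult_1_left)
  qed
  finally show ?case .
qed

lemma lipschitz_clients: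
  fixes S :: "('l::finite, 'e::finite) shape" and fs :: "'c::finite \<Rightarrow> real ^ 'e \<Rightarrow> real"
  assumes "valid_shape S" "\<And>j. layer_smooth S (fs j) (L j)"
  obtains K where "0 \<le> K" "\<And>j X Y. norm (grad (fs j) X - grad (fs j) Y) \<le> K * norm (X - Y)"
proof -
  have "\<exists>A. \<forall>j. 0 \<le> A j \<and> (\<forall>X Y. norm (grad (fs j) X - grad (fs j) Y) \<le> A j * norm (X - Y))"
    using layer_smooth_imp_lipschitz[OF assms] by (intro choice allI) metis
  then obtain A where A: "\<And>j. 0 \<le> A j"
    "\<And>j X Y. norm (grad (fs j) X - grad (fs j) Y) \<le> A j * norm (X - Y)" by blast
  show thesis
  proof (rule that)
    show "0 \<le> (\<Sum>j\<in>UNIV. A j)" using A(1) by (simp add: sum_nonneg)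
    fix j :: 'c and X Y :: "real ^ 'e"
    have "A j \<le> (\<Sum>j\<in>UNIV. A j)" using A(1) by (intro member_le_sum) auto
    then have "A j * norm (X - Y) \<le> (\<Sum>j\<in>UNIV. A j) * norm (X - Y)" by (rule mult_right_mono) simp
    with A(2) show "norm (grad (fs j) X - grad (fs j) Y) \<le> (\<Sum>j\<in>UNIV. A j) * norm (X - Y)"
      by (rule order_trans)
  qed
qed

lemma positive_ratio_bounds:
  fixes \<rho> :: "'l::finite \<Rightarrow> real"
  assumes "\<And>i. 0 < \<rho> i"
  obtains \<rho>min \<rho>max where "0 < \<rho>min" "\<And>i. \<rho>min \<le> \<rho> i" "\<And>i. \<rho> i \<le> \<rho>max"
proof (rule that)
  show "0 < Min (range \<rho>)" using assms by simp
  show "Min (range \<rho>) \<le> \<rho> i" "\<rho> i \<le> Max (range \<rho>)" for i by simp_all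
qed

lemma measurable_rate_nuclear_norm: "measurable_rate S (\<lambda>i G. \<gamma> i * nuclear_norm G) M"
  unfolding measurable_rate_def using borel_measurable_nuclear_norm_block by (intro allI impI) measurable

lemma measurable_rate_const: "measurable_rate S (\<lambda>i G. \<eta> i) M"
  unfolding measurable_rate_def by simp

context stochastic_clients
begin

lemma borel_measurable_average [measurable]: "average fs \<in> borel_measurable borel"
proof (intro borel_measurable_continuous_onI)
  have "isCont (average fs) X" for X
    using average_differentiable[of fs] diff differentiable_imp_continuous_within[of "average fs" X UNIV] by simp
  then show "continuous_on UNIV (average fs)" by (simp add: continuous_on_eq_continuous_at)
qed

lemma borel_measurable_grad_average [measurable]: "grad (average fs) \<in> borel_measurable borel"
proof -
  have "grad (average fs) = (\<lambda>X. (1 / real CARD('c)) *\<^sub>R (\<Sum>j\<in>UNIV. grad (fs j) X))"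
    by (simp add: grad_average[OF diff] fun_eq_iff)
  then show ?thesis by simp
qed

lemma smooth_expected_gradients:
  fixes \<rho> :: "'l \<Rightarrow> real"
  defines "\<delta> \<equiv> 1 / (2 * real CARD('e))"
  assumes lower: "\<And>X. fstar \<le> average fs X"
    and lip: "\<And>j X Y. norm (grad (fs j) X - grad (fs j) Y) \<le> K * norm (X - Y)" and K: "0 \<le> K"
    and \<gamma>: "\<gamma> = \<epsilon> * \<beta>" and \<beta>: "0 < \<beta>" "\<beta> \<le> 1"
    and \<rho>: "0 < \<rho>min" "\<And>i. \<rho>min \<le> \<rho> i" "\<And>i. \<rho> i \<le> \<rho>max"
    and small: "4 * real CARD('c) * K * real CARD('e) * \<rho>max\<^sup>2 * \<gamma> \<le> \<rho>min"
    and s: "0 < s" "s \<le> 1" "s \<le> \<rho>min / 4"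
    and c: "8 \<le> c" "\<rho>max * real CARD('e) \<le> c" "4 * real CARD('c) * K\<^sup>2 \<le> c" "2 / \<delta> \<le> c"
      "8 * (real CARD('e))\<^sup>2 * \<rho>max\<^sup>2 \<le> c" "(real CARD('e))\<^sup>2 * \<rho>max\<^sup>2 / \<delta> \<le> c"
    and \<epsilon>: "0 < \<epsilon>" "\<epsilon>\<^sup>2 \<le> s * \<delta>\<^sup>2 / (28 * c ^ 6)"
  shows "(\<Sum>t<T. \<integral>\<^sup>+ \<omega>. ennreal (s / 8 * \<gamma> * (norm (grad (average fs)
        (iterate S meth X0 (1 - \<beta>) (\<lambda>i G. \<gamma> * \<rho> i * nuclear_norm G) R t \<omega>)))\<^sup>2) \<partial>base R)
    \<le> ennreal (average fs X0 - fstar + 6 * c ^ 3 * \<epsilon> / \<delta> * (\<Sum>j\<in>UNIV. (norm (grad (fs j) X0))\<^sup>2)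
        + real T * (real CARD('c) * \<sigma>\<^sup>2 * (18 * c ^ 3 * \<epsilon> / \<delta> * \<beta>\<^sup>2)))"
proof -
  define lr where "lr = (\<lambda>(i::'l) G. \<gamma> * \<rho> i * nuclear_norm G)"
  define st where "st = muon_state S meth X0 (1 - \<beta>) lr R"
  define P where "P = 6 * c ^ 3 * \<gamma> / (\<delta> * \<beta>)"
  define Q where "Q = 2 * c\<^sup>2 * \<gamma> / \<delta>"
  define Z where "Z = 8 * c ^ 5 * \<gamma> / (\<delta>\<^sup>2 * \<beta>\<^sup>2)"
  have c1: "1 \<le> c" using c by simp
  have "1 \<le> real CARD('e)" by (simp add: Suc_leI)
  then have "1 \<le> 2 * real CARD('e)" by linarith
  then have \<delta>: "0 < \<delta>" "\<delta> \<le> 1" unfolding \<delta>_def by simp_all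
  have \<gamma>0: "0 < \<gamma>" using \<gamma> \<epsilon> \<beta> by simp
  note weights = lyapunov_smooth_weights[OF c1 \<delta> \<beta> s(1) \<epsilon>, folded \<gamma>, folded P_def Q_def Z_def]
  define p where "p = P * (1 + \<beta>) + 2 * c\<^sup>2 * \<gamma>"
  define q where "q = (Q + 2 * c\<^sup>2 * \<gamma>) * c * \<beta>\<^sup>2"
  have p: "0 \<le> p" using weights \<beta> \<gamma>0 by (simp add: p_def)
  have q: "0 \<le> q" using weights c1 \<gamma>0 by (simp add: q_def)
  \<comment> \<open>Gradients are sampled at the broadcast model, which under a compressed downlink
    differs from the iterate; the noise is centred there.\<close>
  define W where "W t \<omega> = broadcast (st t \<omega>)" for t \<omega>
  define \<Phi> where "\<Phi> t \<omega> = average fs (model (st t \<omega>)) - fstar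
      + P * sq_sum (mom_err fs (st t \<omega>))
      + Q * sq_sum (est_err (st t \<omega>)) + Z * (norm (lag (st t \<omega>)))\<^sup>2" for t \<omega>
  define U where "U t \<omega> = average fs (model (st t \<omega>)) - fstar
      + Q * sq_sum (est_err (st t \<omega>)) + Z * (norm (lag (st t \<omega>)))\<^sup>2
      + q * sq_sum (mom_err fs (st t \<omega>))" for t \<omega>
  define H where "H t \<omega> = s / 8 * \<gamma> * (norm (grad (average fs) (model (st t \<omega>))))\<^sup>2" for t \<omega>
  have st_meas: "state_measurable (past R t) (st t)" for t
    unfolding st_def by (rule muon_state_measurable) (simp add: lr_def measurable_rate_nuclear_norm)
  note [measurable] = state_measurableD[OF st_meas]
  have mom_meas [measurable]: "(\<lambda>\<omega>. mom_err fs (st t \<omega>) j) \<in> borel_measurable (past R t)" for t j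
    unfolding mom_err_def by measurable
  have W_meas: "W t \<in> borel_measurable (past R t)" for t unfolding W_def[abs_def] by measurable
  have U_meas: "U t \<in> borel_measurable (past R t)" for t
    unfolding U_def[abs_def] est_err_def lag_def by measurable
  have \<Phi>_meas: "\<Phi> t \<in> borel_measurable (past R t)" for t
    unfolding \<Phi>_def[abs_def] est_err_def lag_def by measurable
  have H_meas: "H t \<in> borel_measurable (past R t)" for t
    unfolding H_def[abs_def] by measurable
  have \<Phi>0: "0 \<le> \<Phi> t \<omega>" for t \<omega>
    unfolding \<Phi>_def using weights lower by (intro add_nonneg_nonneg mult_nonneg_nonneg sum_nonneg) auto
  have U0: "0 \<le> U t \<omega>" for t \<omega>
    unfolding U_def using weights lower q by (intro add_nonneg_nonneg mult_nonneg_nonneg sum_nonneg) auto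
  have H0: "0 \<le> H t \<omega>" for t \<omega> using s \<gamma>0 by (simp add: H_def)
  have step: "\<Phi> (Suc t) \<omega> + H t \<omega> \<le> U t \<omega>
      + p * (\<Sum>j\<in>UNIV. (norm ((1 - \<beta>) *\<^sub>R mom_err fs (st t \<omega>) j + \<beta> *\<^sub>R noise W t j \<omega>))\<^sup>2)
      + q * (\<Sum>j\<in>UNIV. (norm (noise W t j \<omega>))\<^sup>2)" if \<omega>: "\<omega> \<in> space (base R)" for t \<omega>
  proof -
    interpret r: muon_round S meth fs "stoch_grad R" "1 - \<beta>" lr "\<lambda>j. sample R (Suc t) j \<omega>"
      "\<lambda>j. up_sign R (Suc t) j \<omega>" "down_sign R (Suc t) \<omega>" "st t \<omega>"
      unfolding st_def by (rule muon_round_state[OF \<omega>])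
    have \<delta>_eq: "r.\<delta> = \<delta>" unfolding r.\<delta>_def \<delta>_def ..
    have st': "r.st' = st (Suc t) \<omega>" unfolding r.st'_def by (simp add: st_def)
    have n: "r.noise_at = (\<lambda>j. noise W t j \<omega>)" unfolding r.noise_at_def[abs_def] by (simp add: noise_def W_def fun_eq_iff)
    have lr_eq: "lr i M = \<gamma> * \<rho> i * nuclear_norm M" for i M by (simp add: lr_def)
    show ?thesis
      using r.smooth_round_bound[where fstar = fstar and \<rho> = \<rho>, OF lip K lr_eq \<gamma>0 \<rho> small refl \<beta> s c(1,2,3) c(4)[folded \<delta>_eq] c(5) c(6)[folded \<delta>_eq]
          weights(6,7,8) weights(1,2)[folded \<delta>_eq] weights(3)]
      by (simp add: \<Phi>_def H_def U_def p_def q_def st' n r.fresh_err_def)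
  qed
  define \<kappa> where "\<kappa> = real CARD('c) * \<sigma>\<^sup>2 * (18 * c ^ 3 * \<epsilon> / \<delta> * \<beta>\<^sup>2)"
  have "expect (\<Phi> (Suc t)) + expect (H t)
      \<le> ennreal (1 + 0) * expect (\<Phi> t) + ennreal \<kappa>" for t
  proof -
    have "expect (\<Phi> (Suc t)) + expect (H t)
        = (\<integral>\<^sup>+ \<omega>. ennreal (\<Phi> (Suc t) \<omega> + H t \<omega>) \<partial>base R)"
      using measurable_past_base[OF \<Phi>_meas] measurable_past_base[OF H_meas]
      by (simp add: ennreal_plus \<Phi>0 H0 nn_integral_add)
    also have "\<dots> \<le> (\<integral>\<^sup>+ \<omega>. ennreal (U t \<omega> + p * (\<Sum>j\<in>UNIV. (norm ((1 - \<beta>) *\<^sub>R mom_err fs (st t \<omega>) j))\<^sup>2)) \<partial>base R)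
        + ennreal (real CARD('c) * \<sigma>\<^sup>2 * (p * \<beta>\<^sup>2 + q))"
      by (rule expectation_round_le[where W = W and t = t]) (use W_meas U_meas U0 p q step in \<open>auto\<close>)
    also have "\<dots> \<le> expect (\<Phi> t) + ennreal \<kappa>"
    proof (intro add_mono nn_integral_mono ennreal_leI)
      fix \<omega>
      let ?B = "\<Sum>j\<in>UNIV. (norm (mom_err fs (st t \<omega>) j))\<^sup>2"
      \<comment> \<open>Here the potential closes: without its noise the fresh error is the momentum
        error scaled by 1 - \<beta>, and all weights on it add up to at most
        \<open>P\<close>.\<close>
      have "(p * (1 - \<beta>)\<^sup>2 + q) * ?B \<le> P * ?B"
        using weights(4) by (intro mult_right_mono sum_nonneg) (auto simp: p_def q_def)
      then show "U t \<omega> + p * (\<Sum>j\<in>UNIV. (norm ((1 - \<beta>) *\<^sub>R mom_err fs (st t \<omega>) j))\<^sup>2) \<le> \<Phi> t \<omega>"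
        by (simp add: U_def \<Phi>_def power_mult_distrib distrib_right mult.assoc flip: sum_distrib_left)
      show "real CARD('c) * \<sigma>\<^sup>2 * (p * \<beta>\<^sup>2 + q) \<le> \<kappa>"
        unfolding \<kappa>_def using weights(5) by (intro mult_left_mono) (auto simp: p_def q_def)
    qed
    finally show ?thesis by simp
  qed
  \<comment> \<open>The initial state is deterministic, so \<Phi> at round 0 is a constant function;
    \<open>undefined\<close> is an arbitrary point at which to read off its value.\<close>
  then have 1: "expect (\<Phi> T) + (\<Sum>t<T. \<integral>\<^sup>+ \<omega>. ennreal (H t \<omega>) \<partial>base R)
      \<le> ennreal ((1 + 0) ^ T * (\<Phi> 0 undefined + real T * \<kappa>))"
  proof (rule lyapunov_telescope)
    show "0 \<le> \<kappa>" using c1 \<epsilon> \<delta> by (simp add: \<kappa>_def)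
    have const: "\<Phi> 0 \<omega> = \<Phi> 0 undefined" for \<omega> by (simp add: \<Phi>_def st_def)
    have "expect (\<Phi> 0) = (\<integral>\<^sup>+ \<omega>. ennreal (\<Phi> 0 undefined) \<partial>base R)"
      by (intro nn_integral_cong arg_cong[where f = ennreal] const)
    then show "expect (\<Phi> 0) \<le> ennreal (\<Phi> 0 undefined)"
      by (simp add: emeasure_space_1)
  qed (use \<Phi>0 in auto)
  \<comment> \<open>Momentum and estimates start at 0 and the broadcast is exact, so the only
    initial error is minus the gradient at \<open>X0\<close>. Its weight \<open>P\<close> equals
    \<open>6 * c ^ 3 * \<epsilon> / \<delta>\<close>, independent of \<beta> and hence of T.\<close>
  have \<Phi>_init: "\<Phi> 0 undefined = average fs X0 - fstar + 6 * c ^ 3 * \<epsilon> / \<delta> * (\<Sum>j\<in>UNIV. (norm (grad (fs j) X0))\<^sup>2)"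
    using \<beta> by (simp add: \<Phi>_def st_def mom_err_def est_err_def lag_def P_def \<gamma>)
  have 2: "(\<Sum>t<T. \<integral>\<^sup>+ \<omega>. ennreal (H t \<omega>) \<partial>base R)
      \<le> expect (\<Phi> T) + (\<Sum>t<T. \<integral>\<^sup>+ \<omega>. ennreal (H t \<omega>) \<partial>base R)"
    by simp
  from order_trans[OF 2 1] show ?thesis
    by (simp add: \<Phi>_init H_def st_def lr_def \<kappa>_def iterate_def)
qed

end

text \<open>All constants are fixed before T and before the random sources; only \<gamma> and \<mu>
  depend on T. The ratios \<open>\<rho>\<close> are already present, so that equal and unequal layer
  constants both follow, and \<open>0 \<le> C\<close> permits rescaling the bound.\<close>

lemma smooth_convergence_rate:
  fixes S :: "('l::finite, 'e::finite) shape" and fs :: "'c::finite \<Rightarrow> real ^ 'e \<Rightarrow> real"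
    and \<rho> :: "'l \<Rightarrow> real"
  assumes shape: "valid_shape S" and C1: "\<And>j. cont_differentiable (fs j)"
    and lower: "\<And>X. fstar \<le> average fs X"
    and smooth: "\<And>j. layer_smooth S (fs j) (L j)" and \<rho>: "\<And>i. 0 < \<rho> i"
  shows "\<exists>C\<ge>0. \<forall>T\<ge>1. \<exists>\<gamma>>0. \<exists>\<mu>\<in>{0..<1}. \<forall>R :: ('c, 'e, 's, 'w) stochastics. admissible S \<sigma> fs R \<longrightarrow>
    ennreal (1 / real T) * (\<Sum>t<T. \<integral>\<^sup>+ \<omega>. ennreal (nuclear_norm_sq S (grad (average fs)
        (iterate S meth X0 \<mu> (\<lambda>i G. \<gamma> * \<rho> i * nuclear_norm G) R t \<omega>))) \<partial>base R)
      \<le> ennreal (C * real T powr (- 1 / 2))"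
proof -
  obtain K where K: "0 \<le> K" and lip: "\<And>j X Y. norm (grad (fs j) X - grad (fs j) Y) \<le> K * norm (X - Y)"
    using lipschitz_clients[where S = S and fs = fs, OF shape smooth] by blast
  obtain \<rho>min \<rho>max where \<rho>b: "0 < \<rho>min" "\<And>i. \<rho>min \<le> \<rho> i" "\<And>i. \<rho> i \<le> \<rho>max"
    using positive_ratio_bounds[of \<rho>, OF \<rho>] by blast
  have \<rho>max: "0 < \<rho>max" using \<rho>b \<rho> less_le_trans by blast
  define N where "N = real CARD('c)"
  define E where "E = real CARD('e)"
  have E: "1 \<le> E" by (simp add: E_def Suc_leI)
  define \<delta> where "\<delta> = 1 / (2 * E)"
  have \<delta>: "0 < \<delta>" using E by (simp add: \<delta>_def)
  define s where "s = min 1 (\<rho>min / 4)"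
  have s: "0 < s" "s \<le> 1" "s \<le> \<rho>min / 4" using \<rho>b by (auto simp: s_def)
  \<comment> \<open>The sum of all quantities that \<open>c\<close> has to dominate in a
    round.\<close>
  define c where "c = 8 + \<rho>max * E + 4 * N * K\<^sup>2 + 2 / \<delta> + 8 * E\<^sup>2 * \<rho>max\<^sup>2 + E\<^sup>2 * \<rho>max\<^sup>2 / \<delta>"
  have nn: "0 \<le> \<rho>max * E" "0 \<le> 4 * N * K\<^sup>2" "0 \<le> 2 / \<delta>" "0 \<le> 8 * E\<^sup>2 * \<rho>max\<^sup>2" "0 \<le> E\<^sup>2 * \<rho>max\<^sup>2 / \<delta>"
    using \<rho>max E \<delta> by (auto simp: N_def)
  then have c: "8 \<le> c" "\<rho>max * E \<le> c" "4 * N * K\<^sup>2 \<le> c" "2 / \<delta> \<le> c" "8 * E\<^sup>2 * \<rho>max\<^sup>2 \<le> c" "E\<^sup>2 * \<rho>max\<^sup>2 / \<delta> \<le> c"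
    unfolding c_def by linarith+
  define b where "b = 4 * N * K * E * \<rho>max\<^sup>2"
  have b: "0 \<le> b" using K E by (simp add: b_def N_def)
  \<comment> \<open>The two bounds serve the weights of the potential and the second-order term of
    the descent; \<open>b + 1\<close> avoids a division by zero when \<open>K = 0\<close>.\<close>
  define \<epsilon> where "\<epsilon> = min (sqrt (s * \<delta>\<^sup>2 / (28 * c ^ 6))) (\<rho>min / (b + 1))"
  have x: "0 < s * \<delta>\<^sup>2 / (28 * c ^ 6)" using s \<delta> c by (intro divide_pos_pos mult_pos_pos) auto
  then have \<epsilon>: "0 < \<epsilon>" using \<rho>b b by (simp add: \<epsilon>_def)
  have \<epsilon>2: "\<epsilon>\<^sup>2 \<le> s * \<delta>\<^sup>2 / (28 * c ^ 6)"
  proof -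
    have "\<epsilon>\<^sup>2 \<le> (sqrt (s * \<delta>\<^sup>2 / (28 * c ^ 6)))\<^sup>2" using \<epsilon> by (intro power_mono) (auto simp: \<epsilon>_def)
    then show ?thesis using x by simp
  qed
  have \<epsilon>b: "b * \<epsilon> \<le> \<rho>min"
  proof -
    have "(b + 1) * \<epsilon> \<le> (b + 1) * (\<rho>min / (b + 1))" using b by (intro mult_left_mono) (auto simp: \<epsilon>_def)
    then have "(b + 1) * \<epsilon> \<le> \<rho>min" using b by simp
    then show ?thesis using \<epsilon> by (simp add: distrib_right)
  qed
  define C0 where "C0 = average fs X0 - fstar + 6 * c ^ 3 * \<epsilon> / \<delta> * (\<Sum>j\<in>UNIV. (norm (grad (fs j) X0))\<^sup>2)
      + N * \<sigma>\<^sup>2 * (18 * c ^ 3 * \<epsilon> / \<delta>)"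
  have C0: "0 \<le> C0"
    unfolding C0_def using lower[of X0] c \<epsilon> \<delta> by (intro add_nonneg_nonneg mult_nonneg_nonneg sum_nonneg) (auto simp: N_def)
  define C where "C = E * (8 / (s * \<epsilon>)) * C0"
  have C: "0 \<le> C" using C0 s \<epsilon> E by (simp add: C_def)
  have "\<exists>\<gamma>>0. \<exists>\<mu>\<in>{0..<1}. \<forall>R :: ('c, 'e, 's, 'w) stochastics. admissible S \<sigma> fs R \<longrightarrow>
    ennreal (1 / real T) * (\<Sum>t<T. \<integral>\<^sup>+ \<omega>. ennreal (nuclear_norm_sq S (grad (average fs)
        (iterate S meth X0 \<mu> (\<lambda>i G. \<gamma> * \<rho> i * nuclear_norm G) R t \<omega>))) \<partial>base R)
      \<le> ennreal (C * real T powr (- 1 / 2))" if T: "1 \<le> T" for T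
  proof -
    \<comment> \<open>\<open>real T * \<beta>\<^sup>2 = 1\<close> keeps the accumulated noise
      bounded. For \<open>T = 1\<close> this gives \<beta> = 1, that is \<mu> = 0, which is still
      admissible.\<close>
    define \<beta> where "\<beta> = real T powr (- 1 / 2)"
    have \<beta>: "0 < \<beta>" "\<beta> \<le> 1"
      using T powr_mono[of "- 1 / 2" 0 "real T"] by (auto simp: \<beta>_def)
    have \<beta>2: "real T * \<beta>\<^sup>2 = 1"
      using T by (simp add: \<beta>_def power2_eq_square powr_minus_divide flip: powr_add)
    define \<gamma> where "\<gamma> = \<epsilon> * \<beta>"
    have \<gamma>: "0 < \<gamma>" using \<epsilon> \<beta> by (simp add: \<gamma>_def)
    have "ennreal (1 / real T) * (\<Sum>t<T. \<integral>\<^sup>+ \<omega>. ennreal (nuclear_norm_sq S (grad (average fs)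
        (iterate S meth X0 (1 - \<beta>) (\<lambda>i G. \<gamma> * \<rho> i * nuclear_norm G) R t \<omega>))) \<partial>base R)
      \<le> ennreal (C * real T powr (- 1 / 2))" if adm: "admissible S \<sigma> fs R" for R :: "('c, 'e, 's, 'w) stochastics"
    proof -
      interpret stochastic_clients S \<sigma> fs R using shape C1 adm by unfold_locales
      let ?X = "iterate S meth X0 (1 - \<beta>) (\<lambda>i G. \<gamma> * \<rho> i * nuclear_norm G) R"
      let ?h = "\<lambda>t \<omega>. s / 8 * \<gamma> * (norm (grad (average fs) (?X t \<omega>)))\<^sup>2"
      have "b * \<gamma> \<le> \<rho>min"
      proof -
        have "b * \<epsilon> * \<beta> \<le> b * \<epsilon> * 1" using \<beta> b \<epsilon> by (intro mult_left_mono) auto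
        then show ?thesis using \<epsilon>b by (simp add: \<gamma>_def mult.assoc)
      qed
      then have small: "4 * real CARD('c) * K * real CARD('e) * \<rho>max\<^sup>2 * \<gamma> \<le> \<rho>min"
        by (simp add: b_def N_def E_def)
      have "(\<Sum>t<T. \<integral>\<^sup>+ \<omega>. ennreal (?h t \<omega>) \<partial>base R)
        \<le> ennreal (average fs X0 - fstar + 6 * c ^ 3 * \<epsilon> / \<delta> * (\<Sum>j\<in>UNIV. (norm (grad (fs j) X0))\<^sup>2)
          + real T * (real CARD('c) * \<sigma>\<^sup>2 * (18 * c ^ 3 * \<epsilon> / \<delta> * \<beta>\<^sup>2)))"
        unfolding \<delta>_def E_def
        by (rule smooth_expected_gradients[OF lower lip K \<gamma>_def \<beta> \<rho>b small s c[unfolded E_def N_def \<delta>_def] \<epsilon>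
            \<epsilon>2[unfolded \<delta>_def E_def]])
      also have "real T * (real CARD('c) * \<sigma>\<^sup>2 * (18 * c ^ 3 * \<epsilon> / \<delta> * \<beta>\<^sup>2))
          = (real T * \<beta>\<^sup>2) * (N * \<sigma>\<^sup>2 * (18 * c ^ 3 * \<epsilon> / \<delta>))" by (simp add: N_def)
      finally have sum: "(\<Sum>t<T. \<integral>\<^sup>+ \<omega>. ennreal (?h t \<omega>) \<partial>base R) \<le> ennreal C0"
        unfolding \<beta>2 C0_def by simp
      have X_meas: "(\<lambda>\<omega>. ?X t \<omega>) \<in> borel_measurable (base R)" for t
        unfolding iterate_def
        by (rule measurable_past_base[OF state_measurableD(1)[OF muon_state_measurable]])
          (rule measurable_rate_nuclear_norm)
      have h_meas: "(\<lambda>\<omega>. ?h t \<omega>) \<in> borel_measurable (base R)" for t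
        using X_meas by measurable
      have "(\<integral>\<^sup>+ \<omega>. ennreal (nuclear_norm_sq S (grad (average fs) (?X t \<omega>))) \<partial>base R)
          \<le> ennreal (E * (8 / (s * \<gamma>))) * (\<integral>\<^sup>+ \<omega>. ennreal (?h t \<omega>) \<partial>base R)" for t
      proof -
        have "(\<integral>\<^sup>+ \<omega>. ennreal (nuclear_norm_sq S (grad (average fs) (?X t \<omega>))) \<partial>base R)
            \<le> (\<integral>\<^sup>+ \<omega>. ennreal (E * (8 / (s * \<gamma>))) * ennreal (?h t \<omega>) \<partial>base R)"
        proof (rule nn_integral_mono)
          fix \<omega>
          have "E * (8 / (s * \<gamma>)) * ?h t \<omega> = E * (norm (grad (average fs) (?X t \<omega>)))\<^sup>2"
            using s \<gamma> by simp
          then have "nuclear_norm_sq S (grad (average fs) (?X t \<omega>)) \<le> E * (8 / (s * \<gamma>)) * ?h t \<omega>"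
            using nuclear_norm_sq_le_norm_sq[OF shape] by (simp add: E_def)
          then show "ennreal (nuclear_norm_sq S (grad (average fs) (?X t \<omega>)))
              \<le> ennreal (E * (8 / (s * \<gamma>))) * ennreal (?h t \<omega>)"
            using s \<gamma> E by (subst ennreal_mult[symmetric]) (auto intro!: ennreal_leI)
        qed
        also have "\<dots> = ennreal (E * (8 / (s * \<gamma>))) * (\<integral>\<^sup>+ \<omega>. ennreal (?h t \<omega>) \<partial>base R)"
          by (intro nn_integral_cmult measurable_compose[OF h_meas measurable_ennreal])
        finally show ?thesis .
      qed
      then have "(\<Sum>t<T. \<integral>\<^sup>+ \<omega>. ennreal (nuclear_norm_sq S (grad (average fs) (?X t \<omega>))) \<partial>base R)
          \<le> (\<Sum>t<T. ennreal (E * (8 / (s * \<gamma>))) * (\<integral>\<^sup>+ \<omega>. ennreal (?h t \<omega>) \<partial>base R))"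
        by (intro sum_mono)
      also have "\<dots> = ennreal (E * (8 / (s * \<gamma>))) * (\<Sum>t<T. \<integral>\<^sup>+ \<omega>. ennreal (?h t \<omega>) \<partial>base R)"
        by (simp add: sum_distrib_left)
      also have "\<dots> \<le> ennreal (E * (8 / (s * \<gamma>))) * ennreal C0"
        by (intro mult_left_mono sum) simp
      finally have "ennreal (1 / real T) * (\<Sum>t<T. \<integral>\<^sup>+ \<omega>. ennreal (nuclear_norm_sq S (grad (average fs) (?X t \<omega>))) \<partial>base R)
          \<le> ennreal (1 / real T) * (ennreal (E * (8 / (s * \<gamma>))) * ennreal C0)"
        by (intro mult_left_mono) auto
      also have "\<dots> = ennreal (1 / real T * (E * (8 / (s * \<gamma>)) * C0))"
        using C0 s \<gamma> E by (simp flip: ennreal_mult)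
      \<comment> \<open>Here the rate appears: 1 / (T \<gamma>) equals
        \<open>\<beta>\<^sup>2 / (\<epsilon> * \<beta>)\<close>, which leaves one factor
        \<beta>.\<close>
      also have "1 / real T * (E * (8 / (s * \<gamma>)) * C0) = C * \<beta>"
      proof -
        have "1 / real T = \<beta>\<^sup>2" using \<beta>2 T by (simp add: field_simps)
        then show ?thesis using \<beta> by (simp add: C_def \<gamma>_def power2_eq_square)
      qed
      finally show ?thesis by (simp add: \<beta>_def)
    qed
    then show ?thesis using \<gamma> \<beta> by (intro exI[of _ \<gamma>] bexI[of _ "1 - \<beta>"] conjI allI impI) auto
  qed
  then show ?thesis using C by blast
qed

section \<open>Generalized smooth functions\<close>

text \<open>The reference value \<open>m\<close> is the mean of the client lower bounds, so the gap
  to \<open>m\<close> is the mean of the nonnegative client gaps and each client gap is at most the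
  number of clients times it. A single gap thereby controls all client gradients, and the Lipschitz
  constants become affine in it.\<close>

lemma generalized_smooth_clients:
  fixes S :: "('l::finite, 'e::finite) shape" and fs :: "'c::finite \<Rightarrow> real ^ 'e \<Rightarrow> real"
    and fcstar :: "'c \<Rightarrow> real"
  assumes S: "valid_shape S" and diff: "\<And>j X. fs j differentiable (at X)"
    and smooth: "\<And>j. layer_L0_L1_smooth S (fs j) (L0 j) (L1 j)" and below: "\<And>j X. fcstar j \<le> fs j X"
  defines "m \<equiv> (\<Sum>j\<in>UNIV. fcstar j) / real CARD('c)"
  obtains a where "0 \<le> a" "\<And>X. m \<le> average fs X"
    "\<And>j X Y. norm (grad (fs j) X - grad (fs j) Y) \<le> a * (1 + (average fs X - m)) * norm (X - Y)"
proof -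
  have "\<exists>AB. 0 \<le> fst AB \<and> 0 \<le> snd AB \<and> (\<forall>X Y. norm (grad (fs j) X - grad (fs j) Y)
      \<le> (fst AB + snd AB * norm (grad (fs j) X)) * norm (X - Y))" for j
    using layer_L0_L1_smooth_imp_norm[OF S smooth[of j]] by (metis fst_conv snd_conv)
  then obtain AB where AB: "\<And>j. 0 \<le> fst (AB j)" "\<And>j. 0 \<le> snd (AB j)"
    "\<And>j X Y. norm (grad (fs j) X - grad (fs j) Y) \<le> (fst (AB j) + snd (AB j) * norm (grad (fs j) X)) * norm (X - Y)"
    by metis
  define A where "A j = fst (AB j)" for j
  define B where "B j = snd (AB j)" for j
  have A: "0 \<le> A j" and B: "0 \<le> B j"
    and lip: "norm (grad (fs j) X - grad (fs j) Y) \<le> (A j + B j * norm (grad (fs j) X)) * norm (X - Y)" for j X Y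
    using AB by (auto simp: A_def B_def)
  let ?N = "real CARD('c)"
  have N: "0 < ?N" by simp
  have gap: "average fs X - m = (\<Sum>j\<in>UNIV. fs j X - fcstar j) / ?N" for X
    by (simp add: average_def m_def sum_subtractf diff_divide_distrib)
  have gap0: "0 \<le> average fs X - m" for X
    unfolding gap using below by (intro divide_nonneg_nonneg sum_nonneg) auto
  \<comment> \<open>Obtained by inserting the gradient bound into
    \<open>A j + B j * norm (grad (fs j) X)\<close> and bounding both 1 and the gap by 1 plus the
    gap.\<close>
  define k where "k j = A j + B j * A j + B j * (4 * (B j + 1)) * ?N" for j
  have k: "0 \<le> k j" for j using A B by (simp add: k_def)
  have bound: "norm (grad (fs j) X - grad (fs j) Y) \<le> (\<Sum>j\<in>UNIV. k j) * (1 + (average fs X - m)) * norm (X - Y)" for j X Y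
  proof -
    have "fs j X - fcstar j \<le> (\<Sum>j\<in>UNIV. fs j X - fcstar j)"
      using below by (intro member_le_sum) auto
    then have g: "fs j X - fcstar j \<le> ?N * (average fs X - m)" using N by (simp add: gap)
    have "norm (grad (fs j) X) \<le> 4 * (B j + 1) * (fs j X - fcstar j) + A j"
      by (rule norm_grad_le_of_bounded_below[OF diff below A B lip])
    also have "\<dots> \<le> 4 * (B j + 1) * (?N * (average fs X - m)) + A j"
      using g B[of j] by (intro add_right_mono mult_left_mono) auto
    finally have "A j + B j * norm (grad (fs j) X) \<le> A j + B j * (4 * (B j + 1) * (?N * (average fs X - m)) + A j)"
      using B by (intro add_left_mono mult_left_mono) auto
    also have "\<dots> = (A j + B j * A j) * 1 + B j * (4 * (B j + 1)) * ?N * (average fs X - m)"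
      by (simp add: algebra_simps)
    also have "\<dots> \<le> (A j + B j * A j) * (1 + (average fs X - m)) + B j * (4 * (B j + 1)) * ?N * (1 + (average fs X - m))"
      using gap0 A[of j] B[of j] by (intro add_mono mult_left_mono) auto
    also have "\<dots> = k j * (1 + (average fs X - m))" by (simp add: k_def distrib_right)
    also have "\<dots> \<le> (\<Sum>j\<in>UNIV. k j) * (1 + (average fs X - m))"
      using k gap0[of X] by (intro mult_right_mono member_le_sum) auto
    finally have "(A j + B j * norm (grad (fs j) X)) * norm (X - Y)
        \<le> (\<Sum>j\<in>UNIV. k j) * (1 + (average fs X - m)) * norm (X - Y)" by (rule mult_right_mono) simp
    with lip show ?thesis by (rule order_trans)
  qed
  show thesis
  proof (rule that)
    show "0 \<le> (\<Sum>j\<in>UNIV. k j)" using k by (simp add: sum_nonneg)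
    show "m \<le> average fs X" for X using gap0[of X] by simp
  qed (rule bound)
qed

context muon_round
begin

lemma norm_move_constant_le:
  assumes lr: "\<And>i M. lr i M = \<eta> * \<rho> i" and \<rho>: "\<And>i. 0 < \<rho> i" "\<And>i. \<rho> i \<le> \<rho>max" and \<eta>: "0 < \<eta>"
  shows "norm move \<le> real CARD('e) * real CARD('l) * \<rho>max * \<eta>"
    and "(norm move)\<^sup>2 \<le> real CARD('e) * real CARD('l) * \<rho>max\<^sup>2 * \<eta>\<^sup>2"
proof -
  let ?E = "real CARD('e)" and ?L = "real CARD('l)"
  have "(norm move)\<^sup>2 \<le> ?E * (\<Sum>i\<in>UNIV. (\<eta> * \<rho> i)\<^sup>2)"
    unfolding move_def using norm_muon_direction_sq_le[OF shape, of lr "server_est st'"] by (simp add: lr)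
  also have "\<dots> \<le> ?E * (\<Sum>i\<in>(UNIV :: 'l set). (\<eta> * \<rho>max)\<^sup>2)"
    using \<rho> \<eta> by (intro mult_left_mono sum_mono power_mono) (auto simp: less_imp_le)
  finally show sq: "(norm move)\<^sup>2 \<le> ?E * ?L * \<rho>max\<^sup>2 * \<eta>\<^sup>2" by (simp add: power_mult_distrib mult_ac)
  have EL: "1 \<le> ?E" "1 \<le> ?L" by (simp_all add: Suc_leI)
  then have "?E * ?L \<le> (?E * ?L)\<^sup>2"
    using mult_mono[OF EL] by (simp add: power2_eq_square mult_le_cancel_left1)
  then have "?E * ?L * (\<rho>max\<^sup>2 * \<eta>\<^sup>2) \<le> (?E * ?L)\<^sup>2 * (\<rho>max\<^sup>2 * \<eta>\<^sup>2)" by (rule mult_right_mono) simp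
  with sq have "(norm move)\<^sup>2 \<le> (?E * ?L * \<rho>max * \<eta>)\<^sup>2" by (simp add: power_mult_distrib mult.assoc)
  moreover have "0 < \<rho>max" using \<rho> less_le_trans by blast
  ultimately show "norm move \<le> ?E * ?L * \<rho>max * \<eta>"
    using \<eta> by (rule_tac power2_le_imp_le) (assumption, simp)
qed

text \<open>With a rate independent of the estimate the duality pairing is of first order, so the
  decrease and the estimation error enter linearly. The constant \<open>K\<close> is local: it is
  required only from the current model.\<close>

lemma constant_rate_descent:
  assumes lip: "\<And>j Y. norm (grad (fs j) Y - grad (fs j) (model st)) \<le> K * norm (Y - model st)" and K: "0 \<le> K"
    and lr: "\<And>i M. lr i M = \<eta> * \<rho> i" and \<eta>: "0 < \<eta>"
    and \<rho>: "0 < \<rho>min" "\<And>i. \<rho>min \<le> \<rho> i" "\<And>i. \<rho> i \<le> \<rho>max"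
  shows "average fs (model st') \<le> average fs (model st) - \<rho>min * \<eta> * norm (grad (average fs) (model st))
    + (\<rho>min + \<rho>max * real CARD('e) * real CARD('l)) * \<eta> * norm (grad (average fs) (model st) - server_est st')
    + real CARD('c) * K * (real CARD('e) * real CARD('l) * \<rho>max\<^sup>2 * \<eta>\<^sup>2)"
proof -
  let ?f = "average fs" and ?X = "model st" and ?g = "server_est st'" and ?E = "real CARD('e)" and ?L = "real CARD('l)"
  let ?\<nu> = "\<lambda>i. nuclear_norm (block S ?g i)" and ?e = "norm (grad ?f ?X - ?g)"
  have \<rho>0: "0 < \<rho> i" for i using \<rho>(1,2) less_le_trans by blast
  then have \<rho>max: "0 < \<rho>max" using \<rho>(3) less_le_trans by blast
  have "\<eta> * \<rho>min * norm ?g - \<eta> * \<rho>max * ?E * ?L * ?e \<le> inner (grad ?f ?X) move"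
  proof -
    have layerwise: "\<eta> * \<rho>min * ?\<nu> i - \<eta> * \<rho>max * ?E * ?e
        \<le> \<eta> * \<rho> i * finner (block S (grad ?f ?X) i) (polar (block S ?g i))" for i
    proof -
      have E1: "1 \<le> ?E" by (simp add: Suc_leI)
      then have "sqrt ?E \<le> ?E" by (intro real_le_lsqrt) (auto simp: power2_eq_square)
      moreover have "sqrt (frob2 (block S (grad ?f ?X - ?g) i)) \<le> ?e"
        using frob2_block_le[OF shape] by (intro real_le_lsqrt) auto
      ultimately have "sqrt ?E * sqrt (frob2 (block S (grad ?f ?X - ?g) i)) \<le> ?E * ?e"
        by (intro mult_mono) (auto simp: frob2_nonneg)
      then have "?\<nu> i - ?E * ?e \<le> finner (block S (grad ?f ?X) i) (polar (block S ?g i))"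
        using finner_block_polar_ge[OF shape, of ?g i "grad ?f ?X"] by linarith
      then have "\<eta> * \<rho> i * (?\<nu> i - ?E * ?e) \<le> \<eta> * \<rho> i * finner (block S (grad ?f ?X) i) (polar (block S ?g i))"
        using \<eta> \<rho>0[of i] by (intro mult_left_mono) auto
      moreover have "\<eta> * \<rho>min * ?\<nu> i \<le> \<eta> * \<rho> i * ?\<nu> i"
        using \<eta> \<rho> by (intro mult_right_mono mult_left_mono nuclear_norm_nonneg) auto
      moreover have "\<eta> * \<rho> i * (?E * ?e) \<le> \<eta> * \<rho>max * (?E * ?e)"
        using \<eta> \<rho> by (intro mult_right_mono mult_left_mono) auto
      ultimately show ?thesis by (simp add: algebra_simps)
    qed
    have "\<eta> * \<rho>min * norm ?g \<le> \<eta> * \<rho>min * (\<Sum>i\<in>UNIV. ?\<nu> i)"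
      using \<eta> \<rho> by (intro mult_left_mono norm_le_sum_nuclear_norm[OF shape]) auto
    then have "\<eta> * \<rho>min * norm ?g - \<eta> * \<rho>max * ?E * ?L * ?e
        \<le> (\<Sum>i\<in>UNIV. \<eta> * \<rho>min * ?\<nu> i - \<eta> * \<rho>max * ?E * ?e)"
      by (simp add: sum_subtractf sum_distrib_left mult_ac)
    also have "\<dots> \<le> (\<Sum>i\<in>UNIV. \<eta> * \<rho> i * finner (block S (grad ?f ?X) i) (polar (block S ?g i)))"
      using layerwise by (intro sum_mono)
    also have "\<dots> = inner (grad ?f ?X) move"
      unfolding move_def inner_muon_direction[OF shape] by (simp add: lr)
    finally show ?thesis .
  qed
  moreover have "\<eta> * \<rho>min * norm (grad ?f ?X) \<le> \<eta> * \<rho>min * norm ?g + \<eta> * \<rho>min * ?e"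
  proof -
    have "norm (grad ?f ?X) \<le> norm ?g + ?e" using norm_triangle_ineq[of ?g "grad ?f ?X - ?g"] by simp
    then have "\<eta> * \<rho>min * norm (grad ?f ?X) \<le> \<eta> * \<rho>min * (norm ?g + ?e)"
      using \<eta> \<rho> by (intro mult_left_mono) auto
    then show ?thesis by (simp add: distrib_left)
  qed
  moreover have "?f (model st') \<le> ?f ?X + inner (grad ?f ?X) (model st' - ?X)
      + real CARD('c) * K * (norm (model st' - ?X))\<^sup>2"
    by (rule descent_inequality[OF average_differentiable[OF diff]])
      (rule norm_grad_average_diff_le[OF diff lip])
  moreover have "real CARD('c) * K * (norm move)\<^sup>2 \<le> real CARD('c) * K * (?E * ?L * \<rho>max\<^sup>2 * \<eta>\<^sup>2)"
    using K by (intro mult_left_mono norm_move_constant_le[OF lr \<rho>0 \<rho>(3) \<eta>]) auto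
  ultimately show ?thesis by (simp add: model_step algebra_simps)
qed

text \<open>Since \<open>1 - 2 * \<delta> \<le> (1 - \<delta>)\<^sup>2\<close>, the contraction of
  squares is also one of norms, and the triangle inequality replaces Young's.\<close>

lemma norm_est_err_step_le:
  assumes \<mu>: "\<mu> \<le> 1"
  shows "norm (est_err st' j) \<le> (1 - \<delta>) * norm (est_err st j)
    + (1 - \<mu>) * (norm (noise_at j) + norm (mom_err fs st j))"
proof -
  define y where "y = (1 - \<mu>) *\<^sub>R (noise_at j - mom_err fs st j) - est_err st j"
  define x where "x = (1 - \<mu>) * (norm (noise_at j) + norm (mom_err fs st j))"
  have x0: "0 \<le> x" using \<mu> by (simp add: x_def)
  have "(norm (est_err st' j))\<^sup>2 \<le> (1 - 2 * \<delta>) * (norm y)\<^sup>2"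
    using compress_contraction[OF shape u, of j y] unfolding \<delta>(3) by (simp add: est_err_step y_def)
  also have "\<dots> \<le> (1 - \<delta>)\<^sup>2 * (norm y)\<^sup>2"
  proof (rule mult_right_mono)
    have "(1 - \<delta>)\<^sup>2 = 1 - 2 * \<delta> + \<delta>\<^sup>2" by (simp add: power2_diff)
    then show "1 - 2 * \<delta> \<le> (1 - \<delta>)\<^sup>2" by simp
  qed simp
  finally have "(norm (est_err st' j))\<^sup>2 \<le> ((1 - \<delta>) * norm y)\<^sup>2" by (simp add: power_mult_distrib)
  then have "norm (est_err st' j) \<le> (1 - \<delta>) * norm y"
    using \<delta> by (rule_tac power2_le_imp_le) (assumption, simp)
  also have "\<dots> \<le> (1 - \<delta>) * (x + norm (est_err st j))"
  proof (rule mult_left_mono)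
    have "norm y \<le> norm ((1 - \<mu>) *\<^sub>R (noise_at j - mom_err fs st j)) + norm (est_err st j)"
      unfolding y_def by (rule norm_triangle_ineq4)
    also have "norm ((1 - \<mu>) *\<^sub>R (noise_at j - mom_err fs st j)) = (1 - \<mu>) * norm (noise_at j - mom_err fs st j)"
      using \<mu> by (simp only: norm_scaleR abs_of_nonneg diff_ge_0_iff_ge)
    also have "(1 - \<mu>) * norm (noise_at j - mom_err fs st j) \<le> x"
      unfolding x_def using \<mu> by (intro mult_left_mono norm_triangle_ineq4) auto
    finally show "norm y \<le> x + norm (est_err st j)" by simp
  qed (use \<delta> in simp)
  also have "\<dots> \<le> x + (1 - \<delta>) * norm (est_err st j)"
    unfolding distrib_left using mult_right_mono[OF _ x0, of "1 - \<delta>" 1] \<delta>(1) by linarith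
  finally show ?thesis by (simp add: x_def)
qed

end

text \<open>\<open>F\<close>, \<open>E\<close> and \<open>H\<close> are the gap and the norms of the
  server error and of the gradient; \<open>h\<close>, \<open>a\<close>, \<open>\<nu>\<close> and
  \<open>n\<close> are the client sums of the norms of drift, estimation error, accumulated noise
  and new noise; \<open>v\<close> and \<open>n2\<close> are sums of squares. Each weight is the
  error's cost per round divided by its contraction: the drift costs \<tau>^3 and contracts by
  \<tau>^2, giving \<tau>; the estimation error costs \<tau>^3 and contracts by \<delta>; the
  squared noise costs \<tau>^2 and contracts by \<tau>^2. Everything left over is of order
  \<tau>^4.\<close>

lemma lyapunov_generalized_round:
  fixes F F' E H h h' a a' \<nu> \<nu>' v v' n n2 \<tau> N :: real
  assumes \<tau>: "0 < \<tau>" "\<tau> \<le> 1" and c: "1 \<le> c" and \<delta>: "0 < \<delta>" "\<delta> \<le> 1" and N: "0 \<le> N"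
    and pos: "0 \<le> F" "0 \<le> h" "0 \<le> a" "0 \<le> E" "0 \<le> \<nu>" "0 \<le> n"
    and F: "F' \<le> F - s * \<tau> ^ 3 * H + c * \<tau> ^ 3 * E + c * \<tau> ^ 6 * (1 + F)"
    and E: "E \<le> h + \<nu>' + a'"
    and a: "a' \<le> (1 - \<delta>) * a + \<tau>\<^sup>2 * (n + h + \<nu>)"
    and h: "h' \<le> (1 - \<tau>\<^sup>2) * h + c * \<tau> ^ 3 * (1 + F)"
    and \<nu>: "\<nu> \<le> v / \<tau> + N * \<tau>" "\<nu>' \<le> v' / \<tau> + N * \<tau>" "n \<le> n2 + N"
  shows "F' + 3 * c * \<tau> / \<delta> * h' + c * \<tau> ^ 3 / \<delta> * a' + 3 * c / \<delta> * v' + s * \<tau> ^ 3 * H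
    \<le> ((1 + \<tau> ^ 4 * (c + 3 * c\<^sup>2 / \<delta>)) * F + 3 * c * \<tau> / \<delta> * h + c * \<tau> ^ 3 / \<delta> * a + 2 * c * \<tau> ^ 4 / \<delta> * v
        + \<tau> ^ 4 * (c + 3 * c\<^sup>2 / \<delta> + c * N + 4 * c * N / \<delta>))
      + (3 * c / \<delta> + c * \<tau>\<^sup>2) * v' + 2 * c * \<tau> ^ 5 / \<delta> * n2"
proof -
  define d where "d = 1 / \<delta>"
  have d: "1 \<le> d" using \<delta> by (simp add: d_def)
  have dd: "x / \<delta> = x * d" for x by (simp add: d_def)
  have d\<delta>: "d * \<delta> = 1" using \<delta> by (simp add: d_def)
  have c\<tau>: "0 < c * \<tau> ^ 3" "0 < c * \<tau>" using c \<tau> by auto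
  have t64: "\<tau> ^ 6 \<le> \<tau> ^ 4" and t54: "\<tau> ^ 5 \<le> \<tau> ^ 4" and t65: "\<tau> ^ 6 \<le> \<tau> ^ 5"
    using \<tau> by (auto intro: power_decreasing)
  define w where "w = v / \<tau>"
  define w' where "w' = v' / \<tau>"
  have w: "v = w * \<tau>" "v' = w' * \<tau>" using \<tau> by (simp_all add: w_def w'_def)
  have \<nu>w: "\<nu> \<le> w + N * \<tau>" "\<nu>' \<le> w' + N * \<tau>" using \<nu> by (simp_all add: w_def w'_def)
  have 1: "c * \<tau> ^ 3 * E \<le> c * \<tau> ^ 3 * h + (c * \<tau>\<^sup>2 * v' + c * N * \<tau> ^ 4) + c * \<tau> ^ 3 * a'"
  proof -
    have "c * \<tau> ^ 3 * E \<le> c * \<tau> ^ 3 * (h + (w' + N * \<tau>) + a')"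
      using c\<tau> E \<nu>w by (intro mult_left_mono) auto
    also have "\<dots> = c * \<tau> ^ 3 * h + (c * \<tau>\<^sup>2 * v' + c * N * \<tau> ^ 4) + c * \<tau> ^ 3 * a'"
      unfolding w by (simp add: algebra_simps numeral_eq_Suc)
    finally show ?thesis .
  qed
  have 2: "(c * \<tau> ^ 3 * d + c * \<tau> ^ 3) * a' \<le> c * \<tau> ^ 3 * d * a + 2 * c * d * \<tau> ^ 5 * n2 + 2 * c * d * \<tau> ^ 5 * h
      + 2 * c * d * \<tau> ^ 4 * v + 4 * c * N * d * \<tau> ^ 4"
  proof -
    have "(c * \<tau> ^ 3 * d + c * \<tau> ^ 3) * a' \<le> (c * \<tau> ^ 3 * d + c * \<tau> ^ 3) * ((1 - \<delta>) * a + \<tau>\<^sup>2 * (n + h + \<nu>))"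
      using c\<tau> d a by (intro mult_left_mono) (auto simp: less_imp_le)
    also have "\<dots> = (c * \<tau> ^ 3 * d + c * \<tau> ^ 3) * (1 - \<delta>) * a + (c * \<tau> ^ 3 * d + c * \<tau> ^ 3) * (\<tau>\<^sup>2 * (n + h + \<nu>))"
    proof -
      have "k * (l * a + y) = k * l * a + k * y" for k l y :: real by (simp only: distrib_left mult.assoc)
      then show ?thesis .
    qed
    also have "\<dots> \<le> c * \<tau> ^ 3 * d * a + (2 * (c * \<tau> ^ 3 * d)) * (\<tau>\<^sup>2 * ((n2 + N) + h + (w + N * \<tau>)))"
    proof (rule add_mono)
      have "(c * \<tau> ^ 3 * d + c * \<tau> ^ 3) * (1 - \<delta>)
          = c * \<tau> ^ 3 * d + c * \<tau> ^ 3 - c * \<tau> ^ 3 * (d * \<delta>) - c * \<tau> ^ 3 * \<delta>"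
        by (simp add: algebra_simps)
      also have "\<dots> = c * \<tau> ^ 3 * d - c * \<tau> ^ 3 * \<delta>" unfolding d\<delta> by simp
      also have "\<dots> \<le> c * \<tau> ^ 3 * d" using c\<tau> \<delta> by simp
      finally show "(c * \<tau> ^ 3 * d + c * \<tau> ^ 3) * (1 - \<delta>) * a \<le> c * \<tau> ^ 3 * d * a"
        using pos(3) by (rule mult_right_mono)
      have cd: "c * \<tau> ^ 3 * 1 \<le> c * \<tau> ^ 3 * d" using c\<tau> d by (intro mult_left_mono) auto
      show "(c * \<tau> ^ 3 * d + c * \<tau> ^ 3) * (\<tau>\<^sup>2 * (n + h + \<nu>))
          \<le> (2 * (c * \<tau> ^ 3 * d)) * (\<tau>\<^sup>2 * ((n2 + N) + h + (w + N * \<tau>)))"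
      proof (rule mult_mono)
        show "c * \<tau> ^ 3 * d + c * \<tau> ^ 3 \<le> 2 * (c * \<tau> ^ 3 * d)" using cd by linarith
        show "\<tau>\<^sup>2 * (n + h + \<nu>) \<le> \<tau>\<^sup>2 * ((n2 + N) + h + (w + N * \<tau>))"
          using \<nu>(3) \<nu>w(1) by (intro mult_left_mono) auto
        show "0 \<le> 2 * (c * \<tau> ^ 3 * d)" using c\<tau> d by simp
        show "0 \<le> \<tau>\<^sup>2 * (n + h + \<nu>)" using pos by simp
      qed
    qed
    also have "\<dots> = c * \<tau> ^ 3 * d * a + 2 * c * d * \<tau> ^ 5 * n2 + 2 * c * d * \<tau> ^ 5 * h + 2 * c * d * \<tau> ^ 4 * v
        + 2 * c * N * d * (\<tau> ^ 5 + \<tau> ^ 6)"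
      unfolding w by (simp add: algebra_simps numeral_eq_Suc)
    also have "\<dots> \<le> c * \<tau> ^ 3 * d * a + 2 * c * d * \<tau> ^ 5 * n2 + 2 * c * d * \<tau> ^ 5 * h + 2 * c * d * \<tau> ^ 4 * v
        + 2 * c * N * d * (\<tau> ^ 4 + \<tau> ^ 4)"
      using t64 t54 c d N by (intro add_left_mono mult_left_mono add_mono) auto
    finally show ?thesis by simp
  qed
  have 3: "3 * c * \<tau> * d * h' \<le> 3 * c * \<tau> * d * h - 3 * c * d * \<tau> ^ 3 * h + 3 * c\<^sup>2 * d * \<tau> ^ 4 * (1 + F)"
  proof -
    have "3 * c * \<tau> * d * h' \<le> 3 * c * \<tau> * d * ((1 - \<tau>\<^sup>2) * h + c * \<tau> ^ 3 * (1 + F))"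
      using c \<tau> d h by (intro mult_left_mono) auto
    also have "\<dots> = 3 * c * \<tau> * d * h - 3 * c * d * \<tau> ^ 3 * h + 3 * c\<^sup>2 * d * \<tau> ^ 4 * (1 + F)"
      by (simp add: algebra_simps numeral_eq_Suc)
    finally show ?thesis .
  qed
  have 4: "c * \<tau> ^ 6 * (1 + F) \<le> c * \<tau> ^ 4 * (1 + F)" using t64 c pos by (intro mult_right_mono mult_left_mono) auto
  \<comment> \<open>The decay of the drift releases three shares: one covers the gradient error and
    two the estimation error. This is the 3 in the weight of \<open>h\<close>.\<close>
  have 5: "c * \<tau> ^ 3 * h + 2 * c * d * \<tau> ^ 5 * h \<le> 3 * c * d * \<tau> ^ 3 * h"
  proof -
    have "c * \<tau> ^ 3 * 1 \<le> c * \<tau> ^ 3 * d" using c\<tau> d by (intro mult_left_mono) auto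
    moreover have "2 * c * d * \<tau> ^ 5 \<le> 2 * c * d * \<tau> ^ 3"
      using c d \<tau> by (intro mult_left_mono power_decreasing) auto
    ultimately have "c * \<tau> ^ 3 + 2 * c * d * \<tau> ^ 5 \<le> 3 * c * d * \<tau> ^ 3" by (simp add: mult_ac)
    then have "(c * \<tau> ^ 3 + 2 * c * d * \<tau> ^ 5) * h \<le> 3 * c * d * \<tau> ^ 3 * h" using pos by (intro mult_right_mono)
    then show ?thesis by (simp add: distrib_right)
  qed
  show ?thesis
    unfolding dd using F 1 2 3 4 5 by (simp add: algebra_simps)
qed

text \<open>The contraction of the averaged noise releases three shares of order \<tau>^2, which pay
  one surcharge from the gradient error and two from the estimation error. What the new noise
  injects is of order \<tau>^4 = 1 / T, hence summable over the run.\<close>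

lemma lyapunov_generalized_weights:
  fixes c \<delta> \<tau> :: real
  assumes \<tau>: "0 < \<tau>" "\<tau> \<le> 1" and c: "1 \<le> c" and \<delta>: "0 < \<delta>" "\<delta> \<le> 1"
  shows "(3 * c / \<delta> + c * \<tau>\<^sup>2) * (1 - \<tau>\<^sup>2)\<^sup>2 + 2 * c * \<tau> ^ 4 / \<delta> \<le> 3 * c / \<delta>"
    and "(3 * c / \<delta> + c * \<tau>\<^sup>2) * (\<tau>\<^sup>2)\<^sup>2 + 2 * c * \<tau> ^ 5 / \<delta> \<le> \<tau> ^ 4 * (6 * c / \<delta>)"
proof -
  define d where "d = c / \<delta>"
  have d: "c \<le> d" using \<delta> c by (simp add: d_def le_divide_eq mult_left_le)
  have d0: "0 < d" using \<delta> c by (simp add: d_def)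
  have dd: "3 * c / \<delta> = 3 * d" "2 * c * x / \<delta> = 2 * d * x" "6 * c / \<delta> = 6 * d" for x by (simp_all add: d_def)
  have t2: "0 \<le> \<tau>\<^sup>2" "\<tau>\<^sup>2 \<le> 1" using \<tau> by (auto simp: power_le_one)
  have t4: "\<tau> ^ 4 \<le> \<tau>\<^sup>2" "\<tau> ^ 5 \<le> \<tau> ^ 4" using \<tau> by (auto intro: power_decreasing)
  have sq: "(1 - \<tau>\<^sup>2)\<^sup>2 \<le> 1 - \<tau>\<^sup>2" using t2 by (simp add: power2_eq_square mult_left_le)
  have "(3 * d + c * \<tau>\<^sup>2) * (1 - \<tau>\<^sup>2)\<^sup>2 \<le> (3 * d + c * \<tau>\<^sup>2) * (1 - \<tau>\<^sup>2)"
    using sq d0 c by (intro mult_left_mono) auto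
  also have "\<dots> = 3 * d - 3 * d * \<tau>\<^sup>2 + c * \<tau>\<^sup>2 - c * (\<tau>\<^sup>2 * \<tau>\<^sup>2)" by (simp add: algebra_simps)
  also have "\<dots> \<le> 3 * d - 3 * d * \<tau>\<^sup>2 + d * \<tau>\<^sup>2 - 0"
    using d c by (intro diff_mono add_mono mult_right_mono) auto
  finally have "(3 * d + c * \<tau>\<^sup>2) * (1 - \<tau>\<^sup>2)\<^sup>2 \<le> 3 * d - 2 * (d * \<tau>\<^sup>2)" by simp
  moreover have "d * \<tau> ^ 4 \<le> d * \<tau>\<^sup>2" using t4 d0 by (intro mult_left_mono) auto
  ultimately show "(3 * c / \<delta> + c * \<tau>\<^sup>2) * (1 - \<tau>\<^sup>2)\<^sup>2 + 2 * c * \<tau> ^ 4 / \<delta> \<le> 3 * c / \<delta>"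
    unfolding dd by simp
  have "(3 * d + c * \<tau>\<^sup>2) * (\<tau>\<^sup>2)\<^sup>2 \<le> (3 * d + d * 1) * (\<tau>\<^sup>2)\<^sup>2"
    using d t2 c by (intro mult_right_mono add_left_mono mult_mono) auto
  moreover have "2 * d * \<tau> ^ 5 \<le> 2 * d * \<tau> ^ 4" using t4 d0 by (intro mult_left_mono) auto
  moreover have "(\<tau>\<^sup>2)\<^sup>2 = \<tau> ^ 4" by (simp flip: power_mult)
  ultimately show "(3 * c / \<delta> + c * \<tau>\<^sup>2) * (\<tau>\<^sup>2)\<^sup>2 + 2 * c * \<tau> ^ 5 / \<delta> \<le> \<tau> ^ 4 * (6 * c / \<delta>)"
    unfolding dd by (simp add: algebra_simps)
qed

text \<open>The passage from norms to second moments. The split at \<tau> is balanced: the averaged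
  noise has second moment of order \<tau>^2, so both terms are of order \<tau>.\<close>

lemma le_sq_div_add: "0 < \<tau> \<Longrightarrow> x \<le> x\<^sup>2 / \<tau> + \<tau>" for x \<tau> :: real
proof -
  assume \<tau>: "0 < \<tau>"
  have "0 \<le> (x - \<tau> / 2)\<^sup>2 + 3 / 4 * \<tau>\<^sup>2" by simp
  also have "\<dots> = x\<^sup>2 + \<tau>\<^sup>2 - x * \<tau>" by (simp add: power2_eq_square algebra_simps)
  finally have "x * \<tau> \<le> x\<^sup>2 + \<tau>\<^sup>2" by simp
  then have "x \<le> (x\<^sup>2 + \<tau>\<^sup>2) / \<tau>" using \<tau> by (simp add: le_divide_eq)
  then show ?thesis using \<tau> by (simp add: add_divide_distrib power2_eq_square)
qed

lemma sum_norm_le_sum_sq: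
  fixes x :: "'c::finite \<Rightarrow> 'a::real_normed_vector"
  assumes "0 < \<tau>"
  shows "norm_sum x \<le> sq_sum x / \<tau> + real CARD('c) * \<tau>"
proof -
  have "norm_sum x \<le> (\<Sum>j\<in>UNIV. (norm (x j))\<^sup>2 / \<tau> + \<tau>)"
    by (intro sum_mono le_sq_div_add assms)
  then show ?thesis by (simp add: sum.distrib sum_divide_distrib)
qed

context muon_round
begin

text \<open>The vectors \<open>nu\<close> stand for the accumulated noise in the momenta.  Only this part is controlled
  in second moment; the remaining, drift part of the momentum error is controlled in norm.\<close>

lemma generalized_round_bound:
  fixes nu :: "'c \<Rightarrow> real ^ 'e"
  assumes sync: "broadcast st = model st" "broadcast st' = model st'"
    and lower: "\<And>X. m \<le> average fs X" and a: "0 \<le> a"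
    and lip: "\<And>j X Y. norm (grad (fs j) X - grad (fs j) Y) \<le> a * (1 + (average fs X - m)) * norm (X - Y)"
    and lr: "\<And>i M. lr i M = \<tau> ^ 3 * \<rho> i" and \<tau>: "0 < \<tau>" "\<tau> \<le> 1" and \<mu>: "\<mu> = 1 - \<tau>\<^sup>2"
    and \<rho>: "0 < \<rho>min" "\<And>i. \<rho>min \<le> \<rho> i" "\<And>i. \<rho> i \<le> \<rho>max"
    and c: "1 \<le> c" "\<rho>min + \<rho>max * real CARD('e) * real CARD('l) \<le> c"
      "real CARD('c) * a * (real CARD('e) * real CARD('l) * \<rho>max\<^sup>2) \<le> c"
      "real CARD('c) * a * (real CARD('e) * real CARD('l) * \<rho>max) \<le> c"
  defines "nu' \<equiv> \<lambda>j. (1 - \<tau>\<^sup>2) *\<^sub>R nu j + \<tau>\<^sup>2 *\<^sub>R noise_at j"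
  shows "(average fs (model st') - m) + 3 * c * \<tau> / \<delta> * (\<Sum>j\<in>UNIV. norm (mom_err fs st' j - nu' j))
      + c * \<tau> ^ 3 / \<delta> * norm_sum (est_err st') + 3 * c / \<delta> * sq_sum nu'
      + \<rho>min * \<tau> ^ 3 * norm (grad (average fs) (model st))
    \<le> ((1 + \<tau> ^ 4 * (c + 3 * c\<^sup>2 / \<delta>)) * (average fs (model st) - m)
        + 3 * c * \<tau> / \<delta> * (\<Sum>j\<in>UNIV. norm (mom_err fs st j - nu j))
        + c * \<tau> ^ 3 / \<delta> * norm_sum (est_err st) + 2 * c * \<tau> ^ 4 / \<delta> * sq_sum nu
        + \<tau> ^ 4 * (c + 3 * c\<^sup>2 / \<delta> + c * real CARD('c) + 4 * c * real CARD('c) / \<delta>))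
      + (3 * c / \<delta> + c * \<tau>\<^sup>2) * sq_sum nu'
      + 2 * c * \<tau> ^ 5 / \<delta> * sq_sum noise_at"
proof (rule lyapunov_generalized_round)
  let ?N = "real CARD('c)" and ?EL = "real CARD('e) * real CARD('l)" and ?F = "average fs (model st) - m"
  have \<rho>0: "0 < \<rho> i" for i using \<rho>(1,2) less_le_trans by blast
  have F0: "0 \<le> ?F" using lower by simp
  have t2: "0 \<le> \<tau>\<^sup>2" "\<tau>\<^sup>2 \<le> 1" using \<tau> by (auto simp: power_le_one)
  \<comment> \<open>All new noise goes into \<open>nu'\<close>. It cancels in the drift, whose
    recursion is driven by the change of the gradients alone and can therefore be bounded
    pathwise.\<close>
  have fresh: "fresh_err j = (1 - \<tau>\<^sup>2) *\<^sub>R (mom_err fs st j - nu j) + nu' j" for j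
    unfolding fresh_err_def nu'_def unfolding \<mu> by (simp add: algebra_simps)
  have drift: "mom_err fs st' j - nu' j = (1 - \<tau>\<^sup>2) *\<^sub>R (mom_err fs st j - nu j)
      + (grad (fs j) (model st) - grad (fs j) (model st'))" for j
    by (simp add: mom_err_step fresh sync)
  show "0 < \<tau>" "\<tau> \<le> 1" "1 \<le> c" "0 \<le> ?N" "0 \<le> ?F" "0 < \<delta>" "\<delta> \<le> 1"
    using \<tau> c F0 \<delta> by auto
  show "0 \<le> norm (grad (average fs) (model st) - server_est st')" by simp
  show "average fs (model st') - m \<le> ?F - \<rho>min * \<tau> ^ 3 * norm (grad (average fs) (model st))
      + c * \<tau> ^ 3 * norm (grad (average fs) (model st) - server_est st') + c * \<tau> ^ 6 * (1 + ?F)"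
  proof -
    let ?K = "a * (1 + ?F)" and ?E = "norm (grad (average fs) (model st) - server_est st')"
    have lip': "norm (grad (fs j) Y - grad (fs j) (model st)) \<le> ?K * norm (Y - model st)" for j Y
      using lip[of j "model st" Y] by (simp add: norm_minus_commute)
    have "?N * ?K * (?EL * \<rho>max\<^sup>2 * (\<tau> ^ 3)\<^sup>2) = (?N * a * (?EL * \<rho>max\<^sup>2)) * (\<tau> ^ 6 * (1 + ?F))"
      by (simp add: mult_ac flip: power_mult)
    also have "\<dots> \<le> c * (\<tau> ^ 6 * (1 + ?F))"
      using c F0 \<tau> by (intro mult_right_mono) auto
    finally have 1: "?N * ?K * (?EL * \<rho>max\<^sup>2 * (\<tau> ^ 3)\<^sup>2) \<le> c * \<tau> ^ 6 * (1 + ?F)" by (simp add: mult.assoc)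
    have 2: "(\<rho>min + \<rho>max * real CARD('e) * real CARD('l)) * \<tau> ^ 3 * ?E \<le> c * \<tau> ^ 3 * ?E"
      using c \<tau> by (intro mult_right_mono) auto
    have "0 \<le> ?K" "0 < \<tau> ^ 3" using a F0 \<tau> by simp_all
    from constant_rate_descent[OF lip' this(1) lr this(2) \<rho>] 1 2 show ?thesis by linarith
  qed
  show "norm (grad (average fs) (model st) - server_est st')
      \<le> (\<Sum>j\<in>UNIV. norm (mom_err fs st j - nu j)) + norm_sum nu' + norm_sum (est_err st')"
  proof -
    let ?m = "\<lambda>x. (1 / ?N) *\<^sub>R (\<Sum>j\<in>UNIV. x j)"
    have "norm (grad (average fs) (model st) - server_est st') = norm (?m fresh_err + ?m (est_err st'))"
      unfolding grad_minus_server sync(1)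
      using norm_minus_cancel[of "?m fresh_err + ?m (est_err st')"] by simp
    also have "\<dots> \<le> norm_sum fresh_err + norm_sum (est_err st')"
      by (intro norm_triangle_le add_mono norm_mean_le)
    also have "norm_sum fresh_err \<le> (\<Sum>j\<in>UNIV. norm (mom_err fs st j - nu j) + norm (nu' j))"
    proof (rule sum_mono)
      fix j
      have "norm (fresh_err j) \<le> norm ((1 - \<tau>\<^sup>2) *\<^sub>R (mom_err fs st j - nu j)) + norm (nu' j)"
        unfolding fresh by (rule norm_triangle_ineq)
      also have "norm ((1 - \<tau>\<^sup>2) *\<^sub>R (mom_err fs st j - nu j)) \<le> norm (mom_err fs st j - nu j)"
        using t2 by (simp add: mult_left_le_one_le)
      finally show "norm (fresh_err j) \<le> norm (mom_err fs st j - nu j) + norm (nu' j)" by simp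
    qed
    finally show ?thesis by (simp add: sum.distrib)
  qed
  show "norm_sum (est_err st') \<le> (1 - \<delta>) * norm_sum (est_err st)
      + \<tau>\<^sup>2 * (norm_sum noise_at + (\<Sum>j\<in>UNIV. norm (mom_err fs st j - nu j)) + norm_sum nu)"
  proof -
    have "norm_sum (est_err st') \<le> (\<Sum>j\<in>UNIV. (1 - \<delta>) * norm (est_err st j)
        + \<tau>\<^sup>2 * (norm (noise_at j) + norm (mom_err fs st j - nu j) + norm (nu j)))"
    proof (rule sum_mono)
      fix j
      have "norm (mom_err fs st j) \<le> norm (mom_err fs st j - nu j) + norm (nu j)"
        using norm_triangle_ineq[of "mom_err fs st j - nu j" "nu j"] by simp
      then have "\<tau>\<^sup>2 * (norm (noise_at j) + norm (mom_err fs st j))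
          \<le> \<tau>\<^sup>2 * (norm (noise_at j) + norm (mom_err fs st j - nu j) + norm (nu j))"
        by (intro mult_left_mono) auto
      moreover have "norm (est_err st' j) \<le> (1 - \<delta>) * norm (est_err st j)
          + \<tau>\<^sup>2 * (norm (noise_at j) + norm (mom_err fs st j))"
        using norm_est_err_step_le[of j] t2 by (simp add: \<mu>)
      ultimately show "norm (est_err st' j) \<le> (1 - \<delta>) * norm (est_err st j)
        + \<tau>\<^sup>2 * (norm (noise_at j) + norm (mom_err fs st j - nu j) + norm (nu j))" by linarith
    qed
    then show ?thesis by (simp add: sum.distrib flip: sum_distrib_left)
  qed
  show "(\<Sum>j\<in>UNIV. norm (mom_err fs st' j - nu' j)) \<le> (1 - \<tau>\<^sup>2) * (\<Sum>j\<in>UNIV. norm (mom_err fs st j - nu j))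
      + c * \<tau> ^ 3 * (1 + ?F)"
  proof -
    have "(\<Sum>j\<in>UNIV. norm (mom_err fs st' j - nu' j))
        \<le> (\<Sum>j\<in>UNIV. (1 - \<tau>\<^sup>2) * norm (mom_err fs st j - nu j) + a * (1 + ?F) * (?EL * \<rho>max * \<tau> ^ 3))"
    proof (rule sum_mono)
      fix j
      have "norm (mom_err fs st' j - nu' j) \<le> norm ((1 - \<tau>\<^sup>2) *\<^sub>R (mom_err fs st j - nu j))
          + norm (grad (fs j) (model st) - grad (fs j) (model st'))"
        unfolding drift by (rule norm_triangle_ineq)
      also have "norm ((1 - \<tau>\<^sup>2) *\<^sub>R (mom_err fs st j - nu j)) = (1 - \<tau>\<^sup>2) * norm (mom_err fs st j - nu j)"
        using t2 by simp
      also have "norm (grad (fs j) (model st) - grad (fs j) (model st')) \<le> a * (1 + ?F) * norm move"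
        using lip[of j "model st" "model st'"] by (simp add: model_step)
      also have "a * (1 + ?F) * norm move \<le> a * (1 + ?F) * (?EL * \<rho>max * \<tau> ^ 3)"
        using a F0 \<tau> by (intro mult_left_mono norm_move_constant_le[OF lr \<rho>0 \<rho>(3)]) auto
      finally show "norm (mom_err fs st' j - nu' j)
          \<le> (1 - \<tau>\<^sup>2) * norm (mom_err fs st j - nu j) + a * (1 + ?F) * (?EL * \<rho>max * \<tau> ^ 3)" by simp
    qed
    also have "\<dots> = (1 - \<tau>\<^sup>2) * (\<Sum>j\<in>UNIV. norm (mom_err fs st j - nu j))
        + (?N * a * (?EL * \<rho>max)) * (\<tau> ^ 3 * (1 + ?F))"
      by (simp add: sum.distrib sum_distrib_left mult_ac)
    also have "\<dots> \<le> (1 - \<tau>\<^sup>2) * (\<Sum>j\<in>UNIV. norm (mom_err fs st j - nu j)) + c * (\<tau> ^ 3 * (1 + ?F))"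
      using c F0 \<tau> by (intro add_left_mono mult_right_mono) auto
    finally show ?thesis by (simp add: mult.assoc)
  qed
  show "norm_sum nu \<le> sq_sum nu / \<tau> + ?N * \<tau>"
    "norm_sum nu' \<le> sq_sum nu' / \<tau> + ?N * \<tau>"
    by (rule sum_norm_le_sum_sq[OF \<tau>(1)])+
  show "norm_sum noise_at \<le> sq_sum noise_at + ?N"
    using sum_norm_le_sum_sq[of 1 noise_at] by simp
qed (auto intro: sum_nonneg)

end

section \<open>Expected progress of a round in the generalized smooth case\<close>

context stochastic_clients
begin

text \<open>The momentum recursion applied to the noise alone. Starting from 0 assigns the initial
  momentum error, minus the gradient at \<open>X0\<close>, to the drift.\<close>

primrec noise_avg :: "(nat \<Rightarrow> 'w \<Rightarrow> real ^ 'e) \<Rightarrow> real \<Rightarrow> nat \<Rightarrow> 'c \<Rightarrow> 'w \<Rightarrow> real ^ 'e" where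
  "noise_avg W \<beta> 0 = (\<lambda>j \<omega>. 0)"
| "noise_avg W \<beta> (Suc t) = (\<lambda>j \<omega>. (1 - \<beta>) *\<^sub>R noise_avg W \<beta> t j \<omega> + \<beta> *\<^sub>R noise W t j \<omega>)"

lemma noise_avg_measurable:
  assumes W: "\<And>t. W t \<in> borel_measurable (past R t)"
  shows "noise_avg W \<beta> t j \<in> borel_measurable (past R t)"
proof (induction t)
  case (Suc t)
  then have [measurable]: "noise_avg W \<beta> t j \<in> borel_measurable (past R (Suc t))"
    by (rule measurable_past_mono) simp
  note [measurable] = noise_measurable[of W t, OF W]
  show ?case by simp
qed simp

text \<open>Without a lag the gradients are sampled exactly where the gap, and with it the local
  Lipschitz constant, is controlled by the potential.\<close>

lemma USign_synchronized:
  "broadcast (muon_state S EF21_MuonUSign X0 \<mu> lr R t \<omega>) = model (muon_state S EF21_MuonUSign X0 \<mu> lr R t \<omega>)"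
  by (cases t) (simp_all add: muon_step_simps(5))

lemma generalized_expected_gradients:
  fixes \<rho> :: "'l \<Rightarrow> real"
  defines "\<delta> \<equiv> 1 / (2 * real CARD('e))"
  assumes lower: "\<And>X. m \<le> average fs X" and a: "0 \<le> a"
    and lip: "\<And>j X Y. norm (grad (fs j) X - grad (fs j) Y) \<le> a * (1 + (average fs X - m)) * norm (X - Y)"
    and \<tau>: "0 < \<tau>" "\<tau> \<le> 1"
    and \<rho>: "0 < \<rho>min" "\<And>i. \<rho>min \<le> \<rho> i" "\<And>i. \<rho> i \<le> \<rho>max"
    and c: "1 \<le> c" "\<rho>min + \<rho>max * real CARD('e) * real CARD('l) \<le> c"
      "real CARD('c) * a * (real CARD('e) * real CARD('l) * \<rho>max\<^sup>2) \<le> c"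
      "real CARD('c) * a * (real CARD('e) * real CARD('l) * \<rho>max) \<le> c"
  shows "(\<Sum>t<T. \<integral>\<^sup>+ \<omega>. ennreal (\<rho>min * \<tau> ^ 3 * norm (grad (average fs)
        (iterate S EF21_MuonUSign X0 (1 - \<tau>\<^sup>2) (\<lambda>i G. \<tau> ^ 3 * \<rho> i) R t \<omega>))) \<partial>base R)
    \<le> ennreal ((1 + \<tau> ^ 4 * (c + 3 * c\<^sup>2 / \<delta>)) ^ T *
        (average fs X0 - m + 3 * c * \<tau> / \<delta> * (\<Sum>j\<in>UNIV. norm (grad (fs j) X0))
        + real T * (\<tau> ^ 4 * ((c + 3 * c\<^sup>2 / \<delta> + c * real CARD('c) + 4 * c * real CARD('c) / \<delta>)
            + real CARD('c) * \<sigma>\<^sup>2 * (6 * c / \<delta>)))))"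
proof -
  define lr where "lr = (\<lambda>(i::'l) (G::real mat). \<tau> ^ 3 * \<rho> i)"
  define st where "st = muon_state S EF21_MuonUSign X0 (1 - \<tau>\<^sup>2) lr R"
  have "1 \<le> real CARD('e)" by (simp add: Suc_leI)
  then have "1 \<le> 2 * real CARD('e)" by linarith
  then have \<delta>: "0 < \<delta>" "\<delta> \<le> 1" unfolding \<delta>_def by simp_all
  define q where "q = \<tau> ^ 4 * (c + 3 * c\<^sup>2 / \<delta>)"
  have q: "0 \<le> q" using \<tau> c \<delta> by (simp add: q_def)
  define k where "k = \<tau> ^ 4 * (c + 3 * c\<^sup>2 / \<delta> + c * real CARD('c) + 4 * c * real CARD('c) / \<delta>)"
  have k: "0 \<le> k" using \<tau> c \<delta> by (simp add: k_def)
  define P where "P = 3 * c * \<tau> / \<delta>"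
  define Q where "Q = c * \<tau> ^ 3 / \<delta>"
  define Z where "Z = 3 * c / \<delta>"
  define r where "r = 2 * c * \<tau> ^ 4 / \<delta>"
  define p where "p = Z + c * \<tau>\<^sup>2"
  define s where "s = 2 * c * \<tau> ^ 5 / \<delta>"
  have nonneg: "0 \<le> P" "0 \<le> Q" "0 \<le> Z" "0 \<le> r" "0 \<le> p" "0 \<le> s"
    using \<tau> c \<delta> by (auto simp: P_def Q_def Z_def r_def p_def s_def)
  have weights: "p * (1 - \<tau>\<^sup>2)\<^sup>2 + r \<le> Z" "p * (\<tau>\<^sup>2)\<^sup>2 + s \<le> \<tau> ^ 4 * (6 * c / \<delta>)"
    using lyapunov_generalized_weights[OF \<tau> c(1) \<delta>] by (simp_all add: p_def Z_def r_def s_def)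
  define W where "W t \<omega> = broadcast (st t \<omega>)" for t \<omega>
  define nu where "nu = noise_avg W (\<tau>\<^sup>2)"
  define \<Phi> where "\<Phi> t \<omega> = (average fs (model (st t \<omega>)) - m)
      + P * (\<Sum>j\<in>UNIV. norm (mom_err fs (st t \<omega>) j - nu t j \<omega>))
      + Q * norm_sum (est_err (st t \<omega>)) + Z * (\<Sum>j\<in>UNIV. (norm (nu t j \<omega>))\<^sup>2)" for t \<omega>
  define U where "U t \<omega> = (1 + q) * (average fs (model (st t \<omega>)) - m)
      + P * (\<Sum>j\<in>UNIV. norm (mom_err fs (st t \<omega>) j - nu t j \<omega>))
      + Q * norm_sum (est_err (st t \<omega>)) + r * (\<Sum>j\<in>UNIV. (norm (nu t j \<omega>))\<^sup>2) + k" for t \<omega>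
  define H where "H t \<omega> = \<rho>min * \<tau> ^ 3 * norm (grad (average fs) (model (st t \<omega>)))" for t \<omega>
  have st_meas: "state_measurable (past R t) (st t)" for t
    unfolding st_def by (rule muon_state_measurable) (simp add: lr_def measurable_rate_const)
  note [measurable] = state_measurableD[OF st_meas]
  have W_meas: "W t \<in> borel_measurable (past R t)" for t unfolding W_def[abs_def] by measurable
  have nu_meas [measurable]: "nu t j \<in> borel_measurable (past R t)" for t j
    unfolding nu_def by (rule noise_avg_measurable[OF W_meas])
  have U_meas: "U t \<in> borel_measurable (past R t)" for t
    unfolding U_def[abs_def] mom_err_def est_err_def by measurable
  have \<Phi>_meas: "\<Phi> t \<in> borel_measurable (past R t)" for t
    unfolding \<Phi>_def[abs_def] mom_err_def est_err_def by measurable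
  have H_meas: "H t \<in> borel_measurable (past R t)" for t
    unfolding H_def[abs_def] by measurable
  have \<Phi>0: "0 \<le> \<Phi> t \<omega>" for t \<omega>
    unfolding \<Phi>_def using nonneg lower by (intro add_nonneg_nonneg mult_nonneg_nonneg sum_nonneg) auto
  have U0: "0 \<le> U t \<omega>" for t \<omega>
    unfolding U_def using nonneg lower q k by (intro add_nonneg_nonneg mult_nonneg_nonneg sum_nonneg) auto
  have H0: "0 \<le> H t \<omega>" for t \<omega> using \<rho> \<tau> by (simp add: H_def)
  have step: "\<Phi> (Suc t) \<omega> + H t \<omega> \<le> U t \<omega>
      + p * (\<Sum>j\<in>UNIV. (norm ((1 - \<tau>\<^sup>2) *\<^sub>R nu t j \<omega> + \<tau>\<^sup>2 *\<^sub>R noise W t j \<omega>))\<^sup>2)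
      + s * (\<Sum>j\<in>UNIV. (norm (noise W t j \<omega>))\<^sup>2)" if \<omega>: "\<omega> \<in> space (base R)" for t \<omega>
  proof -
    interpret r: muon_round S EF21_MuonUSign fs "stoch_grad R" "1 - \<tau>\<^sup>2" lr "\<lambda>j. sample R (Suc t) j \<omega>"
      "\<lambda>j. up_sign R (Suc t) j \<omega>" "down_sign R (Suc t) \<omega>" "st t \<omega>"
      unfolding st_def by (rule muon_round_state[OF \<omega>])
    have \<delta>_eq: "r.\<delta> = \<delta>" unfolding r.\<delta>_def \<delta>_def ..
    have st': "r.st' = st (Suc t) \<omega>" unfolding r.st'_def by (simp add: st_def)
    have n: "r.noise_at = (\<lambda>j. noise W t j \<omega>)"
      unfolding r.noise_at_def[abs_def] by (simp add: noise_def W_def fun_eq_iff)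
    have lr_eq: "lr i M = \<tau> ^ 3 * \<rho> i" for i M by (simp add: lr_def)
    have sync: "broadcast (st t \<omega>) = model (st t \<omega>)" "broadcast r.st' = model r.st'"
      unfolding st' unfolding st_def by (rule USign_synchronized)+
    have nu_Suc: "nu (Suc t) j \<omega> = (1 - \<tau>\<^sup>2) *\<^sub>R nu t j \<omega> + \<tau>\<^sup>2 *\<^sub>R noise W t j \<omega>" for j
      by (simp add: nu_def)
    show ?thesis
      using r.generalized_round_bound[where nu = "\<lambda>j. nu t j \<omega>" and \<rho> = \<rho>, OF sync lower a lip lr_eq \<tau> refl \<rho> c,
          unfolded \<delta>_eq st' n]
      by (simp only: \<Phi>_def H_def U_def P_def Q_def Z_def p_def q_def r_def s_def k_def nu_Suc)
  qed
  define \<kappa> where "\<kappa> = \<tau> ^ 4 * ((c + 3 * c\<^sup>2 / \<delta> + c * real CARD('c) + 4 * c * real CARD('c) / \<delta>)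
            + real CARD('c) * \<sigma>\<^sup>2 * (6 * c / \<delta>))"
  have "expect (\<Phi> (Suc t)) + expect (H t)
      \<le> ennreal (1 + q) * expect (\<Phi> t) + ennreal \<kappa>" for t
  proof -
    note [measurable] = measurable_past_base[OF \<Phi>_meas] measurable_past_base[OF H_meas]
    have "expect (\<Phi> (Suc t)) + expect (H t)
        = (\<integral>\<^sup>+ \<omega>. ennreal (\<Phi> (Suc t) \<omega> + H t \<omega>) \<partial>base R)"
      by (simp add: ennreal_plus \<Phi>0 H0 nn_integral_add)
    also have "\<dots> \<le> (\<integral>\<^sup>+ \<omega>. ennreal (U t \<omega> + p * (\<Sum>j\<in>UNIV. (norm ((1 - \<tau>\<^sup>2) *\<^sub>R nu t j \<omega>))\<^sup>2)) \<partial>base R)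
        + ennreal (real CARD('c) * \<sigma>\<^sup>2 * (p * (\<tau>\<^sup>2)\<^sup>2 + s))"
      by (rule expectation_round_le[where W = W and t = t]) (use W_meas U_meas U0 nonneg step in \<open>auto\<close>)
    also have "\<dots> \<le> (\<integral>\<^sup>+ \<omega>. ennreal (1 + q) * ennreal (\<Phi> t \<omega>) + ennreal k \<partial>base R)
        + ennreal (real CARD('c) * \<sigma>\<^sup>2 * (\<tau> ^ 4 * (6 * c / \<delta>)))"
    proof (intro add_mono nn_integral_mono ennreal_leI)
      fix \<omega>
      let ?V = "\<Sum>j\<in>UNIV. (norm (nu t j \<omega>))\<^sup>2"
      have "(p * (1 - \<tau>\<^sup>2)\<^sup>2 + r) * ?V \<le> Z * ?V"
        using weights(1) by (intro mult_right_mono sum_nonneg) auto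
      \<comment> \<open>The growth factor stems from the gap alone; the remaining terms of \<Phi>
        are nonnegative, so it may be applied to all of \<Phi>, as telescoping requires.\<close>
      moreover have "0 \<le> q * (\<Phi> t \<omega> - (average fs (model (st t \<omega>)) - m))"
        unfolding \<Phi>_def using q nonneg by (intro mult_nonneg_nonneg) (auto intro!: add_nonneg_nonneg mult_nonneg_nonneg sum_nonneg)
      moreover have e: "p * (\<Sum>j\<in>UNIV. (norm ((1 - \<tau>\<^sup>2) *\<^sub>R nu t j \<omega>))\<^sup>2) = p * (1 - \<tau>\<^sup>2)\<^sup>2 * ?V"
        by (simp add: power_mult_distrib mult.assoc flip: sum_distrib_left)
      ultimately have "U t \<omega> + p * (\<Sum>j\<in>UNIV. (norm ((1 - \<tau>\<^sup>2) *\<^sub>R nu t j \<omega>))\<^sup>2) \<le> (1 + q) * \<Phi> t \<omega> + k"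
        unfolding e unfolding U_def by (simp add: \<Phi>_def distrib_right right_diff_distrib distrib_left)
      then have "ennreal (U t \<omega> + p * (\<Sum>j\<in>UNIV. (norm ((1 - \<tau>\<^sup>2) *\<^sub>R nu t j \<omega>))\<^sup>2))
          \<le> ennreal ((1 + q) * \<Phi> t \<omega> + k)" by (rule ennreal_leI)
      also have "\<dots> = ennreal (1 + q) * ennreal (\<Phi> t \<omega>) + ennreal k"
        using q k \<Phi>0[of t \<omega>] by (simp add: ennreal_mult ennreal_plus del: ennreal_1)
      finally show "ennreal (U t \<omega> + p * (\<Sum>j\<in>UNIV. (norm ((1 - \<tau>\<^sup>2) *\<^sub>R nu t j \<omega>))\<^sup>2))
          \<le> ennreal (1 + q) * ennreal (\<Phi> t \<omega>) + ennreal k" .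
      show "real CARD('c) * \<sigma>\<^sup>2 * (p * (\<tau>\<^sup>2)\<^sup>2 + s) \<le> real CARD('c) * \<sigma>\<^sup>2 * (\<tau> ^ 4 * (6 * c / \<delta>))"
        using weights(2) by (intro mult_left_mono) auto
    qed
    also have "\<dots> = ennreal (1 + q) * expect (\<Phi> t)
        + (ennreal k + ennreal (real CARD('c) * \<sigma>\<^sup>2 * (\<tau> ^ 4 * (6 * c / \<delta>))))"
      by (simp add: nn_integral_add nn_integral_cmult emeasure_space_1 add.assoc)
    also have "ennreal k + ennreal (real CARD('c) * \<sigma>\<^sup>2 * (\<tau> ^ 4 * (6 * c / \<delta>))) = ennreal \<kappa>"
    proof -
      have "0 \<le> real CARD('c) * \<sigma>\<^sup>2 * (\<tau> ^ 4 * (6 * c / \<delta>))" using \<tau> c \<delta> by simp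
      moreover have "k + real CARD('c) * \<sigma>\<^sup>2 * (\<tau> ^ 4 * (6 * c / \<delta>)) = \<kappa>"
        unfolding k_def \<kappa>_def distrib_left[of "\<tau> ^ 4" _ "real CARD('c) * \<sigma>\<^sup>2 * (6 * c / \<delta>)"] by simp
      ultimately show ?thesis using k by (simp flip: ennreal_plus)
    qed
    finally show ?thesis .
  qed
  then have 1: "expect (\<Phi> T) + (\<Sum>t<T. \<integral>\<^sup>+ \<omega>. ennreal (H t \<omega>) \<partial>base R)
      \<le> ennreal ((1 + q) ^ T * (\<Phi> 0 undefined + real T * \<kappa>))"
  proof (rule lyapunov_telescope)
    show "0 \<le> \<kappa>" unfolding \<kappa>_def using c \<tau> \<delta> by (intro mult_nonneg_nonneg add_nonneg_nonneg) auto
    have const: "\<Phi> 0 \<omega> = \<Phi> 0 undefined" for \<omega> by (simp add: \<Phi>_def st_def mom_err_def est_err_def nu_def)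
    have "expect (\<Phi> 0) = (\<integral>\<^sup>+ \<omega>. ennreal (\<Phi> 0 undefined) \<partial>base R)"
      by (intro nn_integral_cong arg_cong[where f = ennreal] const)
    then show "expect (\<Phi> 0) \<le> ennreal (\<Phi> 0 undefined)"
      by (simp add: emeasure_space_1)
  qed (use \<Phi>0 q in auto)
  have \<Phi>_init: "\<Phi> 0 undefined = average fs X0 - m + 3 * c * \<tau> / \<delta> * (\<Sum>j\<in>UNIV. norm (grad (fs j) X0))"
    by (simp add: \<Phi>_def st_def mom_err_def est_err_def nu_def P_def)
  have 2: "(\<Sum>t<T. \<integral>\<^sup>+ \<omega>. ennreal (H t \<omega>) \<partial>base R)
      \<le> expect (\<Phi> T) + (\<Sum>t<T. \<integral>\<^sup>+ \<omega>. ennreal (H t \<omega>) \<partial>base R)"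
    by simp
  from order_trans[OF 2 1] show ?thesis
    unfolding \<Phi>_init H_def st_def lr_def \<kappa>_def iterate_def q_def .
qed

end

text \<open>If every round before T violated the bound, summing would contradict the bound on the
  total. The witness is chosen after the expectations, so it may depend on the random sources
  \<open>R\<close> but not on the outcome.\<close>

lemma generalized_convergence_rate:
  fixes S :: "('l::finite, 'e::finite) shape" and fs :: "'c::finite \<Rightarrow> real ^ 'e \<Rightarrow> real"
    and \<rho> :: "'l \<Rightarrow> real"
  assumes shape: "valid_shape S" and C1: "\<And>j. cont_differentiable (fs j)"
    and smooth: "\<And>j. layer_L0_L1_smooth S (fs j) (L0 j) (L1 j)" and below: "\<And>j X. fcstar j \<le> fs j X"
    and \<rho>: "\<And>i. 0 < \<rho> i"
  shows "\<exists>C\<ge>0. \<forall>T\<ge>1. \<exists>\<eta>>0. \<exists>\<mu>\<in>{0..<1}. \<forall>R :: ('c, 'e, 's, 'w) stochastics. admissible S \<sigma> fs R \<longrightarrow>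
    (\<exists>t<T. (\<Sum>i\<in>UNIV. \<integral>\<^sup>+ \<omega>. ennreal (nuclear_norm (block S (grad (average fs)
        (iterate S EF21_MuonUSign X0 \<mu> (\<lambda>i G. \<eta> * \<rho> i) R t \<omega>)) i)) \<partial>base R)
      \<le> ennreal (C * real T powr (- 1 / 4)))"
proof -
  have diff: "fs j differentiable (at X)" for j X using C1 by (simp add: cont_differentiable_def)
  define m where "m = (\<Sum>j\<in>UNIV. fcstar j) / real CARD('c)"
  obtain a where a: "0 \<le> a" and lower: "\<And>X. m \<le> average fs X"
    and lip: "\<And>j X Y. norm (grad (fs j) X - grad (fs j) Y) \<le> a * (1 + (average fs X - m)) * norm (X - Y)"
    unfolding m_def using generalized_smooth_clients[where S = S and fs = fs, OF shape diff smooth below] by blast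
  obtain \<rho>min \<rho>max where \<rho>b: "0 < \<rho>min" "\<And>i. \<rho>min \<le> \<rho> i" "\<And>i. \<rho> i \<le> \<rho>max"
    using positive_ratio_bounds[of \<rho>, OF \<rho>] by blast
  have \<rho>max: "0 < \<rho>max" using \<rho>b \<rho> less_le_trans by blast
  define N where "N = real CARD('c)"
  define E where "E = real CARD('e)"
  define L where "L = real CARD('l)"
  have NEL: "0 \<le> N" "1 \<le> E" "0 \<le> L" by (simp_all add: N_def E_def L_def Suc_leI)
  define \<delta> where "\<delta> = 1 / (2 * E)"
  have \<delta>: "0 < \<delta>" using NEL by (simp add: \<delta>_def)
  define c where "c = 1 + (\<rho>min + \<rho>max * E * L) + N * a * (E * L * \<rho>max\<^sup>2) + N * a * (E * L * \<rho>max)"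
  have "0 \<le> \<rho>min + \<rho>max * E * L" "0 \<le> N * a * (E * L * \<rho>max\<^sup>2)" "0 \<le> N * a * (E * L * \<rho>max)"
    using NEL a \<rho>b \<rho>max by simp_all
  then have c: "1 \<le> c" "\<rho>min + \<rho>max * E * L \<le> c" "N * a * (E * L * \<rho>max\<^sup>2) \<le> c" "N * a * (E * L * \<rho>max) \<le> c"
    unfolding c_def by linarith+
  define q where "q = c + 3 * c\<^sup>2 / \<delta>"
  define k where "k = (c + 3 * c\<^sup>2 / \<delta> + c * N + 4 * c * N / \<delta>) + N * \<sigma>\<^sup>2 * (6 * c / \<delta>)"
  define \<Phi> where "\<Phi> = average fs X0 - m + 3 * c / \<delta> * (\<Sum>j\<in>UNIV. norm (grad (fs j) X0))"
  have q: "0 \<le> q" using c \<delta> by (simp add: q_def)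
  have k: "0 \<le> k" using c \<delta> NEL by (simp add: k_def)
  have \<Phi>: "0 \<le> \<Phi>"
    unfolding \<Phi>_def using lower[of X0] c \<delta> by (intro add_nonneg_nonneg mult_nonneg_nonneg sum_nonneg) auto
  define C0 where "C0 = exp q * (\<Phi> + k)"
  have C0: "0 \<le> C0" using \<Phi> k by (simp add: C0_def)
  \<comment> \<open>The additional 1 makes the contradiction strict: the assumed lower bound exceeds
    the upper one by \<open>real T * \<tau>\<close>.\<close>
  define C where "C = L * E / \<rho>min * C0 + 1"
  have C: "0 \<le> C" using C0 NEL \<rho>b by (simp add: C_def)
  have "\<exists>\<eta>>0. \<exists>\<mu>\<in>{0..<1}. \<forall>R :: ('c, 'e, 's, 'w) stochastics. admissible S \<sigma> fs R \<longrightarrow>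
    (\<exists>t<T. (\<Sum>i\<in>UNIV. \<integral>\<^sup>+ \<omega>. ennreal (nuclear_norm (block S (grad (average fs)
        (iterate S EF21_MuonUSign X0 \<mu> (\<lambda>i G. \<eta> * \<rho> i) R t \<omega>)) i)) \<partial>base R)
      \<le> ennreal (C * real T powr (- 1 / 4)))" if T: "1 \<le> T" for T
  proof -
    \<comment> \<open>This is the root of the noise level: \<open>real T * \<tau> ^ 4 = 1\<close>
      makes both the growth over T rounds and the accumulated error bounded.\<close>
    define \<tau> where "\<tau> = real T powr (- 1 / 4)"
    have \<tau>: "0 < \<tau>" "\<tau> \<le> 1"
      using T powr_mono[of "- 1 / 4" 0 "real T"] by (auto simp: \<tau>_def)
    have \<tau>4: "real T * \<tau> ^ 4 = 1"
    proof -
      have "\<tau> ^ 4 = real T powr (-1)" using T by (simp add: \<tau>_def powr_powr flip: powr_numeral)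
      then show ?thesis using T by (simp add: powr_minus_divide)
    qed
    define \<eta> where "\<eta> = \<tau> ^ 3"
    have \<eta>: "0 < \<eta>" using \<tau> by (simp add: \<eta>_def)
    have "\<exists>t<T. (\<Sum>i\<in>UNIV. \<integral>\<^sup>+ \<omega>. ennreal (nuclear_norm (block S (grad (average fs)
        (iterate S EF21_MuonUSign X0 (1 - \<tau>\<^sup>2) (\<lambda>i G. \<eta> * \<rho> i) R t \<omega>)) i)) \<partial>base R)
      \<le> ennreal (C * real T powr (- 1 / 4))" if adm: "admissible S \<sigma> fs R" for R :: "('c, 'e, 's, 'w) stochastics"
    proof (rule ccontr)
      interpret stochastic_clients S \<sigma> fs R using shape C1 adm by unfold_locales
      let ?X = "iterate S EF21_MuonUSign X0 (1 - \<tau>\<^sup>2) (\<lambda>i G. \<eta> * \<rho> i) R"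
      let ?h = "\<lambda>t \<omega>. \<rho>min * \<tau> ^ 3 * norm (grad (average fs) (?X t \<omega>))"
      let ?x = "\<lambda>t. \<Sum>i\<in>UNIV. \<integral>\<^sup>+ \<omega>. ennreal (nuclear_norm (block S (grad (average fs) (?X t \<omega>)) i)) \<partial>base R"
      have "(\<Sum>t<T. \<integral>\<^sup>+ \<omega>. ennreal (?h t \<omega>) \<partial>base R)
          \<le> ennreal ((1 + \<tau> ^ 4 * q) ^ T * (average fs X0 - m + 3 * c * \<tau> / \<delta> * (\<Sum>j\<in>UNIV. norm (grad (fs j) X0))
            + real T * (\<tau> ^ 4 * k)))"
        unfolding \<delta>_def E_def N_def q_def k_def \<eta>_def
        by (rule generalized_expected_gradients[OF lower a lip \<tau> \<rho>b c[unfolded E_def N_def L_def]])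
      also have "\<dots> \<le> ennreal C0"
        unfolding C0_def
      proof (intro ennreal_leI mult_mono)
        \<comment> \<open>The gap may grow in every round, but the compounded growth over T rounds
          is at most \<open>exp q\<close>.\<close>
        have "(1 + \<tau> ^ 4 * q) ^ T \<le> exp (\<tau> ^ 4 * q) ^ T"
          using q \<tau> by (intro power_mono exp_ge_add_one_self add_nonneg_nonneg) auto
        also have "\<dots> = exp (real T * \<tau> ^ 4 * q)" by (simp add: exp_of_nat_mult mult.assoc)
        finally show "(1 + \<tau> ^ 4 * q) ^ T \<le> exp q" by (simp add: \<tau>4)
        have "3 * c * \<tau> / \<delta> * (\<Sum>j\<in>UNIV. norm (grad (fs j) X0)) \<le> 3 * c / \<delta> * (\<Sum>j\<in>UNIV. norm (grad (fs j) X0))"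
          using c \<tau> \<delta> by (intro mult_right_mono divide_right_mono sum_nonneg) (auto simp: mult_left_le)
        moreover have "real T * (\<tau> ^ 4 * k) = k" using \<tau>4 by (simp flip: mult.assoc)
        ultimately show "average fs X0 - m + 3 * c * \<tau> / \<delta> * (\<Sum>j\<in>UNIV. norm (grad (fs j) X0)) + real T * (\<tau> ^ 4 * k)
            \<le> \<Phi> + k" unfolding \<Phi>_def by linarith
        show "0 \<le> average fs X0 - m + 3 * c * \<tau> / \<delta> * (\<Sum>j\<in>UNIV. norm (grad (fs j) X0)) + real T * (\<tau> ^ 4 * k)"
          using lower[of X0] c \<tau> \<delta> k by (intro add_nonneg_nonneg mult_nonneg_nonneg sum_nonneg) auto
      qed simp
      finally have sum: "(\<Sum>t<T. \<integral>\<^sup>+ \<omega>. ennreal (?h t \<omega>) \<partial>base R) \<le> ennreal C0" .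
      define b where "b = L * E / (\<rho>min * \<tau> ^ 3)"
      have b: "0 \<le> b" using NEL \<rho>b \<tau> by (simp add: b_def)
      have X_meas: "(\<lambda>\<omega>. ?X t \<omega>) \<in> borel_measurable (base R)" for t
        unfolding iterate_def
        by (rule measurable_past_base[OF state_measurableD(1)[OF muon_state_measurable]])
          (rule measurable_rate_const)
      have h_meas: "(\<lambda>\<omega>. ?h t \<omega>) \<in> borel_measurable (base R)" for t
        using X_meas by measurable
      have x_le: "?x t \<le> ennreal b * (\<integral>\<^sup>+ \<omega>. ennreal (?h t \<omega>) \<partial>base R)" for t
      proof -
        have "?x t \<le> (\<Sum>i\<in>(UNIV :: 'l set). \<integral>\<^sup>+ \<omega>. ennreal (E / (\<rho>min * \<tau> ^ 3)) * ennreal (?h t \<omega>) \<partial>base R)"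
        proof (intro sum_mono nn_integral_mono)
          fix i \<omega>
          have "E / (\<rho>min * \<tau> ^ 3) * ?h t \<omega> = E * norm (grad (average fs) (?X t \<omega>))"
            using \<rho>b \<tau> by simp
          then have "nuclear_norm (block S (grad (average fs) (?X t \<omega>)) i) \<le> E / (\<rho>min * \<tau> ^ 3) * ?h t \<omega>"
            using nuclear_norm_block_le[OF shape] by (simp add: E_def)
          then show "ennreal (nuclear_norm (block S (grad (average fs) (?X t \<omega>)) i))
              \<le> ennreal (E / (\<rho>min * \<tau> ^ 3)) * ennreal (?h t \<omega>)"
            using NEL \<rho>b \<tau> by (subst ennreal_mult[symmetric]) (auto intro!: ennreal_leI)
        qed
        also have "\<dots> = (\<Sum>i\<in>(UNIV :: 'l set). ennreal (E / (\<rho>min * \<tau> ^ 3)) * (\<integral>\<^sup>+ \<omega>. ennreal (?h t \<omega>) \<partial>base R))"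
          by (intro sum.cong refl nn_integral_cmult measurable_compose[OF h_meas measurable_ennreal])
        also have "\<dots> = (ennreal L * ennreal (E / (\<rho>min * \<tau> ^ 3))) * (\<integral>\<^sup>+ \<omega>. ennreal (?h t \<omega>) \<partial>base R)"
          by (simp add: L_def ennreal_of_nat_eq_real_of_nat mult.assoc)
        also have "ennreal L * ennreal (E / (\<rho>min * \<tau> ^ 3)) = ennreal b"
          using NEL \<rho>b \<tau> by (subst ennreal_mult[symmetric]) (auto simp: b_def)
        finally show ?thesis .
      qed
      assume "\<not> (\<exists>t<T. ?x t \<le> ennreal (C * real T powr (- 1 / 4)))"
      then have "ennreal (C * \<tau>) < ?x t" if "t < T" for t using that by (auto simp: not_le \<tau>_def)
      then have "(\<Sum>t<T. ennreal (C * \<tau>)) \<le> (\<Sum>t<T. ?x t)"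
        by (intro sum_mono less_imp_le) auto
      also have "\<dots> \<le> (\<Sum>t<T. ennreal b * (\<integral>\<^sup>+ \<omega>. ennreal (?h t \<omega>) \<partial>base R))"
        by (intro sum_mono x_le)
      also have "\<dots> = ennreal b * (\<Sum>t<T. \<integral>\<^sup>+ \<omega>. ennreal (?h t \<omega>) \<partial>base R)"
        by (simp add: sum_distrib_left)
      also have "\<dots> \<le> ennreal b * ennreal C0" by (intro mult_left_mono sum) simp
      also have "\<dots> = ennreal (b * C0)" using b C0 by (simp add: ennreal_mult)
      finally have "ennreal (real T * (C * \<tau>)) \<le> ennreal (b * C0)"
        using C \<tau> by (simp add: ennreal_of_nat_eq_real_of_nat flip: ennreal_mult)
      then have "real T * (C * \<tau>) \<le> b * C0" using b C0 by (subst (asm) ennreal_le_iff) auto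
      \<comment> \<open>Multiplying \<open>b\<close> by \<open>real T * \<tau> ^ 4\<close>, which is
        1, cancels the cube in its denominator and leaves \<open>real T * \<tau>\<close>.\<close>
      moreover have "real T * (C * \<tau>) = b * C0 + real T * \<tau>"
      proof -
        have "b = b * (real T * \<tau> ^ 4)" by (simp add: \<tau>4)
        also have "\<dots> = L * E / \<rho>min * (real T * \<tau>)"
          using \<tau> \<rho>b by (simp add: b_def numeral_eq_Suc)
        finally have "b * C0 = L * E / \<rho>min * C0 * (real T * \<tau>)" by simp
        then show ?thesis by (simp add: C_def algebra_simps)
      qed
      moreover have "0 < real T * \<tau>" using T \<tau> by simp
      ultimately show False by linarith
    qed
    moreover have "1 - \<tau>\<^sup>2 \<in> {0..<1}" using \<tau> by (auto simp: power_le_one)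
    ultimately show ?thesis using \<eta> by blast
  qed
  then show ?thesis using C by blast
qed

lemma (in stochastic_clients) borel_measurable_iterate:
  assumes "\<And>M :: 'w measure. measurable_rate S lr M"
  shows "iterate S meth X0 \<mu> lr R t \<in> borel_measurable (base R)"
  using measurable_past_base[OF state_measurableD(1)[OF muon_state_measurable[OF assms]]]
  by (simp add: iterate_def[abs_def])

section \<open>Unequal layer constants\<close>

lemma mean_normalized_scale:
  assumes "0 < c"
  shows "mean_normalized (\<lambda>i. c * \<rho> i) i = mean_normalized \<rho> i"
  using assms by (simp add: mean_normalized_def flip: sum_distrib_left)

lemma mean_normalized_bounds:
  fixes \<rho> :: "'l::finite \<Rightarrow> real"
  assumes "\<And>i. 0 < \<rho> i"
  shows "0 \<le> mean_normalized \<rho> i" "mean_normalized \<rho> i \<le> real CARD('l)"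
proof -
  have le: "\<rho> i \<le> (\<Sum>l\<in>UNIV. \<rho> l)" using assms by (intro member_le_sum) (auto simp: less_imp_le)
  then have pos: "0 < (\<Sum>l\<in>UNIV. \<rho> l)" using assms less_le_trans by blast
  then show "0 \<le> mean_normalized \<rho> i" using assms[of i] by (simp add: mean_normalized_def)
  have "real CARD('l) * \<rho> i \<le> real CARD('l) * (\<Sum>l\<in>UNIV. \<rho> l)" using le by (intro mult_left_mono) auto
  then show "mean_normalized \<rho> i \<le> real CARD('l)"
    using pos by (simp add: mean_normalized_def divide_le_eq mult_ac)
qed


text \<open>The normalized weights depend only on the ratios and are at most the number of layers,
  so the unweighted bound carries over with that factor in the constant.\<close>

lemma smooth_convergence_rate_weighted:
  fixes S :: "('l::finite, 'e::finite) shape" and fs :: "'c::finite \<Rightarrow> real ^ 'e \<Rightarrow> real"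
    and \<rho> :: "'l \<Rightarrow> real"
  assumes shape: "valid_shape S" and C1: "\<And>j. cont_differentiable (fs j)"
    and lower: "\<And>X. fstar \<le> average fs X"
    and smooth: "\<And>j. layer_smooth S (fs j) (L j)" and \<rho>: "\<And>i. 0 < \<rho> i"
  shows "\<exists>C::real. \<forall>T\<ge>1. \<exists>c>0. \<exists>\<mu>\<in>{0..<1}. \<forall>R :: ('c, 'e, 's, 'w) stochastics. admissible S \<sigma> fs R \<longrightarrow>
    ennreal (1 / real T) * (\<Sum>t<T. \<Sum>i\<in>UNIV. ennreal (mean_normalized (\<lambda>i. c * \<rho> i) i) *
        (\<integral>\<^sup>+ \<omega>. ennreal ((nuclear_norm (block S (grad (average fs)
          (iterate S meth X0 \<mu> (\<lambda>i G. c * \<rho> i * nuclear_norm G) R t \<omega>)) i))\<^sup>2) \<partial>base R))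
      \<le> ennreal (C * real T powr (- 1 / 2))"
proof -
  have "\<exists>C\<ge>0. \<forall>T\<ge>1. \<exists>\<gamma>>0. \<exists>\<mu>\<in>{0..<1}. \<forall>R :: ('c, 'e, 's, 'w) stochastics. admissible S \<sigma> fs R \<longrightarrow>
    ennreal (1 / real T) * (\<Sum>t<T. \<integral>\<^sup>+ \<omega>. ennreal (nuclear_norm_sq S (grad (average fs)
        (iterate S meth X0 \<mu> (\<lambda>i G. \<gamma> * \<rho> i * nuclear_norm G) R t \<omega>))) \<partial>base R)
      \<le> ennreal (C * real T powr (- 1 / 2))"
    by (rule smooth_convergence_rate[OF shape C1 lower smooth \<rho>])
  then obtain C where C: "0 \<le> C"
    "\<And>T. 1 \<le> T \<Longrightarrow> \<exists>\<gamma>>0. \<exists>\<mu>\<in>{0..<1}. \<forall>R :: ('c, 'e, 's, 'w) stochastics. admissible S \<sigma> fs R \<longrightarrow>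
      ennreal (1 / real T) * (\<Sum>t<T. \<integral>\<^sup>+ \<omega>. ennreal (nuclear_norm_sq S (grad (average fs)
        (iterate S meth X0 \<mu> (\<lambda>i G. \<gamma> * \<rho> i * nuclear_norm G) R t \<omega>))) \<partial>base R)
      \<le> ennreal (C * real T powr (- 1 / 2))" by blast
  let ?p = "real CARD('l)"
  show ?thesis
  proof (rule exI[of _ "?p * C"], intro allI impI)
    fix T :: nat assume "1 \<le> T"
    from C(2)[OF this] obtain \<gamma> \<mu> where \<gamma>: "0 < \<gamma>" and \<mu>: "\<mu> \<in> {0..<1}"
      and bound: "\<And>R :: ('c, 'e, 's, 'w) stochastics. admissible S \<sigma> fs R \<Longrightarrow>
        ennreal (1 / real T) * (\<Sum>t<T. \<integral>\<^sup>+ \<omega>. ennreal (nuclear_norm_sq S (grad (average fs)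
          (iterate S meth X0 \<mu> (\<lambda>i G. \<gamma> * \<rho> i * nuclear_norm G) R t \<omega>))) \<partial>base R)
        \<le> ennreal (C * real T powr (- 1 / 2))" by blast
    have "ennreal (1 / real T) * (\<Sum>t<T. \<Sum>i\<in>UNIV. ennreal (mean_normalized (\<lambda>i. \<gamma> * \<rho> i) i) *
          (\<integral>\<^sup>+ \<omega>. ennreal ((nuclear_norm (block S (grad (average fs)
            (iterate S meth X0 \<mu> (\<lambda>i G. \<gamma> * \<rho> i * nuclear_norm G) R t \<omega>)) i))\<^sup>2) \<partial>base R))
        \<le> ennreal (?p * C * real T powr (- 1 / 2))" if adm: "admissible S \<sigma> fs R" for R :: "('c, 'e, 's, 'w) stochastics"
    proof -
      interpret stochastic_clients S \<sigma> fs R using shape C1 adm by unfold_locales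
      let ?g = "\<lambda>t \<omega>. grad (average fs) (iterate S meth X0 \<mu> (\<lambda>i G. \<gamma> * \<rho> i * nuclear_norm G) R t \<omega>)"
      let ?n = "\<lambda>t i \<omega>. (nuclear_norm (block S (?g t \<omega>) i))\<^sup>2"
      have "iterate S meth X0 \<mu> (\<lambda>i G. \<gamma> * \<rho> i * nuclear_norm G) R t \<in> borel_measurable (base R)" for t
        by (rule borel_measurable_iterate[OF measurable_rate_nuclear_norm])
      then have "?g t \<in> borel_measurable (base R)" for t by measurable
      note [measurable] = borel_measurable_nuclear_norm_block[OF this]
      have round: "(\<Sum>i\<in>UNIV. ennreal (mean_normalized (\<lambda>i. \<gamma> * \<rho> i) i) * (\<integral>\<^sup>+ \<omega>. ennreal (?n t i \<omega>) \<partial>base R))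
          \<le> ennreal ?p * (\<integral>\<^sup>+ \<omega>. ennreal (nuclear_norm_sq S (?g t \<omega>)) \<partial>base R)" for t
      proof -
        have "(\<Sum>i\<in>UNIV. ennreal (mean_normalized (\<lambda>i. \<gamma> * \<rho> i) i) * (\<integral>\<^sup>+ \<omega>. ennreal (?n t i \<omega>) \<partial>base R))
            \<le> (\<Sum>i\<in>UNIV. ennreal ?p * (\<integral>\<^sup>+ \<omega>. ennreal (?n t i \<omega>) \<partial>base R))"
          using mean_normalized_bounds[of \<rho>, OF \<rho>]
          by (intro sum_mono mult_right_mono ennreal_leI) (auto simp: mean_normalized_scale[OF \<gamma>])
        also have "\<dots> = ennreal ?p * (\<integral>\<^sup>+ \<omega>. (\<Sum>i\<in>UNIV. ennreal (?n t i \<omega>)) \<partial>base R)"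
          by (subst nn_integral_sum) (auto simp: sum_distrib_left)
        also have "(\<integral>\<^sup>+ \<omega>. (\<Sum>i\<in>UNIV. ennreal (?n t i \<omega>)) \<partial>base R)
            = (\<integral>\<^sup>+ \<omega>. ennreal (nuclear_norm_sq S (?g t \<omega>)) \<partial>base R)"
          by (simp add: nuclear_norm_sq_def)
        finally show ?thesis .
      qed
      have "ennreal (1 / real T) * (\<Sum>t<T. \<Sum>i\<in>UNIV. ennreal (mean_normalized (\<lambda>i. \<gamma> * \<rho> i) i) *
            (\<integral>\<^sup>+ \<omega>. ennreal (?n t i \<omega>) \<partial>base R))
          \<le> ennreal (1 / real T) * (\<Sum>t<T. ennreal ?p * (\<integral>\<^sup>+ \<omega>. ennreal (nuclear_norm_sq S (?g t \<omega>)) \<partial>base R))"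
        by (intro mult_left_mono sum_mono round) auto
      also have "\<dots> = ennreal ?p * (ennreal (1 / real T) * (\<Sum>t<T. \<integral>\<^sup>+ \<omega>. ennreal (nuclear_norm_sq S (?g t \<omega>)) \<partial>base R))"
        by (simp only: sum_distrib_left[symmetric] mult.left_commute)
      also have "\<dots> \<le> ennreal ?p * ennreal (C * real T powr (- 1 / 2))"
        by (intro mult_left_mono bound[OF adm]) simp
      also have "\<dots> = ennreal (?p * C * real T powr (- 1 / 2))"
        using C(1) by (subst ennreal_mult[symmetric]) (auto simp: mult.assoc)
      finally show ?thesis .
    qed
    with \<gamma> \<mu> show "\<exists>c>0. \<exists>\<mu>\<in>{0..<1}. \<forall>R :: ('c, 'e, 's, 'w) stochastics. admissible S \<sigma> fs R \<longrightarrow>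
      ennreal (1 / real T) * (\<Sum>t<T. \<Sum>i\<in>UNIV. ennreal (mean_normalized (\<lambda>i. c * \<rho> i) i) *
        (\<integral>\<^sup>+ \<omega>. ennreal ((nuclear_norm (block S (grad (average fs)
          (iterate S meth X0 \<mu> (\<lambda>i G. c * \<rho> i * nuclear_norm G) R t \<omega>)) i))\<^sup>2) \<partial>base R))
      \<le> ennreal (?p * C * real T powr (- 1 / 2))" by blast
  qed
qed

lemma generalized_convergence_rate_weighted:
  fixes S :: "('l::finite, 'e::finite) shape" and fs :: "'c::finite \<Rightarrow> real ^ 'e \<Rightarrow> real"
    and \<rho> :: "'l \<Rightarrow> real"
  assumes shape: "valid_shape S" and C1: "\<And>j. cont_differentiable (fs j)"
    and smooth: "\<And>j. layer_L0_L1_smooth S (fs j) (L0 j) (L1 j)" and below: "\<And>j X. fcstar j \<le> fs j X"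
    and \<rho>: "\<And>i. 0 < \<rho> i"
  shows "\<exists>C::real. \<forall>T\<ge>1. \<exists>c>0. \<exists>\<mu>\<in>{0..<1}. \<forall>R :: ('c, 'e, 's, 'w) stochastics. admissible S \<sigma> fs R \<longrightarrow>
    Min ((\<lambda>t. \<Sum>i\<in>UNIV. ennreal (mean_normalized (\<lambda>i. c * \<rho> i) i) *
        (\<integral>\<^sup>+ \<omega>. ennreal (nuclear_norm (block S (grad (average fs)
          (iterate S EF21_MuonUSign X0 \<mu> (\<lambda>i G. c * \<rho> i) R t \<omega>)) i)) \<partial>base R)) ` {0..T})
      \<le> ennreal (C * real T powr (- 1 / 4))"
proof -
  have "\<exists>C\<ge>0. \<forall>T\<ge>1. \<exists>\<eta>>0. \<exists>\<mu>\<in>{0..<1}. \<forall>R :: ('c, 'e, 's, 'w) stochastics. admissible S \<sigma> fs R \<longrightarrow>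
    (\<exists>t<T. (\<Sum>i\<in>UNIV. \<integral>\<^sup>+ \<omega>. ennreal (nuclear_norm (block S (grad (average fs)
        (iterate S EF21_MuonUSign X0 \<mu> (\<lambda>i G. \<eta> * \<rho> i) R t \<omega>)) i)) \<partial>base R)
      \<le> ennreal (C * real T powr (- 1 / 4)))"
    by (rule generalized_convergence_rate[OF shape C1 smooth below \<rho>])
  then obtain C where C: "0 \<le> C"
    "\<And>T. 1 \<le> T \<Longrightarrow> \<exists>\<eta>>0. \<exists>\<mu>\<in>{0..<1}. \<forall>R :: ('c, 'e, 's, 'w) stochastics. admissible S \<sigma> fs R \<longrightarrow>
    (\<exists>t<T. (\<Sum>i\<in>UNIV. \<integral>\<^sup>+ \<omega>. ennreal (nuclear_norm (block S (grad (average fs)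
        (iterate S EF21_MuonUSign X0 \<mu> (\<lambda>i G. \<eta> * \<rho> i) R t \<omega>)) i)) \<partial>base R)
      \<le> ennreal (C * real T powr (- 1 / 4)))" by blast
  let ?p = "real CARD('l)"
  show ?thesis
  proof (rule exI[of _ "?p * C"], intro allI impI)
    fix T :: nat assume "1 \<le> T"
    from C(2)[OF this] obtain \<eta> \<mu> where \<eta>: "0 < \<eta>" and \<mu>: "\<mu> \<in> {0..<1}"
      and bound: "\<And>R :: ('c, 'e, 's, 'w) stochastics. admissible S \<sigma> fs R \<Longrightarrow>
        \<exists>t<T. (\<Sum>i\<in>UNIV. \<integral>\<^sup>+ \<omega>. ennreal (nuclear_norm (block S (grad (average fs)
          (iterate S EF21_MuonUSign X0 \<mu> (\<lambda>i G. \<eta> * \<rho> i) R t \<omega>)) i)) \<partial>base R)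
        \<le> ennreal (C * real T powr (- 1 / 4))" by blast
    have "Min ((\<lambda>t. \<Sum>i\<in>UNIV. ennreal (mean_normalized (\<lambda>i. \<eta> * \<rho> i) i) *
        (\<integral>\<^sup>+ \<omega>. ennreal (nuclear_norm (block S (grad (average fs)
          (iterate S EF21_MuonUSign X0 \<mu> (\<lambda>i G. \<eta> * \<rho> i) R t \<omega>)) i)) \<partial>base R)) ` {0..T})
      \<le> ennreal (?p * C * real T powr (- 1 / 4))" if adm: "admissible S \<sigma> fs R" for R :: "('c, 'e, 's, 'w) stochastics"
    proof -
      let ?n = "\<lambda>t i. \<integral>\<^sup>+ \<omega>. ennreal (nuclear_norm (block S (grad (average fs)
          (iterate S EF21_MuonUSign X0 \<mu> (\<lambda>i G. \<eta> * \<rho> i) R t \<omega>)) i)) \<partial>base R"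
      let ?v = "\<lambda>t. \<Sum>i\<in>UNIV. ennreal (mean_normalized (\<lambda>i. \<eta> * \<rho> i) i) * ?n t i"
      obtain t where t: "t < T" and le: "(\<Sum>i\<in>UNIV. ?n t i) \<le> ennreal (C * real T powr (- 1 / 4))"
        using bound[OF adm] by blast
      \<comment> \<open>The unweighted result provides a round strictly before T, which lies in the
        larger range of the minimum.\<close>
      have "Min (?v ` {0..T}) \<le> ?v t" using t by (intro Min_le) auto
      also have "\<dots> \<le> (\<Sum>i\<in>UNIV. ennreal ?p * ?n t i)"
        using mean_normalized_bounds[of \<rho>, OF \<rho>]
        by (intro sum_mono mult_right_mono ennreal_leI) (auto simp: mean_normalized_scale[OF \<eta>])
      also have "\<dots> = ennreal ?p * (\<Sum>i\<in>UNIV. ?n t i)" by (rule sum_distrib_left[symmetric])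
      also have "\<dots> \<le> ennreal ?p * ennreal (C * real T powr (- 1 / 4))"
        by (intro mult_left_mono le) simp
      also have "\<dots> = ennreal (?p * C * real T powr (- 1 / 4))"
        using C(1) by (subst ennreal_mult[symmetric]) (auto simp: mult.assoc)
      finally show ?thesis .
    qed
    with \<eta> \<mu> show "\<exists>c>0. \<exists>\<mu>\<in>{0..<1}. \<forall>R :: ('c, 'e, 's, 'w) stochastics. admissible S \<sigma> fs R \<longrightarrow>
      Min ((\<lambda>t. \<Sum>i\<in>UNIV. ennreal (mean_normalized (\<lambda>i. c * \<rho> i) i) *
        (\<integral>\<^sup>+ \<omega>. ennreal (nuclear_norm (block S (grad (average fs)
          (iterate S EF21_MuonUSign X0 \<mu> (\<lambda>i G. c * \<rho> i) R t \<omega>)) i)) \<partial>base R)) ` {0..T})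
      \<le> ennreal (?p * C * real T powr (- 1 / 4))" by blast
  qed
qed

lemma mean_normalized_const: "c \<noteq> 0 \<Longrightarrow> mean_normalized (\<lambda>i::'l::finite. c) = (\<lambda>i. 1)"
  by (simp add: mean_normalized_def fun_eq_iff)

theorem theorem5:
  fixes S :: "('l::finite, 'e::finite) shape"
    and fs :: "'c::finite \<Rightarrow> real ^ 'e \<Rightarrow> real"
    and X0 :: "real ^ 'e"
    and fstar \<sigma> :: real
  defines "f \<equiv> average fs"
  assumes shape: "valid_shape S"
    and C1: "\<And>j. cont_differentiable (fs j)"
    and lower: "\<And>X. fstar \<le> f X"
  shows
    "(\<forall>(L :: 'l \<Rightarrow> real) (Lc :: 'c \<Rightarrow> 'l \<Rightarrow> real).
        layer_smooth S f L \<and> (\<forall>j. layer_smooth S (fs j) (Lc j)) \<longrightarrow>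
        (\<forall>meth.
          (\<exists>C::real. \<forall>T\<ge>1. \<exists>\<gamma>>0. \<exists>\<mu>\<in>{0..<1}.
             \<forall>R :: ('c, 'e, 's, 'w) stochastics. admissible S \<sigma> fs R \<longrightarrow>
               (let X = iterate S meth X0 \<mu> (\<lambda>i G. \<gamma> * nuclear_norm G) R in
                 ennreal (1 / real T) * (\<Sum>t<T.
                   \<integral>\<^sup>+ \<omega>. ennreal (nuclear_norm_sq S (grad f (X t \<omega>))) \<partial>base R)
                 \<le> ennreal (C * real T powr (- 1 / 2)))) \<and>
          (\<forall>\<rho> :: 'l \<Rightarrow> real. (\<forall>i. 0 < \<rho> i) \<longrightarrow>
            (\<exists>C::real. \<forall>T\<ge>1. \<exists>c>0. \<exists>\<mu>\<in>{0..<1}.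
               \<forall>R :: ('c, 'e, 's, 'w) stochastics. admissible S \<sigma> fs R \<longrightarrow>
                 (let \<gamma> = (\<lambda>i. c * \<rho> i);
                      w = mean_normalized \<gamma>;
                      X = iterate S meth X0 \<mu> (\<lambda>i G. \<gamma> i * nuclear_norm G) R in
                   ennreal (1 / real T) * (\<Sum>t<T. \<Sum>i\<in>UNIV. ennreal (w i) *
                     (\<integral>\<^sup>+ \<omega>. ennreal ((nuclear_norm (block S (grad f (X t \<omega>)) i))\<^sup>2) \<partial>base R))
                   \<le> ennreal (C * real T powr (- 1 / 2)))))))
     \<and>
     (\<forall>(L0 :: 'l \<Rightarrow> real) (L1 :: 'l \<Rightarrow> real)
        (Lc0 :: 'c \<Rightarrow> 'l \<Rightarrow> real) (Lc1 :: 'c \<Rightarrow> 'l \<Rightarrow> real) (fcstar :: 'c \<Rightarrow> real).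
        layer_L0_L1_smooth S f L0 L1 \<and>
        (\<forall>j. layer_L0_L1_smooth S (fs j) (Lc0 j) (Lc1 j)) \<and>
        (\<forall>j X. fcstar j \<le> fs j X) \<longrightarrow>
          (\<exists>C::real. \<forall>T\<ge>1. \<exists>\<eta>>0. \<exists>\<mu>\<in>{0..<1}.
             \<forall>R :: ('c, 'e, 's, 'w) stochastics. admissible S \<sigma> fs R \<longrightarrow>
               (let X = iterate S EF21_MuonUSign X0 \<mu> (\<lambda>i G. \<eta>) R in
                 Min ((\<lambda>t. \<Sum>i\<in>UNIV.
                   \<integral>\<^sup>+ \<omega>. ennreal (nuclear_norm (block S (grad f (X t \<omega>)) i)) \<partial>base R) ` {0..T})
                 \<le> ennreal (C * real T powr (- 1 / 4)))) \<and>
          (\<forall>\<rho> :: 'l \<Rightarrow> real. (\<forall>i. 0 < \<rho> i) \<longrightarrow>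
            (\<exists>C::real. \<forall>T\<ge>1. \<exists>c>0. \<exists>\<mu>\<in>{0..<1}.
               \<forall>R :: ('c, 'e, 's, 'w) stochastics. admissible S \<sigma> fs R \<longrightarrow>
                 (let \<eta> = (\<lambda>i. c * \<rho> i);
                      v = mean_normalized \<eta>;
                      X = iterate S EF21_MuonUSign X0 \<mu> (\<lambda>i G. \<eta> i) R in
                   Min ((\<lambda>t. \<Sum>i\<in>UNIV. ennreal (v i) *
                     (\<integral>\<^sup>+ \<omega>. ennreal (nuclear_norm (block S (grad f (X t \<omega>)) i)) \<partial>base R)) ` {0..T})
                   \<le> ennreal (C * real T powr (- 1 / 4))))))"
proof -
  have weaken: "\<exists>C. P C" if "\<exists>C\<ge>0. P C" for P :: "real \<Rightarrow> bool" using that by blast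
  have lower': "fstar \<le> average fs X" for X using lower by (simp add: f_def)
  show ?thesis
    unfolding f_def Let_def
  proof (intro conjI allI impI, goal_cases)
    case (1 L Lc meth)
    then have smooth: "layer_smooth S (fs j) (Lc j)" for j by blast
    show ?case
      by (rule weaken, rule smooth_convergence_rate[where \<rho> = "\<lambda>_. 1", unfolded mult_1_right])
        (use shape C1 lower' smooth in auto)
  next
    case (2 L Lc meth \<rho>)
    then have smooth: "layer_smooth S (fs j) (Lc j)" and \<rho>: "0 < \<rho> i" for j i by blast+
    show ?case by (rule smooth_convergence_rate_weighted[OF shape C1 lower' smooth \<rho>])
  next
    case (3 L0 L1 Lc0 Lc1 fcstar)
    then have smooth: "layer_L0_L1_smooth S (fs j) (Lc0 j) (Lc1 j)" and below: "fcstar j \<le> fs j X" for j X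
      by blast+
    \<comment> \<open>A common rate is the case of equal ratios, in which every normalized weight is
      1.\<close>
    have "\<exists>C::real. \<forall>T\<ge>1. \<exists>c>0. \<exists>\<mu>\<in>{0..<1}. \<forall>R :: ('c, 'e, 's, 'w) stochastics. admissible S \<sigma> fs R \<longrightarrow>
      Min ((\<lambda>t. \<Sum>i\<in>UNIV. ennreal (mean_normalized (\<lambda>i. c * 1) i) *
          (\<integral>\<^sup>+ \<omega>. ennreal (nuclear_norm (block S (grad (average fs)
            (iterate S EF21_MuonUSign X0 \<mu> (\<lambda>i G. c * 1) R t \<omega>)) i)) \<partial>base R)) ` {0..T})
        \<le> ennreal (C * real T powr (- 1 / 4))"
      by (rule generalized_convergence_rate_weighted[where \<rho> = "\<lambda>_. 1"])
        (use shape C1 smooth below in auto)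
    then show ?case by (simp add: mean_normalized_const cong: bex_cong conj_cong)
  next
    case (4 L0 L1 Lc0 Lc1 fcstar \<rho>)
    then have smooth: "layer_L0_L1_smooth S (fs j) (Lc0 j) (Lc1 j)" and below: "fcstar j \<le> fs j X"
      and \<rho>: "0 < \<rho> i" for j X i by blast+
    show ?case by (rule generalized_convergence_rate_weighted[OF shape C1 smooth below \<rho>])
  qed
qed

end
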